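(* Let $\mathcal A$ be an abelian category. (1) There is a one to one correspondence between torsion model structures on $\mathcal A$ and twin torsion pairs in $\mathcal A$. Explicitly, $$\Phi:\{\text{twin torsion pairs in }\mathcal A\}\longrightarrow\{\text{torsion model structures on }\mathcal A\},\quad(\mathcal T_1,\mathcal F_1,t_1,r_1;\mathcal T_2,\mathcal F_2,t_2,r_2)\longmapsto(\mathrm{CoFib},\mathrm{Fib},\mathrm{Weq})$$ is a bijection, where $$\mathrm{CoFib}=\{f\mid r_1(f)\text{ is an isomorphism}\},\quad \mathrm{Fib}=\{f\mid t_2(f)\text{ is an isomorphism}\},\quad\mathrm{Weq}=\{f\mid H(f)\text{ is an isomorphism}\}$$ with $f$ ranging over $\mathrm{Mor}(\mathcal A)$ and $H\cong t_1\circ r_2\cong r_2\circ t_1:\mathcal A\to\mathcal T_1\cap\mathcal F_2$; and the inverse is $\Psi:(\mathrm{CoFib},\mathrm{Fib},\mathrm{Weq})\longmapsto(\mathcal T_1,\mathcal F_1;\mathcal T_2,\mathcal F_2)$, where $$\mathcal T_1=\{X\mid 0\to X\text{ is in }\mathrm{CoFib}\},\quad\mathcal F_1=\{X\mid X\to0\text{ is in }\mathrm{TFib}\},$$ $$\mathcal T_2=\{X\mid 0\to X\text{ is in }\mathrm{TCoFib}\},\quad\mathcal F_2=\{X\mid X\to 0\text{ is in }\mathrm{Fib}\}.$$ (2) Any torsion model structure on $\mathcal A$ is a bi-reflective model structure. (3) Let $(\mathrm{CoFib},\mathrm{Fib},\mathrm{Weq})$ be a torsion model structure given by a twin torsion pair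 $(\mathcal T_1,\mathcal F_1;\mathcal T_2,\mathcal F_2)$. Then the class of cofibrant objects is $\mathcal T_1$, the class of fibrant objects is $\mathcal F_2$, and the class of trivial objects is $$\mathcal T_2*\mathcal F_1:=\{X\in\mathcal A\mid\exists\text{ an exact sequence }0\to T_2\to X\to F_1\to0,\ T_2\in\mathcal T_2,\ F_1\in\mathcal F_1\}.$$ The homotopy category $\mathrm{Ho}(\mathcal A)$ is a quasi-abelian category, and it is equivalent to $\mathcal T_1\cap\mathcal F_2$ as a category. In particular, every torsion class and every torsion-free class of $\mathcal A$ can be realized (up to equivalence) as the homotopy category of a torsion model structure.
   Context: Torsion pairs: a torsion pair in $\mathcal A$ is a pair $(\mathcal T,\mathcal F)$ of full subcategories (closed under isomorphisms), the torsion class and the torsion-free class, such that $\mathrm{Hom}_{\mathcal A}(T,F)=0$ for $T\in\mathcal T$, $F\in\mathcal F$, and every $X\in\mathcal A$ admits an exact sequence $0\to t(X)\to X\to r(X)\to0$ with $t(X)\in\mathcal T$, $r(X)\in\mathcal F$. Fixing such a sequence for each $X$ gives functors $t:\mathcal A\to\mathcal T$, $r:\mathcal A\to\mathcal F$; one writes $(\mathcal T,\mathcal F,t,r)$. A twin torsion pair is a quadruple $(\mathcal T_1,\mathcal F_1;\mathcal T_2,\mathcal F_2)$, also written $(\mathcal T_1,\mathcal F_1,t_1,r_1;\mathcal T_2,\mathcal F_2,t_2,r_2)$, where $(\mathcal T_1,\mathcal F_1)$, $(\mathcal T_2,\mathcal F_2)$ are torsion pairs with $\mathcal T_2\subseteq\mathcal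 T_1$. A class of morphisms has the two-out-of-three property if whenever two of $f,g,g\circ f$ lie in it so does the third. A model structure on a category $\mathcal A$ is a triple $(\mathrm{CoFib},\mathrm{Fib},\mathrm{Weq})$ of classes of morphisms such that, with $\mathrm{TCoFib}:=\mathrm{CoFib}\cap\mathrm{Weq}$ and $\mathrm{TFib}:=\mathrm{Fib}\cap\mathrm{Weq}$: (CM1) $\mathrm{Weq}$ has the two-out-of-three property; (CM2) the three classes are closed under retracts; (CM3) every commutative square from $i$ to $p$ with $i\in\mathrm{TCoFib}$, $p\in\mathrm{Fib}$ or $i\in\mathrm{CoFib}$, $p\in\mathrm{TFib}$ has a lifting; (CM4) every morphism factors as $p\circ i$ with $i\in\mathrm{TCoFib}$, $p\in\mathrm{Fib}$ and as $q\circ j$ with $j\in\mathrm{CoFib}$, $q\in\mathrm{TFib}$. It is orthogonal if the liftings in (CM3) are unique. A torsion model structure is an orthogonal model structure such that $\mathrm{CoFib}$ and $\mathrm{Fib}$ have the two-out-of-three property. $\mathrm{Ho}(\mathcal A)=\mathcal A[\mathrm{Weq}^{-1}]$. An object $X$ is cofibrant if $0\to X$ is in $\mathrm{CoFib}$, fibrant if $X\to0$ is in $\mathrm{Fib}$, trivial if $0\to X$ is in $\mathrm{Weq}$. (In a category with zero object carrying an orthogonal model structure, these notions of cofibrant/fibrant agree with the unique-lifting ones: $C$ is cofibrant iff maps out of $C$ lift uniquely along every morphism of $\mathrm{TFib}$, and dually.) A bi-reflective model structure is an orthogonal model structure such that: (M1) there are enough cofibrant objects (for every $A$ a morphism $C\to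 A$ in $\mathrm{TFib}$ with $C$ cofibrant) and enough fibrant objects (for every $A$ a morphism $A\to F$ in $\mathrm{TCoFib}$ with $F$ fibrant); (M2) $\mathrm{TCoFib}$ and $\mathrm{TFib}$ have the two-out-of-three property; (M3) for every $p:C\to D$ in $\mathrm{TFib}$ with $C$ cofibrant and every $u:C\to E$ in $\mathrm{CoFib}$, the pushout of $p$ along $u$ exists and the coprojection $E\to Q$ is in $\mathrm{TFib}$; (M3') for every $i:X\to Z$ in $\mathrm{TCoFib}$ with $Z$ fibrant and every $v:Y\to Z$ in $\mathrm{Fib}$, the pullback of $i$ along $v$ exists and the projection $P\to Y$ is in $\mathrm{TCoFib}$. *)

theory Defs
  imports "HOL-Algebra.Group"
begin

section \<open>Categories\<close>

text \<open>The composite \<open>g \<odot>\<^bsub>C\<^esub> f\<close> means \<open>f\<close> first, then \<open>g\<close>; it is only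
  meaningful when \<open>Cod C f = Dom C g\<close>.\<close>

record ('o, 'm) cat =
  Ob :: "'o set"
  Ar :: "'m set"
  Dom :: "'m \<Rightarrow> 'o"
  Cod :: "'m \<Rightarrow> 'o"
  Ident :: "'o \<Rightarrow> 'm"
  Cmp :: "'m \<Rightarrow> 'm \<Rightarrow> 'm"  (infixl "\<odot>\<index>" 70)

definition Hom :: "('o, 'm) cat \<Rightarrow> 'o \<Rightarrow> 'o \<Rightarrow> 'm set" where
  "Hom C X Y = {f \<in> Ar C. Dom C f = X \<and> Cod C f = Y}"

locale category =
  fixes C :: "('o, 'm) cat" (structure)
  assumes Dom_Ob: "f \<in> Ar C \<Longrightarrow> Dom C f \<in> Ob C"
    and Cod_Ob: "f \<in> Ar C \<Longrightarrow> Cod C f \<in> Ob C"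
    and Ident_Hom: "X \<in> Ob C \<Longrightarrow> Ident C X \<in> Hom C X X"
    and Cmp_Hom: "f \<in> Hom C X Y \<Longrightarrow> g \<in> Hom C Y Z \<Longrightarrow> g \<odot> f \<in> Hom C X Z"
    and Ident_left: "f \<in> Hom C X Y \<Longrightarrow> Ident C Y \<odot> f = f"
    and Ident_right: "f \<in> Hom C X Y \<Longrightarrow> f \<odot> Ident C X = f"
    and Cmp_assoc: "f \<in> Hom C W X \<Longrightarrow> g \<in> Hom C X Y \<Longrightarrow> h \<in> Hom C Y Z \<Longrightarrow>
      (h \<odot> g) \<odot> f = h \<odot> (g \<odot> f)"

definition iso_arrow :: "('o, 'm) cat \<Rightarrow> 'm \<Rightarrow> bool" where
  "iso_arrow C f \<longleftrightarrow> f \<in> Ar C \<and>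
     (\<exists>g \<in> Hom C (Cod C f) (Dom C f).
        g \<odot>\<^bsub>C\<^esub> f = Ident C (Dom C f) \<and> f \<odot>\<^bsub>C\<^esub> g = Ident C (Cod C f))"

definition isomorphic :: "('o, 'm) cat \<Rightarrow> 'o \<Rightarrow> 'o \<Rightarrow> bool" where
  "isomorphic C X Y \<longleftrightarrow> (\<exists>f \<in> Hom C X Y. iso_arrow C f)"

definition mono_arrow :: "('o, 'm) cat \<Rightarrow> 'm \<Rightarrow> bool" where
  "mono_arrow C f \<longleftrightarrow> f \<in> Ar C \<and>
     (\<forall>g \<in> Ar C. \<forall>h \<in> Ar C. Dom C g = Dom C h \<and> Cod C g = Dom C f \<and> Cod C h = Dom C f \<and>
        f \<odot>\<^bsub>C\<^esub> g = f \<odot>\<^bsub>C\<^esub> h \<longrightarrow> g = h)"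

definition epi_arrow :: "('o, 'm) cat \<Rightarrow> 'm \<Rightarrow> bool" where
  "epi_arrow C f \<longleftrightarrow> f \<in> Ar C \<and>
     (\<forall>g \<in> Ar C. \<forall>h \<in> Ar C. Cod C g = Cod C h \<and> Dom C g = Cod C f \<and> Dom C h = Cod C f \<and>
        g \<odot>\<^bsub>C\<^esub> f = h \<odot>\<^bsub>C\<^esub> f \<longrightarrow> g = h)"

definition full_subcat :: "('o, 'm) cat \<Rightarrow> 'o set \<Rightarrow> ('o, 'm) cat" where
  "full_subcat C S =
     C\<lparr>Ob := Ob C \<inter> S, Ar := {f \<in> Ar C. Dom C f \<in> S \<and> Cod C f \<in> S}\<rparr>"

definition is_pullback :: "('o, 'm) cat \<Rightarrow> 'm \<Rightarrow> 'm \<Rightarrow> 'm \<Rightarrow> 'm \<Rightarrow> bool" where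
  \<comment> \<open>\<open>p\<close>, \<open>q\<close> are the projections with \<open>f \<circ> p = g \<circ> q\<close>\<close>
  "is_pullback C f g p q \<longleftrightarrow>
     f \<in> Ar C \<and> g \<in> Ar C \<and> p \<in> Ar C \<and> q \<in> Ar C \<and> Cod C f = Cod C g \<and>
     Dom C p = Dom C q \<and> Cod C p = Dom C f \<and> Cod C q = Dom C g \<and>
     f \<odot>\<^bsub>C\<^esub> p = g \<odot>\<^bsub>C\<^esub> q \<and>
     (\<forall>a \<in> Ar C. \<forall>b \<in> Ar C. Dom C a = Dom C b \<and> Cod C a = Dom C f \<and> Cod C b = Dom C g \<and>
        f \<odot>\<^bsub>C\<^esub> a = g \<odot>\<^bsub>C\<^esub> b \<longrightarrow>
        (\<exists>!u. u \<in> Hom C (Dom C a) (Dom C p) \<and> p \<odot>\<^bsub>C\<^esub> u = a \<and> q \<odot>\<^bsub>C\<^esub> u = b))"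

definition is_pushout :: "('o, 'm) cat \<Rightarrow> 'm \<Rightarrow> 'm \<Rightarrow> 'm \<Rightarrow> 'm \<Rightarrow> bool" where
  \<comment> \<open>\<open>i\<close>, \<open>j\<close> are the coprojections with \<open>i \<circ> f = j \<circ> g\<close>\<close>
  "is_pushout C f g i j \<longleftrightarrow>
     f \<in> Ar C \<and> g \<in> Ar C \<and> i \<in> Ar C \<and> j \<in> Ar C \<and> Dom C f = Dom C g \<and>
     Cod C i = Cod C j \<and> Dom C i = Cod C f \<and> Dom C j = Cod C g \<and>
     i \<odot>\<^bsub>C\<^esub> f = j \<odot>\<^bsub>C\<^esub> g \<and>
     (\<forall>a \<in> Ar C. \<forall>b \<in> Ar C. Cod C a = Cod C b \<and> Dom C a = Cod C f \<and> Dom C b = Cod C g \<and>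
        a \<odot>\<^bsub>C\<^esub> f = b \<odot>\<^bsub>C\<^esub> g \<longrightarrow>
        (\<exists>!u. u \<in> Hom C (Cod C i) (Cod C a) \<and> u \<odot>\<^bsub>C\<^esub> i = a \<and> u \<odot>\<^bsub>C\<^esub> j = b))"


section \<open>Functors, natural isomorphisms, equivalences\<close>

record ('o, 'm, 'p, 'n) ftor =
  FO :: "'o \<Rightarrow> 'p"
  FM :: "'m \<Rightarrow> 'n"

definition is_functor ::
  "('o, 'm) cat \<Rightarrow> ('p, 'n) cat \<Rightarrow> ('o, 'm, 'p, 'n) ftor \<Rightarrow> bool" where
  "is_functor C D F \<longleftrightarrow>
     (\<forall>X \<in> Ob C. FO F X \<in> Ob D) \<and>
     (\<forall>f \<in> Ar C. FM F f \<in> Hom D (FO F (Dom C f)) (FO F (Cod C f))) \<and>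
     (\<forall>X \<in> Ob C. FM F (Ident C X) = Ident D (FO F X)) \<and>
     (\<forall>f \<in> Ar C. \<forall>g \<in> Ar C. Cod C f = Dom C g \<longrightarrow>
        FM F (g \<odot>\<^bsub>C\<^esub> f) = FM F g \<odot>\<^bsub>D\<^esub> FM F f)"

definition id_functor :: "('o, 'm, 'o, 'm) ftor" where
  "id_functor = \<lparr>FO = (\<lambda>X. X), FM = (\<lambda>f. f)\<rparr>"

definition comp_functor ::
  "('p, 'n, 'q, 'k) ftor \<Rightarrow> ('o, 'm, 'p, 'n) ftor \<Rightarrow> ('o, 'm, 'q, 'k) ftor" where
  "comp_functor G F = \<lparr>FO = FO G \<circ> FO F, FM = FM G \<circ> FM F\<rparr>"

definition nat_isomorphic ::
  "('o, 'm) cat \<Rightarrow> ('p, 'n) cat \<Rightarrow> ('o, 'm, 'p, 'n) ftor \<Rightarrow> ('o, 'm, 'p, 'n) ftor \<Rightarrow> bool" where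
  "nat_isomorphic C D F G \<longleftrightarrow> is_functor C D F \<and> is_functor C D G \<and>
     (\<exists>\<alpha>. (\<forall>X \<in> Ob C. \<alpha> X \<in> Hom D (FO F X) (FO G X) \<and> iso_arrow D (\<alpha> X)) \<and>
          (\<forall>f \<in> Ar C. \<alpha> (Cod C f) \<odot>\<^bsub>D\<^esub> FM F f = FM G f \<odot>\<^bsub>D\<^esub> \<alpha> (Dom C f)))"

definition equivalent_cats :: "('o, 'm) cat \<Rightarrow> ('p, 'n) cat \<Rightarrow> bool" where
  "equivalent_cats C D \<longleftrightarrow>
     (\<exists>F G. is_functor C D F \<and> is_functor D C G \<and>
        nat_isomorphic C C (comp_functor G F) id_functor \<and>
        nat_isomorphic D D (comp_functor F G) id_functor)"


section \<open>Additive, abelian and quasi-abelian categories\<close>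

definition zero_object :: "('o, 'm) cat \<Rightarrow> 'o \<Rightarrow> bool" where
  "zero_object C Z \<longleftrightarrow> Z \<in> Ob C \<and>
     (\<forall>X \<in> Ob C. (\<exists>!f. f \<in> Hom C Z X) \<and> (\<exists>!f. f \<in> Hom C X Z))"

definition zero_arrow :: "('o, 'm) cat \<Rightarrow> 'm \<Rightarrow> bool" where
  "zero_arrow C f \<longleftrightarrow> f \<in> Ar C \<and>
     (\<exists>Z g h. zero_object C Z \<and> g \<in> Hom C (Dom C f) Z \<and> h \<in> Hom C Z (Cod C f) \<and>
        f = h \<odot>\<^bsub>C\<^esub> g)"

definition preadditive_with :: "('o, 'm) cat \<Rightarrow> ('m \<Rightarrow> 'm \<Rightarrow> 'm) \<Rightarrow> ('o \<Rightarrow> 'o \<Rightarrow> 'm) \<Rightarrow> bool" where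
  "preadditive_with C pl z \<longleftrightarrow> category C \<and>
     (\<forall>X \<in> Ob C. \<forall>Y \<in> Ob C.
        comm_group \<lparr>carrier = Hom C X Y, mult = pl, one = z X Y\<rparr>) \<and>
     (\<forall>X \<in> Ob C. \<forall>Y \<in> Ob C. \<forall>Z \<in> Ob C.
        (\<forall>f \<in> Hom C X Y. \<forall>g \<in> Hom C Y Z. \<forall>h \<in> Hom C Y Z.
           pl g h \<odot>\<^bsub>C\<^esub> f = pl (g \<odot>\<^bsub>C\<^esub> f) (h \<odot>\<^bsub>C\<^esub> f)) \<and>
        (\<forall>f \<in> Hom C X Y. \<forall>g \<in> Hom C X Y. \<forall>h \<in> Hom C Y Z.
           h \<odot>\<^bsub>C\<^esub> pl f g = pl (h \<odot>\<^bsub>C\<^esub> f) (h \<odot>\<^bsub>C\<^esub> g)))"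

text \<open>The additive structure on a category with biproducts is unique, so being
  additive is treated as a property.\<close>

definition additive_category :: "('o, 'm) cat \<Rightarrow> bool" where
  "additive_category C \<longleftrightarrow>
     (\<exists>Z. zero_object C Z) \<and>
     (\<exists>pl z. preadditive_with C pl z \<and>
        (\<forall>X \<in> Ob C. \<forall>Y \<in> Ob C. \<exists>B \<in> Ob C.
           \<exists>i \<in> Hom C X B. \<exists>j \<in> Hom C Y B. \<exists>p \<in> Hom C B X. \<exists>q \<in> Hom C B Y.
             p \<odot>\<^bsub>C\<^esub> i = Ident C X \<and> q \<odot>\<^bsub>C\<^esub> j = Ident C Y \<and>
             p \<odot>\<^bsub>C\<^esub> j = z Y X \<and> q \<odot>\<^bsub>C\<^esub> i = z X Y \<and>
             pl (i \<odot>\<^bsub>C\<^esub> p) (j \<odot>\<^bsub>C\<^esub> q) = Ident C B))"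

definition is_kernel :: "('o, 'm) cat \<Rightarrow> 'm \<Rightarrow> 'm \<Rightarrow> bool" where
  \<comment> \<open>\<open>k\<close> is a kernel of \<open>f\<close>\<close>
  "is_kernel C f k \<longleftrightarrow> f \<in> Ar C \<and> k \<in> Ar C \<and> Cod C k = Dom C f \<and>
     zero_arrow C (f \<odot>\<^bsub>C\<^esub> k) \<and>
     (\<forall>h \<in> Ar C. Cod C h = Dom C f \<and> zero_arrow C (f \<odot>\<^bsub>C\<^esub> h) \<longrightarrow>
        (\<exists>!u. u \<in> Hom C (Dom C h) (Dom C k) \<and> k \<odot>\<^bsub>C\<^esub> u = h))"

definition is_cokernel :: "('o, 'm) cat \<Rightarrow> 'm \<Rightarrow> 'm \<Rightarrow> bool" where
  \<comment> \<open>\<open>c\<close> is a cokernel of \<open>f\<close>\<close>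
  "is_cokernel C f c \<longleftrightarrow> f \<in> Ar C \<and> c \<in> Ar C \<and> Dom C c = Cod C f \<and>
     zero_arrow C (c \<odot>\<^bsub>C\<^esub> f) \<and>
     (\<forall>h \<in> Ar C. Dom C h = Cod C f \<and> zero_arrow C (h \<odot>\<^bsub>C\<^esub> f) \<longrightarrow>
        (\<exists>!u. u \<in> Hom C (Cod C c) (Cod C h) \<and> u \<odot>\<^bsub>C\<^esub> c = h))"

definition pre_abelian_category :: "('o, 'm) cat \<Rightarrow> bool" where
  "pre_abelian_category C \<longleftrightarrow> additive_category C \<and>
     (\<forall>f \<in> Ar C. (\<exists>k. is_kernel C f k) \<and> (\<exists>c. is_cokernel C f c))"

definition abelian_category :: "('o, 'm) cat \<Rightarrow> bool" where
  "abelian_category C \<longleftrightarrow> pre_abelian_category C \<and>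
     (\<forall>f. mono_arrow C f \<longrightarrow> (\<exists>g. is_kernel C g f)) \<and>
     (\<forall>f. epi_arrow C f \<longrightarrow> (\<exists>g. is_cokernel C g f))"

text \<open>In a pre-abelian category the strict monomorphisms are exactly the kernels and the
  strict epimorphisms exactly the cokernels.\<close>

definition quasi_abelian_category :: "('o, 'm) cat \<Rightarrow> bool" where
  "quasi_abelian_category C \<longleftrightarrow> pre_abelian_category C \<and>
     (\<forall>f g p q. is_pullback C f g p q \<and> (\<exists>h. is_cokernel C h f) \<longrightarrow> (\<exists>h. is_cokernel C h q)) \<and>
     (\<forall>f g i j. is_pushout C f g i j \<and> (\<exists>h. is_kernel C h f) \<longrightarrow> (\<exists>h. is_kernel C h j))"

definition short_exact :: "('o, 'm) cat \<Rightarrow> 'm \<Rightarrow> 'm \<Rightarrow> bool" where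
  "short_exact C i p \<longleftrightarrow> is_kernel C p i \<and> is_cokernel C i p"

definition zero_ob :: "('o, 'm) cat \<Rightarrow> 'o" where
  "zero_ob C = (SOME Z. zero_object C Z)"

definition from_zero :: "('o, 'm) cat \<Rightarrow> 'o \<Rightarrow> 'm" where
  "from_zero C X = (THE f. f \<in> Hom C (zero_ob C) X)"

definition to_zero :: "('o, 'm) cat \<Rightarrow> 'o \<Rightarrow> 'm" where
  "to_zero C X = (THE f. f \<in> Hom C X (zero_ob C))"


section \<open>Torsion pairs\<close>

text \<open>A full subcategory closed under isomorphisms is represented by its set of objects.\<close>

definition torsion_pair :: "('o, 'm) cat \<Rightarrow> 'o set \<Rightarrow> 'o set \<Rightarrow> bool" where
  "torsion_pair C T F \<longleftrightarrow> T \<subseteq> Ob C \<and> F \<subseteq> Ob C \<and>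
     (\<forall>X \<in> T. \<forall>Y \<in> Ob C. isomorphic C X Y \<longrightarrow> Y \<in> T) \<and>
     (\<forall>X \<in> F. \<forall>Y \<in> Ob C. isomorphic C X Y \<longrightarrow> Y \<in> F) \<and>
     (\<forall>X \<in> T. \<forall>Y \<in> F. \<forall>f \<in> Hom C X Y. zero_arrow C f) \<and>
     (\<forall>X \<in> Ob C. \<exists>A \<in> T. \<exists>B \<in> F. \<exists>i \<in> Hom C A X. \<exists>p \<in> Hom C X B. short_exact C i p)"

definition twin_torsion_pairs ::
  "('o, 'm) cat \<Rightarrow> ('o set \<times> 'o set \<times> 'o set \<times> 'o set) set" where
  "twin_torsion_pairs C =
     {(T1, F1, T2, F2). torsion_pair C T1 F1 \<and> torsion_pair C T2 F2 \<and> T2 \<subseteq> T1}"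

text \<open>A choice, for every object \<open>X\<close>, of an exact sequence
  \<open>0 \<rightarrow> t(X) \<rightarrow> X \<rightarrow> r(X) \<rightarrow> 0\<close> for a given torsion pair.\<close>

record ('o, 'm) torsion_seqs =
  tor_ob :: "'o \<Rightarrow> 'o"
  tor_inc :: "'o \<Rightarrow> 'm"
  free_ob :: "'o \<Rightarrow> 'o"
  free_proj :: "'o \<Rightarrow> 'm"

definition is_torsion_seqs ::
  "('o, 'm) cat \<Rightarrow> 'o set \<Rightarrow> 'o set \<Rightarrow> ('o, 'm) torsion_seqs \<Rightarrow> bool" where
  "is_torsion_seqs C T F d \<longleftrightarrow>
     (\<forall>X \<in> Ob C. tor_ob d X \<in> T \<and> free_ob d X \<in> F \<and>
        tor_inc d X \<in> Hom C (tor_ob d X) X \<and> free_proj d X \<in> Hom C X (free_ob d X) \<and>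
        short_exact C (tor_inc d X) (free_proj d X))"

definition tor_functor ::
  "('o, 'm) cat \<Rightarrow> ('o, 'm) torsion_seqs \<Rightarrow> ('o, 'm, 'o, 'm) ftor" where
  "tor_functor C d = \<lparr>FO = tor_ob d,
     FM = (\<lambda>f. THE g. g \<in> Hom C (tor_ob d (Dom C f)) (tor_ob d (Cod C f)) \<and>
            tor_inc d (Cod C f) \<odot>\<^bsub>C\<^esub> g = f \<odot>\<^bsub>C\<^esub> tor_inc d (Dom C f))\<rparr>"

definition free_functor ::
  "('o, 'm) cat \<Rightarrow> ('o, 'm) torsion_seqs \<Rightarrow> ('o, 'm, 'o, 'm) ftor" where
  "free_functor C d = \<lparr>FO = free_ob d,
     FM = (\<lambda>f. THE g. g \<in> Hom C (free_ob d (Dom C f)) (free_ob d (Cod C f)) \<and>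
            g \<odot>\<^bsub>C\<^esub> free_proj d (Dom C f) = free_proj d (Cod C f) \<odot>\<^bsub>C\<^esub> f)\<rparr>"

definition extension_class :: "('o, 'm) cat \<Rightarrow> 'o set \<Rightarrow> 'o set \<Rightarrow> 'o set" where
  "extension_class C S R =
     {X \<in> Ob C. \<exists>A \<in> S. \<exists>B \<in> R. \<exists>i \<in> Hom C A X. \<exists>p \<in> Hom C X B. short_exact C i p}"


section \<open>Model structures\<close>

definition two_out_of_three :: "('o, 'm) cat \<Rightarrow> 'm set \<Rightarrow> bool" where
  "two_out_of_three C S \<longleftrightarrow>
     (\<forall>f \<in> Ar C. \<forall>g \<in> Ar C. Cod C f = Dom C g \<longrightarrow>
        (f \<in> S \<and> g \<in> S \<longrightarrow> g \<odot>\<^bsub>C\<^esub> f \<in> S) \<and>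
        (f \<in> S \<and> g \<odot>\<^bsub>C\<^esub> f \<in> S \<longrightarrow> g \<in> S) \<and>
        (g \<in> S \<and> g \<odot>\<^bsub>C\<^esub> f \<in> S \<longrightarrow> f \<in> S))"

definition retract_of :: "('o, 'm) cat \<Rightarrow> 'm \<Rightarrow> 'm \<Rightarrow> bool" where
  \<comment> \<open>\<open>f\<close> is a retract of \<open>g\<close> in the arrow category\<close>
  "retract_of C f g \<longleftrightarrow> f \<in> Ar C \<and> g \<in> Ar C \<and>
     (\<exists>a \<in> Hom C (Dom C f) (Dom C g). \<exists>b \<in> Hom C (Cod C f) (Cod C g).
      \<exists>c \<in> Hom C (Dom C g) (Dom C f). \<exists>d \<in> Hom C (Cod C g) (Cod C f).
        c \<odot>\<^bsub>C\<^esub> a = Ident C (Dom C f) \<and> d \<odot>\<^bsub>C\<^esub> b = Ident C (Cod C f) \<and>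
        g \<odot>\<^bsub>C\<^esub> a = b \<odot>\<^bsub>C\<^esub> f \<and> f \<odot>\<^bsub>C\<^esub> c = d \<odot>\<^bsub>C\<^esub> g)"

definition closed_under_retracts :: "('o, 'm) cat \<Rightarrow> 'm set \<Rightarrow> bool" where
  "closed_under_retracts C S \<longleftrightarrow> (\<forall>f g. g \<in> S \<and> retract_of C f g \<longrightarrow> f \<in> S)"

definition lift_square :: "('o, 'm) cat \<Rightarrow> 'm \<Rightarrow> 'm \<Rightarrow> 'm \<Rightarrow> 'm \<Rightarrow> bool" where
  \<comment> \<open>a commutative square \<open>p \<circ> u = v \<circ> i\<close> from \<open>i\<close> to \<open>p\<close>\<close>
  "lift_square C i p u v \<longleftrightarrow>
     u \<in> Hom C (Dom C i) (Dom C p) \<and> v \<in> Hom C (Cod C i) (Cod C p) \<and>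
     p \<odot>\<^bsub>C\<^esub> u = v \<odot>\<^bsub>C\<^esub> i"

definition is_lifting :: "('o, 'm) cat \<Rightarrow> 'm \<Rightarrow> 'm \<Rightarrow> 'm \<Rightarrow> 'm \<Rightarrow> 'm \<Rightarrow> bool" where
  "is_lifting C i p u v h \<longleftrightarrow>
     h \<in> Hom C (Cod C i) (Dom C p) \<and> h \<odot>\<^bsub>C\<^esub> i = u \<and> p \<odot>\<^bsub>C\<^esub> h = v"

definition lifts :: "('o, 'm) cat \<Rightarrow> 'm set \<Rightarrow> 'm set \<Rightarrow> bool" where
  "lifts C L R \<longleftrightarrow>
     (\<forall>i \<in> L. \<forall>p \<in> R. \<forall>u v. lift_square C i p u v \<longrightarrow> (\<exists>h. is_lifting C i p u v h))"

definition lifts_uniquely :: "('o, 'm) cat \<Rightarrow> 'm set \<Rightarrow> 'm set \<Rightarrow> bool" where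
  "lifts_uniquely C L R \<longleftrightarrow>
     (\<forall>i \<in> L. \<forall>p \<in> R. \<forall>u v. lift_square C i p u v \<longrightarrow> (\<exists>!h. is_lifting C i p u v h))"

definition factors_through :: "('o, 'm) cat \<Rightarrow> 'm set \<Rightarrow> 'm set \<Rightarrow> bool" where
  "factors_through C L R \<longleftrightarrow>
     (\<forall>f \<in> Ar C. \<exists>i \<in> L. \<exists>p \<in> R. Cod C i = Dom C p \<and> f = p \<odot>\<^bsub>C\<^esub> i)"

type_synonym 'm model_data = "'m set \<times> 'm set \<times> 'm set"

fun model_structure :: "('o, 'm) cat \<Rightarrow> 'm model_data \<Rightarrow> bool" where
  "model_structure C (CoFib, Fib, Weq) \<longleftrightarrow>
     CoFib \<subseteq> Ar C \<and> Fib \<subseteq> Ar C \<and> Weq \<subseteq> Ar C \<and>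
     two_out_of_three C Weq \<and>
     closed_under_retracts C CoFib \<and> closed_under_retracts C Fib \<and>
     closed_under_retracts C Weq \<and>
     lifts C (CoFib \<inter> Weq) Fib \<and> lifts C CoFib (Fib \<inter> Weq) \<and>
     factors_through C (CoFib \<inter> Weq) Fib \<and> factors_through C CoFib (Fib \<inter> Weq)"

fun orthogonal_model_structure :: "('o, 'm) cat \<Rightarrow> 'm model_data \<Rightarrow> bool" where
  "orthogonal_model_structure C (CoFib, Fib, Weq) \<longleftrightarrow>
     model_structure C (CoFib, Fib, Weq) \<and>
     lifts_uniquely C (CoFib \<inter> Weq) Fib \<and> lifts_uniquely C CoFib (Fib \<inter> Weq)"

fun torsion_model_structure :: "('o, 'm) cat \<Rightarrow> 'm model_data \<Rightarrow> bool" where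
  "torsion_model_structure C (CoFib, Fib, Weq) \<longleftrightarrow>
     orthogonal_model_structure C (CoFib, Fib, Weq) \<and>
     two_out_of_three C CoFib \<and> two_out_of_three C Fib"

text \<open>These are meant for a category with a zero object.\<close>

fun cofibrant_objects :: "('o, 'm) cat \<Rightarrow> 'm model_data \<Rightarrow> 'o set" where
  "cofibrant_objects C (CoFib, Fib, Weq) = {X \<in> Ob C. from_zero C X \<in> CoFib}"

fun fibrant_objects :: "('o, 'm) cat \<Rightarrow> 'm model_data \<Rightarrow> 'o set" where
  "fibrant_objects C (CoFib, Fib, Weq) = {X \<in> Ob C. to_zero C X \<in> Fib}"

fun trivial_objects :: "('o, 'm) cat \<Rightarrow> 'm model_data \<Rightarrow> 'o set" where
  "trivial_objects C (CoFib, Fib, Weq) = {X \<in> Ob C. from_zero C X \<in> Weq}"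

fun bireflective_model_structure :: "('o, 'm) cat \<Rightarrow> 'm model_data \<Rightarrow> bool" where
  "bireflective_model_structure C (CoFib, Fib, Weq) \<longleftrightarrow>
     orthogonal_model_structure C (CoFib, Fib, Weq) \<and>
     (\<forall>A \<in> Ob C. \<exists>X \<in> cofibrant_objects C (CoFib, Fib, Weq).
        \<exists>p \<in> Hom C X A. p \<in> Fib \<inter> Weq) \<and>
     (\<forall>A \<in> Ob C. \<exists>X \<in> fibrant_objects C (CoFib, Fib, Weq).
        \<exists>i \<in> Hom C A X. i \<in> CoFib \<inter> Weq) \<and>
     two_out_of_three C (CoFib \<inter> Weq) \<and> two_out_of_three C (Fib \<inter> Weq) \<and>
     (\<forall>p \<in> Fib \<inter> Weq. \<forall>u \<in> CoFib.
        Dom C p \<in> cofibrant_objects C (CoFib, Fib, Weq) \<and> Dom C u = Dom C p \<longrightarrow>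
        (\<exists>a b. is_pushout C p u a b) \<and>
        (\<forall>a b. is_pushout C p u a b \<longrightarrow> b \<in> Fib \<inter> Weq)) \<and>
     (\<forall>i \<in> CoFib \<inter> Weq. \<forall>v \<in> Fib.
        Cod C i \<in> fibrant_objects C (CoFib, Fib, Weq) \<and> Cod C v = Cod C i \<longrightarrow>
        (\<exists>a b. is_pullback C i v a b) \<and>
        (\<forall>a b. is_pullback C i v a b \<longrightarrow> b \<in> CoFib \<inter> Weq))"


section \<open>Localization and the homotopy category\<close>

text \<open>The localization \<open>C[W\<inverse>]\<close> of Gabriel and Zisman: its objects are those of \<open>C\<close>, its
  arrows are zigzags (paths in arrows of \<open>C\<close> and formal inverses \<open>Bwd w\<close> of arrows
  \<open>w \<in> W\<close>, listed in the order in which they are traversed) modulo the congruence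
  generated by the composition of \<open>C\<close> and by \<open>Bwd w\<close> being inverse to \<open>Fwd w\<close>.
  Its universal property is the lemma \<open>localization_universal\<close>.\<close>

datatype 'm zstep = Fwd 'm | Bwd 'm

fun zsrc :: "('o, 'm) cat \<Rightarrow> 'm zstep \<Rightarrow> 'o" where
  "zsrc C (Fwd f) = Dom C f"
| "zsrc C (Bwd w) = Cod C w"

fun ztgt :: "('o, 'm) cat \<Rightarrow> 'm zstep \<Rightarrow> 'o" where
  "ztgt C (Fwd f) = Cod C f"
| "ztgt C (Bwd w) = Dom C w"

fun zigzag :: "('o, 'm) cat \<Rightarrow> 'm set \<Rightarrow> 'o \<Rightarrow> 'm zstep list \<Rightarrow> 'o \<Rightarrow> bool" where
  "zigzag C W X [] Y \<longleftrightarrow> X \<in> Ob C \<and> X = Y"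
| "zigzag C W X (s # ss) Y \<longleftrightarrow>
     s \<in> Fwd ` Ar C \<union> Bwd ` W \<and> zsrc C s = X \<and> zigzag C W (ztgt C s) ss Y"

inductive zeq :: "('o, 'm) cat \<Rightarrow> 'm set \<Rightarrow> 'o \<Rightarrow> 'o \<Rightarrow> 'm zstep list \<Rightarrow> 'm zstep list \<Rightarrow> bool"
  for C :: "('o, 'm) cat" and W :: "'m set" where
  refl: "zigzag C W X p Y \<Longrightarrow> zeq C W X Y p p"
| sym: "zeq C W X Y p q \<Longrightarrow> zeq C W X Y q p"
| trans: "zeq C W X Y p q \<Longrightarrow> zeq C W X Y q r \<Longrightarrow> zeq C W X Y p r"
| append: "zeq C W X Y p q \<Longrightarrow> zeq C W Y Z p' q' \<Longrightarrow> zeq C W X Z (p @ p') (q @ q')"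
| ident: "X \<in> Ob C \<Longrightarrow> zeq C W X X [Fwd (Ident C X)] []"
| comp: "f \<in> Ar C \<Longrightarrow> g \<in> Ar C \<Longrightarrow> Cod C f = Dom C g \<Longrightarrow>
    zeq C W (Dom C f) (Cod C g) [Fwd f, Fwd g] [Fwd (g \<odot>\<^bsub>C\<^esub> f)]"
| inv_right: "w \<in> W \<Longrightarrow> zeq C W (Dom C w) (Dom C w) [Fwd w, Bwd w] []"
| inv_left: "w \<in> W \<Longrightarrow> zeq C W (Cod C w) (Cod C w) [Bwd w, Fwd w] []"

type_synonym ('o, 'm) loc_arrow = "'o \<times> 'm zstep list set \<times> 'o"

definition zclass ::
  "('o, 'm) cat \<Rightarrow> 'm set \<Rightarrow> 'o \<Rightarrow> 'm zstep list \<Rightarrow> 'o \<Rightarrow> ('o, 'm) loc_arrow" where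
  "zclass C W X p Y = (X, {q. zeq C W X Y p q}, Y)"

definition localization :: "('o, 'm) cat \<Rightarrow> 'm set \<Rightarrow> ('o, ('o, 'm) loc_arrow) cat" where
  "localization C W =
     \<lparr>Ob = Ob C,
      Ar = {zclass C W X p Y | X p Y. zigzag C W X p Y},
      Dom = (\<lambda>(X, P, Y). X),
      Cod = (\<lambda>(X, P, Y). Y),
      Ident = (\<lambda>X. zclass C W X [] X),
      Cmp = (\<lambda>(Y', Q, Z) (X, P, Y). (X, {s. \<exists>p \<in> P. \<exists>q \<in> Q. zeq C W X Z (p @ q) s}, Z))\<rparr>"

definition loc_functor ::
  "('o, 'm) cat \<Rightarrow> 'm set \<Rightarrow> ('o, 'm, 'o, ('o, 'm) loc_arrow) ftor" where
  "loc_functor C W =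
     \<lparr>FO = (\<lambda>X. X), FM = (\<lambda>f. zclass C W (Dom C f) [Fwd f] (Cod C f))\<rparr>"

fun Ho :: "('o, 'm) cat \<Rightarrow> 'm model_data \<Rightarrow> ('o, ('o, 'm) loc_arrow) cat" where
  "Ho C (CoFib, Fib, Weq) = localization C Weq"

lemma zigzag_append:
  "zigzag C W X p Y \<Longrightarrow> zigzag C W Y q Z \<Longrightarrow> zigzag C W X (p @ q) Z"
  by (induction p arbitrary: X) auto

lemma (in category) zigzag_Ob:
  assumes "W \<subseteq> Ar C" "zigzag C W X p Y"
  shows "X \<in> Ob C \<and> Y \<in> Ob C"
  using assms(2)
proof (induction p arbitrary: X)
  case (Cons s p)
  then show ?case using assms(1) Dom_Ob Cod_Ob by (cases s) auto
qed auto

lemma (in category) zeq_zigzag: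
  assumes "W \<subseteq> Ar C" "zeq C W X Y p q"
  shows "zigzag C W X p Y \<and> zigzag C W X q Y"
  using assms(2)
proof (induction rule: zeq.induct)
  case (comp f g)
  then have "g \<odot> f \<in> Hom C (Dom C f) (Cod C g)"
    by (intro Cmp_Hom) (auto simp: Hom_def)
  then show ?case using comp by (auto simp: Hom_def Cod_Ob)
next
  case (ident X)
  then show ?case using Ident_Hom[of X] by (auto simp: Hom_def)
qed (use assms(1) Dom_Ob Cod_Ob in \<open>auto intro: zigzag_append\<close>)

lemma zclass_eq_iff:
  assumes "zigzag C W X p Y"
  shows "zclass C W X p Y = zclass C W X' q Y' \<longleftrightarrow> X = X' \<and> Y = Y' \<and> zeq C W X Y q p"
proof
  assume "zclass C W X p Y = zclass C W X' q Y'"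
  then have "X = X'" "Y = Y'" "{r. zeq C W X Y p r} = {r. zeq C W X' Y' q r}"
    unfolding zclass_def prod.inject by blast+
  then show "X = X' \<and> Y = Y' \<and> zeq C W X Y q p" using zeq.refl[OF assms] by blast
next
  assume eq: "X = X' \<and> Y = Y' \<and> zeq C W X Y q p"
  then have "zeq C W X Y p r \<longleftrightarrow> zeq C W X Y q r" for r
    by (meson zeq.sym zeq.trans)
  with eq show "zclass C W X p Y = zclass C W X' q Y'" by (simp add: zclass_def)
qed

lemma zclass_Cmp:
  assumes "zigzag C W X p Y" "zigzag C W Y q Z"
  shows "zclass C W Y q Z \<odot>\<^bsub>localization C W\<^esub> zclass C W X p Y = zclass C W X (p @ q) Z"
proof -
  have "(\<exists>p'. zeq C W X Y p p' \<and> (\<exists>q'. zeq C W Y Z q q' \<and> zeq C W X Z (p' @ q') s)) \<longleftrightarrow>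
        zeq C W X Z (p @ q) s" for s
    using assms by (meson zeq.append zeq.refl zeq.trans)
  then show ?thesis by (simp add: localization_def zclass_def)
qed

lemma localization_Hom:
  "Hom (localization C W) X Y = {zclass C W X p Y | p. zigzag C W X p Y}"
  by (auto simp: Hom_def localization_def zclass_def)

lemma (in category) category_localization:
  assumes W: "W \<subseteq> Ar C"
  shows "category (localization C W)"
proof
  fix X Y Z V f g h
  let ?L = "localization C W"
  show "Dom ?L f \<in> Ob ?L" "Cod ?L f \<in> Ob ?L" if "f \<in> Ar ?L"
    using that zigzag_Ob[OF W] by (fastforce simp: localization_def zclass_def)+
  show "Ident ?L X \<in> Hom ?L X X" if "X \<in> Ob ?L"
    using that unfolding localization_Hom by (force simp: localization_def)
  show "g \<odot>\<^bsub>?L\<^esub> f \<in> Hom ?L X Z" if "f \<in> Hom ?L X Y" "g \<in> Hom ?L Y Z"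
    using that unfolding localization_Hom by (auto simp: zclass_Cmp intro: zigzag_append)
  show "Ident ?L Y \<odot>\<^bsub>?L\<^esub> f = f" "f \<odot>\<^bsub>?L\<^esub> Ident ?L X = f" if f: "f \<in> Hom ?L X Y"
  proof -
    obtain p where p: "f = zclass C W X p Y" "zigzag C W X p Y"
      using f unfolding localization_Hom by auto
    have I: "Ident ?L V = zclass C W V [] V" for V by (simp add: localization_def)
    have "zigzag C W X [] X" "zigzag C W Y [] Y" using zigzag_Ob[OF W p(2)] by auto
    with p zclass_Cmp[of C W X p Y "[]" Y] zclass_Cmp[of C W X "[]" X p Y]
    show "Ident ?L Y \<odot>\<^bsub>?L\<^esub> f = f" "f \<odot>\<^bsub>?L\<^esub> Ident ?L X = f" by (simp_all add: I)
  qed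
  show "(h \<odot>\<^bsub>?L\<^esub> g) \<odot>\<^bsub>?L\<^esub> f = h \<odot>\<^bsub>?L\<^esub> (g \<odot>\<^bsub>?L\<^esub> f)"
    if "f \<in> Hom ?L V X" "g \<in> Hom ?L X Y" "h \<in> Hom ?L Y Z"
    using that unfolding localization_Hom by (auto simp: zclass_Cmp zigzag_append)
qed

lemma (in category) loc_functor_is_functor:
  assumes W: "W \<subseteq> Ar C"
  shows "is_functor C (localization C W) (loc_functor C W)"
proof -
  let ?L = "localization C W"
  have "zclass C W (Dom C f) [Fwd f] (Cod C f) \<in> Hom ?L (Dom C f) (Cod C f)" if "f \<in> Ar C" for f
    unfolding localization_Hom using that Cod_Ob by force
  moreover have "zclass C W X [Fwd (Ident C X)] X = zclass C W X [] X" if "X \<in> Ob C" for X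
  proof -
    have "zigzag C W X [Fwd (Ident C X)] X"
      using Ident_Hom[OF that] that by (auto simp: Hom_def)
    then show ?thesis
      using zclass_eq_iff[of C W X _ X X "[]" X] zeq.sym[OF zeq.ident[OF that, of W]] by blast
  qed
  moreover have "zclass C W (Dom C f) [Fwd (g \<odot> f)] (Cod C g) =
      zclass C W (Dom C g) [Fwd g] (Cod C g) \<odot>\<^bsub>?L\<^esub> zclass C W (Dom C f) [Fwd f] (Cod C f)"
    "Dom C (g \<odot> f) = Dom C f" "Cod C (g \<odot> f) = Cod C g"
    if "f \<in> Ar C" "g \<in> Ar C" "Cod C f = Dom C g" for f g
  proof -
    have gf: "g \<odot> f \<in> Hom C (Dom C f) (Cod C g)"
      using that by (intro Cmp_Hom) (auto simp: Hom_def)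
    have z: "zigzag C W (Dom C f) [Fwd f] (Cod C f)" "zigzag C W (Cod C f) [Fwd g] (Cod C g)"
      "zigzag C W (Dom C f) [Fwd (g \<odot> f)] (Cod C g)"
      using that gf Cod_Ob Dom_Ob by (auto simp: Hom_def)
    show "zclass C W (Dom C f) [Fwd (g \<odot> f)] (Cod C g) =
      zclass C W (Dom C g) [Fwd g] (Cod C g) \<odot>\<^bsub>?L\<^esub> zclass C W (Dom C f) [Fwd f] (Cod C f)"
      using zclass_Cmp[OF z(1,2)] that zeq.comp[OF that, of W]
        zclass_eq_iff[OF z(3), of "Dom C f" "[Fwd f, Fwd g]" "Cod C g"]
      by simp
    show "Dom C (g \<odot> f) = Dom C f" "Cod C (g \<odot> f) = Cod C g" using gf by (auto simp: Hom_def)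
  qed
  moreover have "Dom C (Ident C X) = X" "Cod C (Ident C X) = X" if "X \<in> Ob C" for X
    using Ident_Hom[OF that] by (auto simp: Hom_def)
  ultimately show ?thesis
    by (simp add: is_functor_def loc_functor_def) (simp add: localization_def)
qed

lemma (in category) loc_functor_inverts:
  assumes W: "W \<subseteq> Ar C" and w: "w \<in> W"
  shows "iso_arrow (localization C W) (FM (loc_functor C W) w)"
    and "zclass C W (Cod C w) [Bwd w] (Dom C w) \<odot>\<^bsub>localization C W\<^esub> FM (loc_functor C W) w
         = Ident (localization C W) (Dom C w)"
    and "FM (loc_functor C W) w \<odot>\<^bsub>localization C W\<^esub> zclass C W (Cod C w) [Bwd w] (Dom C w)
         = Ident (localization C W) (Cod C w)"
proof -
  let ?L = "localization C W" and ?b = "zclass C W (Cod C w) [Bwd w] (Dom C w)"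
  have z: "zigzag C W (Dom C w) [Fwd w] (Cod C w)" "zigzag C W (Cod C w) [Bwd w] (Dom C w)"
    "zigzag C W (Dom C w) [] (Dom C w)" "zigzag C W (Cod C w) [] (Cod C w)"
    using W w Dom_Ob Cod_Ob by auto
  show 1: "?b \<odot>\<^bsub>?L\<^esub> FM (loc_functor C W) w = Ident ?L (Dom C w)"
    using zclass_Cmp[OF z(1,2)] zclass_eq_iff[OF z(3), of "Dom C w" "[Fwd w, Bwd w]" "Dom C w"]
      zeq.inv_right[OF w, of C] by (simp add: loc_functor_def) (simp add: localization_def)
  show 2: "FM (loc_functor C W) w \<odot>\<^bsub>?L\<^esub> ?b = Ident ?L (Cod C w)"
    using zclass_Cmp[OF z(2,1)] zclass_eq_iff[OF z(4), of "Cod C w" "[Bwd w, Fwd w]" "Cod C w"]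
      zeq.inv_left[OF w, of C] by (simp add: loc_functor_def) (simp add: localization_def)
  have f: "FM (loc_functor C W) w \<in> Hom ?L (Dom C w) (Cod C w)"
    unfolding localization_Hom loc_functor_def using z(1) by auto
  have "?b \<in> Hom ?L (Cod C w) (Dom C w)"
    unfolding localization_Hom using z(2) by auto
  with f 1 2 show "iso_arrow ?L (FM (loc_functor C W) w)"
    unfolding iso_arrow_def Hom_def by (metis (mono_tags, lifting) mem_Collect_eq)
qed

definition inverse_arrow :: "('o, 'm) cat \<Rightarrow> 'm \<Rightarrow> 'm" where
  "inverse_arrow C f = (SOME g. g \<in> Hom C (Cod C f) (Dom C f) \<and>
     g \<odot>\<^bsub>C\<^esub> f = Ident C (Dom C f) \<and> f \<odot>\<^bsub>C\<^esub> g = Ident C (Cod C f))"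

lemma inverse_arrow:
  assumes "iso_arrow C f"
  shows "inverse_arrow C f \<in> Hom C (Cod C f) (Dom C f)"
    "inverse_arrow C f \<odot>\<^bsub>C\<^esub> f = Ident C (Dom C f)"
    "f \<odot>\<^bsub>C\<^esub> inverse_arrow C f = Ident C (Cod C f)"
proof -
  have "\<exists>g. g \<in> Hom C (Cod C f) (Dom C f) \<and>
     g \<odot>\<^bsub>C\<^esub> f = Ident C (Dom C f) \<and> f \<odot>\<^bsub>C\<^esub> g = Ident C (Cod C f)"
    using assms by (auto simp: iso_arrow_def)
  from someI_ex[OF this]
  show "inverse_arrow C f \<in> Hom C (Cod C f) (Dom C f)"
    "inverse_arrow C f \<odot>\<^bsub>C\<^esub> f = Ident C (Dom C f)"
    "f \<odot>\<^bsub>C\<^esub> inverse_arrow C f = Ident C (Cod C f)"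
    unfolding inverse_arrow_def by simp_all
qed

lemma (in category) inverse_unique:
  assumes "f \<in> Hom C X Y" "g \<in> Hom C Y X" "h \<in> Hom C Y X"
    "g \<odot> f = Ident C X" "f \<odot> h = Ident C Y"
  shows "g = h"
proof -
  have "g = g \<odot> (f \<odot> h)" using Ident_right[OF assms(2)] assms(5) by simp
  also have "\<dots> = (g \<odot> f) \<odot> h" using Cmp_assoc[OF assms(3,1,2)] by simp
  also have "\<dots> = h" using Ident_left[OF assms(3)] assms(4) by simp
  finally show ?thesis .
qed

fun zstep_eval :: "('p, 'n) cat \<Rightarrow> ('o, 'm, 'p, 'n) ftor \<Rightarrow> 'm zstep \<Rightarrow> 'n" where
  "zstep_eval D F (Fwd f) = FM F f"
| "zstep_eval D F (Bwd w) = inverse_arrow D (FM F w)"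

fun zeval ::
  "('o, 'm) cat \<Rightarrow> ('p, 'n) cat \<Rightarrow> ('o, 'm, 'p, 'n) ftor \<Rightarrow> 'o \<Rightarrow> 'm zstep list \<Rightarrow> 'n" where
  "zeval C D F X [] = Ident D (FO F X)"
| "zeval C D F X (s # p) = zeval C D F (ztgt C s) p \<odot>\<^bsub>D\<^esub> zstep_eval D F s"

lemma localization_universal:
  fixes C :: "('o, 'm) cat" and D :: "('p, 'n) cat"
  assumes C: "category C" and D: "category D" and W: "W \<subseteq> Ar C"
    and F: "is_functor C D F" and inv: "\<And>w. w \<in> W \<Longrightarrow> iso_arrow D (FM F w)"
  shows "\<exists>G. is_functor (localization C W) D G \<and>
           (\<forall>X \<in> Ob C. FO (comp_functor G (loc_functor C W)) X = FO F X) \<and>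
           (\<forall>f \<in> Ar C. FM (comp_functor G (loc_functor C W)) f = FM F f)"
    and "is_functor (localization C W) D G \<Longrightarrow> is_functor (localization C W) D G' \<Longrightarrow>
         (\<forall>X \<in> Ob C. FO G X = FO G' X) \<Longrightarrow>
         (\<forall>f \<in> Ar C. FM (comp_functor G (loc_functor C W)) f =
                     FM (comp_functor G' (loc_functor C W)) f) \<Longrightarrow>
         (\<forall>f \<in> Ar (localization C W). FM G f = FM G' f)"
proof -
  interpret C: category C by (rule C)
  interpret D: category D by (rule D)
  let ?L = "localization C W"
  interpret L: category ?L by (rule C.category_localization[OF W])
  have FO: "FO F X \<in> Ob D" if "X \<in> Ob C" for X using F that by (auto simp: is_functor_def)
  have FM: "FM F f \<in> Hom D (FO F (Dom C f)) (FO F (Cod C f))" if "f \<in> Ar C" for f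
    using F that by (auto simp: is_functor_def)
  have step: "zstep_eval D F s \<in> Hom D (FO F (zsrc C s)) (FO F (ztgt C s))"
    if "s \<in> Fwd ` Ar C \<union> Bwd ` W" for s
  proof (cases s)
    case (Fwd f)
    then show ?thesis using that FM by auto
  next
    case (Bwd w)
    then have w: "w \<in> W" using that by auto
    then show ?thesis
      using inverse_arrow(1)[OF inv[OF w]] FM[of w] W Bwd by (auto simp: Hom_def)
  qed
  have ev: "zeval C D F X p \<in> Hom D (FO F X) (FO F Y)" if "zigzag C W X p Y" for X p Y
    using that
  proof (induction p arbitrary: X)
    case Nil
    then show ?case using D.Ident_Hom FO by auto
  next
    case (Cons s p)
    then have "zeval C D F (ztgt C s) p \<in> Hom D (FO F (ztgt C s)) (FO F Y)"
      and "zstep_eval D F s \<in> Hom D (FO F X) (FO F (ztgt C s))"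
      using step[of s] by auto
    then show ?case using D.Cmp_Hom by simp
  qed
  have app: "zeval C D F X (p @ q) = zeval C D F Y q \<odot>\<^bsub>D\<^esub> zeval C D F X p"
    if "zigzag C W X p Y" "zigzag C W Y q Z" for X p Y q Z
    using that(1)
  proof (induction p arbitrary: X)
    case Nil
    then show ?case using D.Ident_right[OF ev[OF that(2)]] by auto
  next
    case (Cons s p)
    then have "zigzag C W (ztgt C s) p Y" "zsrc C s = X" "s \<in> Fwd ` Ar C \<union> Bwd ` W" by auto
    then show ?case
      using Cons.IH D.Cmp_assoc[OF step[of s] ev ev[OF that(2)]] by auto
  qed
  have ev_eq: "zeval C D F X p = zeval C D F X q" if "zeq C W X Y p q" for X Y p q
    using that
  proof (induction rule: zeq.induct)
    case (append X Y p q Z p' q')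
    then show ?case
      using C.zeq_zigzag[OF W append.hyps(1)] C.zeq_zigzag[OF W append.hyps(2)]
      by (metis app)
  next
    case (ident X)
    have "Dom C (Ident C X) = X" "Cod C (Ident C X) = X" "Ident C X \<in> Ar C"
      using C.Ident_Hom[OF ident] by (auto simp: Hom_def)
    moreover have "FM F (Ident C X) = Ident D (FO F X)"
      using F ident by (auto simp: is_functor_def)
    ultimately show ?case
      using D.Ident_left[OF D.Ident_Hom[OF FO[OF ident]]] by simp
  next
    case (comp f g)
    have gf: "g \<odot>\<^bsub>C\<^esub> f \<in> Hom C (Dom C f) (Cod C g)"
      using comp by (intro C.Cmp_Hom) (auto simp: Hom_def)
    have "FM F (g \<odot>\<^bsub>C\<^esub> f) = FM F g \<odot>\<^bsub>D\<^esub> FM F f"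
      using F comp by (auto simp: is_functor_def)
    moreover have "Ident D (FO F (Cod C g)) \<odot>\<^bsub>D\<^esub> FM F (g \<odot>\<^bsub>C\<^esub> f) = FM F (g \<odot>\<^bsub>C\<^esub> f)"
      using FM[of "g \<odot>\<^bsub>C\<^esub> f"] gf by (intro D.Ident_left) (auto simp: Hom_def)
    moreover have "Ident D (FO F (Cod C g)) \<odot>\<^bsub>D\<^esub> FM F g = FM F g"
      using FM[OF comp(2)] by (rule D.Ident_left)
    ultimately show ?case using gf by (simp add: Hom_def)
  next
    case (inv_right w)
    then have w: "w \<in> Ar C" using W by auto
    have Fw: "FM F w \<in> Hom D (FO F (Dom C w)) (FO F (Cod C w))" by (rule FM[OF w])
    have "Ident D (FO F (Dom C w)) \<odot>\<^bsub>D\<^esub> inverse_arrow D (FM F w) = inverse_arrow D (FM F w)"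
      using inverse_arrow(1)[OF inv[OF inv_right]] Fw by (intro D.Ident_left) (auto simp: Hom_def)
    then show ?case using inverse_arrow(2)[OF inv[OF inv_right]] Fw by (simp add: Hom_def)
  next
    case (inv_left w)
    then have w: "w \<in> Ar C" using W by auto
    have Fw: "FM F w \<in> Hom D (FO F (Dom C w)) (FO F (Cod C w))" by (rule FM[OF w])
    have "Ident D (FO F (Cod C w)) \<odot>\<^bsub>D\<^esub> FM F w = FM F w" using Fw by (rule D.Ident_left)
    then show ?case using inverse_arrow(3)[OF inv[OF inv_left]] Fw by (simp add: Hom_def)
  qed auto
  define G :: "('o, ('o, 'm) loc_arrow, 'p, 'n) ftor" where
    "G = \<lparr>FO = FO F, FM = (\<lambda>(X, P, Y). zeval C D F X (SOME p. p \<in> P))\<rparr>"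
  have G: "FM G (zclass C W X p Y) = zeval C D F X p" if "zigzag C W X p Y" for X p Y
  proof -
    have "(SOME q. q \<in> {q. zeq C W X Y p q}) \<in> {q. zeq C W X Y p q}"
      using zeq.refl[OF that] by (intro someI[of "\<lambda>q. q \<in> {q. zeq C W X Y p q}"]) auto
    then show ?thesis by (simp add: G_def zclass_def ev_eq)
  qed
  have dc: "Dom ?L (zclass C W X p Y) = X" "Cod ?L (zclass C W X p Y) = Y" for X p Y
    by (simp_all add: localization_def zclass_def)
  have Ob: "Ob ?L = Ob C" and Id: "Ident ?L = (\<lambda>X. zclass C W X [] X)"
    by (simp_all add: localization_def)
  have Ar: "(\<exists>X p Y. f = zclass C W X p Y \<and> zigzag C W X p Y)" if "f \<in> Ar ?L" for f
    using that by (auto simp: localization_def)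
  have "is_functor ?L D G"
    unfolding is_functor_def
  proof (intro conjI ballI impI)
    fix X assume "X \<in> Ob ?L"
    then have X: "X \<in> Ob C" by (simp add: Ob)
    then show "FO G X \<in> Ob D" using FO by (simp add: G_def)
    show "FM G (Ident ?L X) = Ident D (FO G X)" using G[of X "[]" X] X by (simp add: Id) (simp add: G_def)
  next
    fix f assume "f \<in> Ar ?L"
    then obtain X p Y where f: "f = zclass C W X p Y" "zigzag C W X p Y" using Ar by blast
    then show "FM G f \<in> Hom D (FO G (Dom ?L f)) (FO G (Cod ?L f))"
      using ev[OF f(2)] by (simp add: G dc) (simp add: G_def)
    fix g assume "g \<in> Ar ?L" and fg: "Cod ?L f = Dom ?L g"
    then obtain Y' q Z where "g = zclass C W Y' q Z" "zigzag C W Y' q Z" using Ar by blast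
    moreover from this fg f have "Y' = Y" by (simp add: dc)
    ultimately have g: "g = zclass C W Y q Z" "zigzag C W Y q Z" by auto
    show "FM G (g \<odot>\<^bsub>?L\<^esub> f) = FM G g \<odot>\<^bsub>D\<^esub> FM G f"
      using f g by (simp add: zclass_Cmp G zigzag_append app)
  qed
  moreover have "FM G (zclass C W (Dom C f) [Fwd f] (Cod C f)) = FM F f" if "f \<in> Ar C" for f
  proof -
    have "zigzag C W (Dom C f) [Fwd f] (Cod C f)" using that C.Cod_Ob by auto
    then show ?thesis using G D.Ident_left[OF FM[OF that]] by simp
  qed
  ultimately show "\<exists>G. is_functor ?L D G \<and>
      (\<forall>X \<in> Ob C. FO (comp_functor G (loc_functor C W)) X = FO F X) \<and>
      (\<forall>f \<in> Ar C. FM (comp_functor G (loc_functor C W)) f = FM F f)"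
    by (intro exI[of _ G]) (simp add: comp_functor_def loc_functor_def G_def)
next
  interpret C: category C by (rule C)
  interpret D: category D by (rule D)
  let ?L = "localization C W"
  interpret L: category ?L by (rule C.category_localization[OF W])
  assume G: "is_functor ?L D G" and G': "is_functor ?L D G'"
    and ob: "\<forall>X \<in> Ob C. FO G X = FO G' X"
    and "\<forall>f \<in> Ar C. FM (comp_functor G (loc_functor C W)) f =
                     FM (comp_functor G' (loc_functor C W)) f"
  then have fwd: "FM G (FM (loc_functor C W) f) = FM G' (FM (loc_functor C W) f)" if "f \<in> Ar C" for f
    using that by (simp add: comp_functor_def)
  have Ob: "Ob ?L = Ob C" by (simp add: localization_def)
  have hom: "FM K f \<in> Hom D (FO K X) (FO K Y)" if "is_functor ?L D K" "f \<in> Hom ?L X Y" for K f X Y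
    using that by (auto simp: is_functor_def Hom_def)
  have cmp: "FM K (g \<odot>\<^bsub>?L\<^esub> f) = FM K g \<odot>\<^bsub>D\<^esub> FM K f"
    if "is_functor ?L D K" "f \<in> Hom ?L X Y" "g \<in> Hom ?L Y Z" for K f g X Y Z
    using that by (auto simp: is_functor_def Hom_def)
  have idn: "FM K (Ident ?L X) = Ident D (FO K X)" if "is_functor ?L D K" "X \<in> Ob C" for K X
    using that by (auto simp: is_functor_def Ob)
  have zin: "zclass C W X p Y \<in> Hom ?L X Y" if "zigzag C W X p Y" for X p Y
    using that by (auto simp: localization_Hom)
  have lf: "FM (loc_functor C W) f = zclass C W (Dom C f) [Fwd f] (Cod C f)" for f
    by (simp add: loc_functor_def)
  have one: "FM G (zclass C W (zsrc C s) [s] (ztgt C s)) = FM G' (zclass C W (zsrc C s) [s] (ztgt C s))"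
    if s: "s \<in> Fwd ` Ar C \<union> Bwd ` W" for s
  proof (cases s)
    case (Fwd f)
    then show ?thesis using s fwd[of f] by (auto simp: lf)
  next
    case (Bwd w)
    then have w: "w \<in> W" "w \<in> Ar C" using s W by auto
    let ?w = "FM (loc_functor C W) w" and ?b = "zclass C W (Cod C w) [Bwd w] (Dom C w)"
    have h: "?w \<in> Hom ?L (Dom C w) (Cod C w)" "?b \<in> Hom ?L (Cod C w) (Dom C w)"
      using w C.Dom_Ob C.Cod_Ob by (auto simp: lf intro!: zin)
    have o: "Dom C w \<in> Ob C" "Cod C w \<in> Ob C" using w C.Dom_Ob C.Cod_Ob by auto
    have "FM G ?b = FM G' ?b"
    proof (rule D.inverse_unique)
      show "FM G ?w \<in> Hom D (FO G (Dom C w)) (FO G (Cod C w))" by (rule hom[OF G h(1)])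
      show "FM G ?b \<in> Hom D (FO G (Cod C w)) (FO G (Dom C w))" by (rule hom[OF G h(2)])
      show "FM G' ?b \<in> Hom D (FO G (Cod C w)) (FO G (Dom C w))"
        using hom[OF G' h(2)] ob o by simp
      show "FM G ?b \<odot>\<^bsub>D\<^esub> FM G ?w = Ident D (FO G (Dom C w))"
        using cmp[OF G h] idn[OF G o(1)] C.loc_functor_inverts(2)[OF W w(1)] by simp
      show "FM G ?w \<odot>\<^bsub>D\<^esub> FM G' ?b = Ident D (FO G (Cod C w))"
        using cmp[OF G' h(2,1)] idn[OF G' o(2)] C.loc_functor_inverts(3)[OF W w(1)] ob o fwd[OF w(2)]
        by simp
    qed
    then show ?thesis using Bwd by simp
  qed
  have "FM G (zclass C W X p Y) = FM G' (zclass C W X p Y)" if "zigzag C W X p Y" for X p Y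
    using that
  proof (induction p arbitrary: X)
    case Nil
    then show ?case using idn[OF G, of X] idn[OF G', of X] ob by (auto simp: localization_def)
  next
    case (Cons s p)
    then have s: "s \<in> Fwd ` Ar C \<union> Bwd ` W" "zsrc C s = X" and p: "zigzag C W (ztgt C s) p Y" by auto
    have z: "zigzag C W X [s] (ztgt C s)" using s C.zigzag_Ob[OF W p] by auto
    have "zclass C W X (s # p) Y = zclass C W (ztgt C s) p Y \<odot>\<^bsub>?L\<^esub> zclass C W X [s] (ztgt C s)"
      using zclass_Cmp[OF z p] by simp
    then show ?case
      using cmp[OF G zin[OF z] zin[OF p]] cmp[OF G' zin[OF z] zin[OF p]] Cons.IH[OF p] one[OF s(1)] s(2)
      by simp
  qed
  then show "\<forall>f \<in> Ar ?L. FM G f = FM G' f" by (auto simp: localization_def)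
qed

section \<open>The two assignments\<close>

definition model_of_seqs ::
  "('o, 'm) cat \<Rightarrow> ('o, 'm) torsion_seqs \<Rightarrow> ('o, 'm) torsion_seqs \<Rightarrow>
   ('o, 'm, 'o, 'm) ftor \<Rightarrow> 'm model_data" where
  "model_of_seqs C d1 d2 H =
     ({f \<in> Ar C. iso_arrow C (FM (free_functor C d1) f)},
      {f \<in> Ar C. iso_arrow C (FM (tor_functor C d2) f)},
      {f \<in> Ar C. iso_arrow C (FM H f)})"

fun Phi :: "('o, 'm) cat \<Rightarrow> 'o set \<times> 'o set \<times> 'o set \<times> 'o set \<Rightarrow> 'm model_data" where
  "Phi C (T1, F1, T2, F2) =
     (let d1 = (SOME d. is_torsion_seqs C T1 F1 d);
          d2 = (SOME d. is_torsion_seqs C T2 F2 d)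
      in model_of_seqs C d1 d2 (comp_functor (tor_functor C d1) (free_functor C d2)))"

fun Psi :: "('o, 'm) cat \<Rightarrow> 'm model_data \<Rightarrow> 'o set \<times> 'o set \<times> 'o set \<times> 'o set" where
  "Psi C (CoFib, Fib, Weq) =
     ({X \<in> Ob C. from_zero C X \<in> CoFib},
      {X \<in> Ob C. to_zero C X \<in> Fib \<inter> Weq},
      {X \<in> Ob C. from_zero C X \<in> CoFib \<inter> Weq},
      {X \<in> Ob C. to_zero C X \<in> Fib})"

end

theory Submission
  imports Defs
begin

text \<open>
  For a class \<open>S\<close> of objects let \<open>Lorth S\<close> be the class of morphisms \<open>f\<close> such that \<open>Hom(f, Y)\<close> is bijective
  for all \<open>Y\<close> in \<open>S\<close>, and \<open>Rorth S\<close> its dual; both are closed under retracts and have the two-out-of-three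
  property. For a torsion pair \<open>(T, F)\<close> the morphisms inverted by \<open>r\<close> are \<open>Lorth F\<close>, those inverted by \<open>t\<close> are
  \<open>Rorth T\<close>, their intersection consists of the isomorphisms, and \<open>(Lorth F, Rorth T)\<close> is an orthogonal
  factorization system, the factorization of \<open>f: X \<rightarrow> Y\<close> being given by the pullback of
  \<open>Y \<rightarrow> r Y \<leftarrow> r X\<close>. Conversely, every orthogonal factorization system in which both classes have the
  two-out-of-three property is of this form.

  A torsion model structure is thus the pair of systems \<open>(CoFib, TFib) = (Lorth F\<^sub>1, Rorth T\<^sub>1)\<close> and
  \<open>(TCoFib, Fib) = (Lorth F\<^sub>2, Rorth T\<^sub>2)\<close>. A fibration \<open>f\<close> with \<open>r\<^sub>2 t\<^sub>1 f\<close> invertible lies in \<open>TFib\<close> because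
  \<open>t\<^sub>1 f\<close> is then in \<open>Rorth T\<^sub>2 \<inter> Lorth F\<^sub>2\<close>, so \<open>Weq = TFib \<circ> TCoFib\<close>. If the exact sequences are
  chosen to be trivial on \<open>T\<^sub>1\<close> and \<open>F\<^sub>2\<close>, the functor \<open>t\<^sub>1 r\<^sub>2\<close> induces an equivalence from the homotopy category onto
  \<open>T\<^sub>1 \<inter> F\<^sub>2\<close> that is surjective on objects; it transports the quasi-abelian structure. In
  \<open>T\<^sub>1 \<inter> F\<^sub>2\<close> the strict epimorphisms are the epimorphisms of the ambient category with kernel in \<open>T\<^sub>1\<close>, whence their
  stability under pullback.
\<close>

section \<open>Categories\<close>

text \<open>Duality carries half of the work. \<open>op_cat\<close> keeps objects and arrows, and
  every structure used here dualizes as a whole locale; a twin pair \<open>(T1, F1, T2, F2)\<close>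
  becomes \<open>(F2, T2, F1, T1)\<close>, with the same \<open>T1 \<inter> F2\<close>. So claims
  about \<open>t\<close>, \<open>Rorth\<close> or strict monomorphisms are mostly instances of those
  about \<open>r\<close>, \<open>Lorth\<close> or strict epimorphisms. Two descriptions of weak
  equivalences have to coexist. Composites of a trivial cofibration and a trivial fibration involve
  no exact sequences, which \<open>Phi\<close> picks arbitrarily, but they hide two-out-of-three and
  closure under retracts. Both become evident once the class is known to consist of the arrows
  inverted by a functor. The localization comes with no addition, biproducts or kernels, and its
  arrows are classes of zigzags. Its quasi-abelian structure therefore has to be carried back along
  a functor; strict surjectivity on objects makes every object of the target literally an image, so
  that no diagram has to be conjugated by isomorphisms.\<close>

context category
begin

lemma Cmp_Ar [simp]: "f \<in> Ar C \<Longrightarrow> g \<in> Ar C \<Longrightarrow> Cod C f = Dom C g \<Longrightarrow> g \<odot> f \<in> Ar C"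
  and Dom_Cmp [simp]: "f \<in> Ar C \<Longrightarrow> g \<in> Ar C \<Longrightarrow> Cod C f = Dom C g \<Longrightarrow> Dom C (g \<odot> f) = Dom C f"
  and Cod_Cmp [simp]: "f \<in> Ar C \<Longrightarrow> g \<in> Ar C \<Longrightarrow> Cod C f = Dom C g \<Longrightarrow> Cod C (g \<odot> f) = Cod C g"
  using Cmp_Hom[of f "Dom C f" "Cod C f" g "Cod C g"] by (auto simp: Hom_def)

lemma Cmp_assoc_Ar [simp]:
  "f \<in> Ar C \<Longrightarrow> g \<in> Ar C \<Longrightarrow> h \<in> Ar C \<Longrightarrow> Cod C f = Dom C g \<Longrightarrow> Cod C g = Dom C h \<Longrightarrow>
    (h \<odot> g) \<odot> f = h \<odot> (g \<odot> f)"
  using Cmp_assoc[of f "Dom C f" "Cod C f" g "Cod C g" h "Cod C h"] by (auto simp: Hom_def)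

text \<open>Composites are bracketed to the right, where \<open>g \<odot> f\<close> is no longer a
  subterm of \<open>g \<odot> (f \<odot> x)\<close>. This form lets a commutative square or an
  inverse law act in front of a further arrow.\<close>

lemma Cmp_rewrite:
  "g \<odot> f = h \<Longrightarrow> f \<in> Ar C \<Longrightarrow> g \<in> Ar C \<Longrightarrow> Cod C f = Dom C g \<Longrightarrow> x \<in> Ar C \<Longrightarrow> Cod C x = Dom C f \<Longrightarrow>
    g \<odot> (f \<odot> x) = h \<odot> x"
  using Cmp_assoc_Ar[of x f g] by simp

lemma Ident_Ar [simp]: "X \<in> Ob C \<Longrightarrow> Ident C X \<in> Ar C"
  and Dom_Ident [simp]: "X \<in> Ob C \<Longrightarrow> Dom C (Ident C X) = X"
  and Cod_Ident [simp]: "X \<in> Ob C \<Longrightarrow> Cod C (Ident C X) = X"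
  using Ident_Hom[of X] by (auto simp: Hom_def)

lemma Ident_left_Ar [simp]: "f \<in> Ar C \<Longrightarrow> Cod C f = Y \<Longrightarrow> Ident C Y \<odot> f = f"
  and Ident_right_Ar [simp]: "f \<in> Ar C \<Longrightarrow> Dom C f = X \<Longrightarrow> f \<odot> Ident C X = f"
  using Ident_left[of f "Dom C f" Y] Ident_right[of f X "Cod C f"] by (auto simp: Hom_def)

lemmas Dom_Ob [simp] and Cod_Ob [simp]

lemma Hom_Ob: "f \<in> Hom C X Y \<Longrightarrow> X \<in> Ob C" "f \<in> Hom C X Y \<Longrightarrow> Y \<in> Ob C"
  using Dom_Ob Cod_Ob by (auto simp: Hom_def)

lemma iso_arrowI:
  "f \<in> Hom C X Y \<Longrightarrow> g \<in> Hom C Y X \<Longrightarrow> g \<odot> f = Ident C X \<Longrightarrow> f \<odot> g = Ident C Y \<Longrightarrow> iso_arrow C f"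
  by (auto simp: iso_arrow_def Hom_def)

lemma iso_arrowE:
  assumes "iso_arrow C f" "f \<in> Hom C X Y"
  obtains g where "g \<in> Hom C Y X" "g \<odot> f = Ident C X" "f \<odot> g = Ident C Y" "iso_arrow C g"
proof -
  obtain g where "g \<in> Hom C Y X" "g \<odot> f = Ident C X" "f \<odot> g = Ident C Y"
    using assms by (auto simp: iso_arrow_def Hom_def)
  then show thesis using that iso_arrowI[of g Y X f] assms by blast
qed

lemma iso_Ident: "X \<in> Ob C \<Longrightarrow> iso_arrow C (Ident C X)"
  by (rule iso_arrowI[of _ X X "Ident C X"]) (auto simp: Hom_def)

lemma iso_Cmp:
  assumes "iso_arrow C f" "iso_arrow C g" "Cod C f = Dom C g"
  shows "iso_arrow C (g \<odot> f)"
proof -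
  have f: "f \<in> Ar C" "g \<in> Ar C" using assms by (auto simp: iso_arrow_def)
  obtain f' where f': "f' \<in> Hom C (Cod C f) (Dom C f)" "f' \<odot> f = Ident C (Dom C f)" "f \<odot> f' = Ident C (Cod C f)"
    using assms by (auto simp: iso_arrow_def)
  obtain g' where g': "g' \<in> Hom C (Cod C g) (Dom C g)" "g' \<odot> g = Ident C (Dom C g)" "g \<odot> g' = Ident C (Cod C g)"
    using assms by (auto simp: iso_arrow_def)
  show ?thesis
    using f f'(1) g'(1) assms(3)
    by (intro iso_arrowI[of _ "Dom C f" "Cod C g" "f' \<odot> g'"])
      (auto simp: Hom_def f' g' f'(2,3)[THEN Cmp_rewrite] g'(2,3)[THEN Cmp_rewrite])
qed

text \<open>The inverse of \<open>f\<close> is \<open>c \<odot> (g' \<odot> b)\<close>: pass to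
  \<open>g\<close>, invert there, and return.\<close>

lemma iso_retract:
  assumes "iso_arrow C g" "retract_of C f g"
  shows "iso_arrow C f"
proof -
  obtain a b c d where a: "a \<in> Hom C (Dom C f) (Dom C g)" "b \<in> Hom C (Cod C f) (Cod C g)"
    "c \<in> Hom C (Dom C g) (Dom C f)" "d \<in> Hom C (Cod C g) (Cod C f)"
    and e: "c \<odot> a = Ident C (Dom C f)" "d \<odot> b = Ident C (Cod C f)"
      "g \<odot> a = b \<odot> f" "f \<odot> c = d \<odot> g"
    using assms(2) by (auto simp: retract_of_def)
  have f: "f \<in> Ar C" "g \<in> Ar C" using assms by (auto simp: retract_of_def)
  obtain g' where g': "g' \<in> Hom C (Cod C g) (Dom C g)" "g' \<odot> g = Ident C (Dom C g)" "g \<odot> g' = Ident C (Cod C g)"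
    using assms by (auto simp: iso_arrow_def)
  have "c \<odot> (g' \<odot> b) \<odot> f = c \<odot> (g' \<odot> (g \<odot> a))" using f a g'(1) e by (auto simp: Hom_def)
  also have "\<dots> = Ident C (Dom C f)"
    using f a g'(1) e(1) by (auto simp: Hom_def g'(2,3)[THEN Cmp_rewrite])
  finally have 1: "c \<odot> (g' \<odot> b) \<odot> f = Ident C (Dom C f)" .
  have "f \<odot> (c \<odot> (g' \<odot> b)) = (f \<odot> c) \<odot> (g' \<odot> b)" using f a g'(1) by (simp add: Hom_def)
  also have "\<dots> = Ident C (Cod C f)"
    using f a g'(1) unfolding e(4) by (simp add: Hom_def e g'(2,3)[THEN Cmp_rewrite])
  finally show ?thesis using f a g'(1) 1
    by (intro iso_arrowI[of _ "Dom C f" "Cod C f" "c \<odot> (g' \<odot> b)"]) (auto simp: Hom_def)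
qed

lemma iso_two_out_of_three:
  assumes f: "f \<in> Ar C" "g \<in> Ar C" "Cod C f = Dom C g" and gf: "iso_arrow C (g \<odot> f)"
  shows "iso_arrow C f \<Longrightarrow> iso_arrow C g" "iso_arrow C g \<Longrightarrow> iso_arrow C f"
proof -
  have fh: "f \<in> Hom C (Dom C f) (Cod C f)" "g \<in> Hom C (Dom C g) (Cod C g)" using f by (auto simp: Hom_def)
  assume "iso_arrow C f"
  then obtain f' where f': "f' \<in> Hom C (Cod C f) (Dom C f)" "f \<odot> f' = Ident C (Cod C f)" "iso_arrow C f'"
    using iso_arrowE[of f "Dom C f" "Cod C f"] fh by metis
  have "iso_arrow C ((g \<odot> f) \<odot> f')" by (rule iso_Cmp) (use gf f f' in \<open>auto simp: Hom_def\<close>)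
  also have "(g \<odot> f) \<odot> f' = g" using f f' by (simp add: Hom_def)
  finally show "iso_arrow C g" .
next
  have fh: "f \<in> Hom C (Dom C f) (Cod C f)" "g \<in> Hom C (Dom C g) (Cod C g)" using f by (auto simp: Hom_def)
  assume "iso_arrow C g"
  then obtain f' where f': "f' \<in> Hom C (Cod C g) (Dom C g)" "f' \<odot> g = Ident C (Dom C g)" "iso_arrow C f'"
    using iso_arrowE[of g "Dom C g" "Cod C g"] fh by metis
  have "iso_arrow C (f' \<odot> (g \<odot> f))" by (rule iso_Cmp) (use gf f f' in \<open>auto simp: Hom_def\<close>)
  also have "f' \<odot> (g \<odot> f) = f" using f f' by (simp add: Hom_def f'(2)[THEN Cmp_rewrite])
  finally show "iso_arrow C f" .
qed

lemma isomorphic_sym: "isomorphic C X Y \<Longrightarrow> isomorphic C Y X"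
  unfolding isomorphic_def by (meson iso_arrowE)

lemma mono_cancel:
  "mono_arrow C f \<Longrightarrow> f \<odot> g = f \<odot> h \<Longrightarrow> g \<in> Hom C W (Dom C f) \<Longrightarrow> h \<in> Hom C W (Dom C f) \<Longrightarrow> g = h"
  by (auto simp: mono_arrow_def Hom_def)

lemma epi_cancel:
  "epi_arrow C f \<Longrightarrow> g \<odot> f = h \<odot> f \<Longrightarrow> g \<in> Hom C (Cod C f) W \<Longrightarrow> h \<in> Hom C (Cod C f) W \<Longrightarrow> g = h"
  by (auto simp: epi_arrow_def Hom_def)

lemma iso_mono: "iso_arrow C f \<Longrightarrow> mono_arrow C f"
  unfolding mono_arrow_def
proof (intro conjI ballI impI)
  assume f: "iso_arrow C f" then show fa: "f \<in> Ar C" by (simp add: iso_arrow_def)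
  obtain f' where f': "f' \<in> Hom C (Cod C f) (Dom C f)" "f' \<odot> f = Ident C (Dom C f)"
    using f by (auto simp: iso_arrow_def)
  fix g h assume g: "g \<in> Ar C" "h \<in> Ar C"
    "Dom C g = Dom C h \<and> Cod C g = Dom C f \<and> Cod C h = Dom C f \<and> f \<odot> g = f \<odot> h"
  have "f' \<odot> (f \<odot> x) = x" if "x \<in> Ar C" "Cod C x = Dom C f" for x
    using fa f'(1) that by (simp add: Hom_def f'(2)[THEN Cmp_rewrite])
  then show "g = h" using g by metis
qed

end

section \<open>The opposite category\<close>

text \<open>Only the direction of arrows and the order of composition change, so the double opposite
  is equal to \<open>C\<close> itself and a dual statement can be dualized back by
  rewriting.\<close>

definition op_cat :: "('o, 'm) cat \<Rightarrow> ('o, 'm) cat" where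
  "op_cat C = \<lparr>Ob = Ob C, Ar = Ar C, Dom = Cod C, Cod = Dom C, Ident = Ident C, Cmp = (\<lambda>g f. f \<odot>\<^bsub>C\<^esub> g)\<rparr>"

lemma op_cat_simps [simp]:
  "Ob (op_cat C) = Ob C" "Ar (op_cat C) = Ar C" "Dom (op_cat C) = Cod C" "Cod (op_cat C) = Dom C"
  "Ident (op_cat C) = Ident C" "g \<odot>\<^bsub>op_cat C\<^esub> f = f \<odot>\<^bsub>C\<^esub> g"
  "op_cat (op_cat C) = C"
  by (simp_all add: op_cat_def)

lemma Hom_op [simp]: "Hom (op_cat C) X Y = Hom C Y X"
  by (auto simp: Hom_def)

lemma iso_arrow_op [simp]: "iso_arrow (op_cat C) f = iso_arrow C f"
  by (auto simp: iso_arrow_def)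

lemma mono_arrow_op [simp]: "mono_arrow (op_cat C) f = epi_arrow C f"
  by (auto simp: mono_arrow_def epi_arrow_def)

lemma epi_arrow_op [simp]: "epi_arrow (op_cat C) f = mono_arrow C f"
  by (auto simp: mono_arrow_def epi_arrow_def)

lemma is_pullback_op [simp]: "is_pullback (op_cat C) f g p q = is_pushout C f g p q"
  by (auto simp: is_pullback_def is_pushout_def)

lemma is_pushout_op [simp]: "is_pushout (op_cat C) f g p q = is_pullback C f g p q"
  by (auto simp: is_pullback_def is_pushout_def)

lemma zero_object_op [simp]: "zero_object (op_cat C) Z = zero_object C Z"
  by (auto simp: zero_object_def)

lemma zero_arrow_op [simp]: "zero_arrow (op_cat C) f = zero_arrow C f"
  unfolding zero_arrow_def by auto

lemma is_kernel_op [simp]: "is_kernel (op_cat C) f k = is_cokernel C f k"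
  by (simp add: is_kernel_def is_cokernel_def)

lemma is_cokernel_op [simp]: "is_cokernel (op_cat C) f k = is_kernel C f k"
  by (simp add: is_kernel_def is_cokernel_def)

lemma short_exact_op [simp]: "short_exact (op_cat C) p i = short_exact C i p"
  by (auto simp: short_exact_def)

lemma isomorphic_op [simp]: "isomorphic (op_cat C) X Y = isomorphic C Y X"
  by (simp add: isomorphic_def)

lemma full_subcat_op: "full_subcat (op_cat C) S = op_cat (full_subcat C S)"
  by (auto simp: full_subcat_def op_cat_def)

text \<open>Reversing arrows turns the sections \<open>a\<close>, \<open>b\<close> into retractions
  and \<open>c\<close>, \<open>d\<close> into sections. One implication for an arbitrary
  \<open>D\<close> suffices, since the converse is its instance at the opposite category.\<close>

lemma retract_of_op:
  fixes C :: "('o, 'm) cat"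
  shows "retract_of (op_cat C) f g = retract_of C f g"
proof -
  have "retract_of (op_cat D) f g" if "retract_of D f g" for D :: "('o, 'm) cat"
  proof -
    obtain a b c d where "a \<in> Hom D (Dom D f) (Dom D g)" "b \<in> Hom D (Cod D f) (Cod D g)"
      "c \<in> Hom D (Dom D g) (Dom D f)" "d \<in> Hom D (Cod D g) (Cod D f)"
      "c \<odot>\<^bsub>D\<^esub> a = Ident D (Dom D f)" "d \<odot>\<^bsub>D\<^esub> b = Ident D (Cod D f)"
      "g \<odot>\<^bsub>D\<^esub> a = b \<odot>\<^bsub>D\<^esub> f" "f \<odot>\<^bsub>D\<^esub> c = d \<odot>\<^bsub>D\<^esub> g" "f \<in> Ar D" "g \<in> Ar D"
      using \<open>retract_of D f g\<close> unfolding retract_of_def by blast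
    then show ?thesis unfolding retract_of_def op_cat_simps Hom_op
      by (intro conjI bexI[of _ a] bexI[of _ b] bexI[of _ c] bexI[of _ d]) simp_all
  qed
  from this[of C] this[of "op_cat C"] show ?thesis by auto
qed

lemma lift_square_op: "lift_square (op_cat C) p i v u = lift_square C i p u v"
  by (auto simp: lift_square_def)

lemma is_lifting_op: "is_lifting (op_cat C) p i v u h = is_lifting C i p u v h"
  by (auto simp: is_lifting_def)

lemma (in category) category_op: "category (op_cat C)"
  by unfold_locales (auto simp: Hom_def)

lemma torsion_pair_op:
  assumes "category C" "torsion_pair C T F"
  shows "torsion_pair (op_cat C) F T"
proof -
  interpret category C by fact
  show ?thesis using assms(2) unfolding torsion_pair_def
    by simp (meson isomorphic_sym)
qed

section \<open>Orthogonality\<close>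

definition Lorth :: "('o, 'm) cat \<Rightarrow> 'o set \<Rightarrow> 'm set" where
  "Lorth C S = {f \<in> Ar C. \<forall>Y \<in> S. \<forall>u \<in> Hom C (Dom C f) Y. \<exists>!v. v \<in> Hom C (Cod C f) Y \<and> v \<odot>\<^bsub>C\<^esub> f = u}"

definition Rorth :: "('o, 'm) cat \<Rightarrow> 'o set \<Rightarrow> 'm set" where
  "Rorth C S = Lorth (op_cat C) S"

lemma Lorth_op [simp]: "Lorth (op_cat C) S = Rorth C S"
  and Rorth_op [simp]: "Rorth (op_cat C) S = Lorth C S"
  by (simp_all add: Rorth_def)

lemma Lorth_anti_mono: "S \<subseteq> S' \<Longrightarrow> Lorth C S' \<subseteq> Lorth C S"
  unfolding Lorth_def by blast

lemma Rorth_anti_mono: "S \<subseteq> S' \<Longrightarrow> Rorth C S' \<subseteq> Rorth C S"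
  unfolding Rorth_def by (rule Lorth_anti_mono)

lemma Lorth_Ar: "f \<in> Lorth C S \<Longrightarrow> f \<in> Ar C"
  by (simp add: Lorth_def)

lemma Rorth_Ar: "f \<in> Rorth C S \<Longrightarrow> f \<in> Ar C"
  by (simp add: Rorth_def Lorth_def)

lemma LorthE:
  assumes "f \<in> Lorth C S" "f \<in> Hom C A B" "Y \<in> S" "u \<in> Hom C A Y"
  obtains v where "v \<in> Hom C B Y" "v \<odot>\<^bsub>C\<^esub> f = u"
  using assms unfolding Lorth_def Hom_def by blast

lemma Lorth_unique:
  assumes "f \<in> Lorth C S" "f \<in> Hom C A B" "Y \<in> S" "v \<in> Hom C B Y" "w \<in> Hom C B Y"
    "v \<odot>\<^bsub>C\<^esub> f = w \<odot>\<^bsub>C\<^esub> f" "category C"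
  shows "v = w"
proof -
  interpret category C by fact
  have "v \<odot>\<^bsub>C\<^esub> f \<in> Hom C A Y" using assms by (auto simp: Hom_def)
  moreover have "f \<in> Ar C" "Dom C f = A" "Cod C f = B" using assms(2) by (auto simp: Hom_def)
  ultimately have "\<exists>!x. x \<in> Hom C B Y \<and> x \<odot>\<^bsub>C\<^esub> f = v \<odot>\<^bsub>C\<^esub> f"
    using assms(1,3) unfolding Lorth_def by blast
  then show ?thesis using assms(4-6) by metis
qed

lemma RorthE:
  assumes "f \<in> Rorth C S" "f \<in> Hom C A B" "X \<in> S" "u \<in> Hom C X B"
  obtains v where "v \<in> Hom C X A" "f \<odot>\<^bsub>C\<^esub> v = u"
  by (rule LorthE[of f "op_cat C" S B A X u]) (use assms in simp_all)

lemma Rorth_unique: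
  assumes "f \<in> Rorth C S" "f \<in> Hom C A B" "X \<in> S" "v \<in> Hom C X A" "w \<in> Hom C X A"
    "f \<odot>\<^bsub>C\<^esub> v = f \<odot>\<^bsub>C\<^esub> w" "category C"
  shows "v = w"
  by (rule Lorth_unique[of f "op_cat C" S B A X v w])
    (use assms category.category_op in simp_all)

lemma LorthI:
  assumes "f \<in> Hom C A B"
    "\<And>Y u. Y \<in> S \<Longrightarrow> u \<in> Hom C A Y \<Longrightarrow> \<exists>v \<in> Hom C B Y. v \<odot>\<^bsub>C\<^esub> f = u"
    "\<And>Y v w. Y \<in> S \<Longrightarrow> v \<in> Hom C B Y \<Longrightarrow> w \<in> Hom C B Y \<Longrightarrow> v \<odot>\<^bsub>C\<^esub> f = w \<odot>\<^bsub>C\<^esub> f \<Longrightarrow> v = w"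
  shows "f \<in> Lorth C S"
proof -
  have f: "f \<in> Ar C" "Dom C f = A" "Cod C f = B" using assms(1) by (auto simp: Hom_def)
  have "\<exists>!v. v \<in> Hom C B Y \<and> v \<odot>\<^bsub>C\<^esub> f = u" if "Y \<in> S" "u \<in> Hom C A Y" for Y u
    using assms(2,3)[OF that(1)] that(2) by metis
  then show ?thesis using f unfolding Lorth_def by simp
qed

lemma RorthI:
  assumes "f \<in> Hom C A B"
    "\<And>X u. X \<in> S \<Longrightarrow> u \<in> Hom C X B \<Longrightarrow> \<exists>v \<in> Hom C X A. f \<odot>\<^bsub>C\<^esub> v = u"
    "\<And>X v w. X \<in> S \<Longrightarrow> v \<in> Hom C X A \<Longrightarrow> w \<in> Hom C X A \<Longrightarrow> f \<odot>\<^bsub>C\<^esub> v = f \<odot>\<^bsub>C\<^esub> w \<Longrightarrow> v = w"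
  shows "f \<in> Rorth C S"
  unfolding Rorth_def by (rule LorthI[of _ _ B A]) (use assms in auto)

context category
begin

lemma iso_Lorth:
  assumes "iso_arrow C f"
  shows "f \<in> Lorth C S"
proof -
  have f: "f \<in> Ar C" using assms by (simp add: iso_arrow_def)
  then obtain g where g: "g \<in> Hom C (Cod C f) (Dom C f)" "g \<odot> f = Ident C (Dom C f)" "f \<odot> g = Ident C (Cod C f)"
    using assms by (auto simp: iso_arrow_def)
  show ?thesis
  proof (rule LorthI[of f C "Dom C f" "Cod C f"])
    show "f \<in> Hom C (Dom C f) (Cod C f)" using f by (simp add: Hom_def)
    fix Y u assume "u \<in> Hom C (Dom C f) Y"
    then show "\<exists>v \<in> Hom C (Cod C f) Y. v \<odot> f = u"
      using f g by (intro bexI[of _ "u \<odot> g"]) (auto simp: Hom_def)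
  next
    fix Y v w assume v: "v \<in> Hom C (Cod C f) Y" "w \<in> Hom C (Cod C f) Y" "v \<odot> f = w \<odot> f"
    then have "(v \<odot> f) \<odot> g = (w \<odot> f) \<odot> g" by simp
    then show "v = w" using f g v(1,2) by (simp add: Hom_def)
  qed
qed

text \<open>Bijections have the two-out-of-three property, and \<open>Hom(g \<odot> f, Y)\<close> is
  the composite of \<open>Hom(g, Y)\<close> and \<open>Hom(f, Y)\<close>.\<close>

lemma Lorth_two_out_of_three: "two_out_of_three C (Lorth C S)"
  unfolding two_out_of_three_def
proof (intro ballI impI)
  fix f g assume f: "f \<in> Ar C" "g \<in> Ar C" "Cod C f = Dom C g"
  have h: "f \<in> Hom C (Dom C f) (Dom C g)" "g \<in> Hom C (Dom C g) (Cod C g)" "g \<odot> f \<in> Hom C (Dom C f) (Cod C g)"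
    using f by (auto simp: Hom_def)
  have a: "(v \<odot> g) \<odot> f = v \<odot> (g \<odot> f)" "v \<odot> g \<in> Hom C (Dom C g) Y" "v \<odot> (g \<odot> f) \<in> Hom C (Dom C f) Y"
    if "v \<in> Hom C (Cod C g) Y" for v Y
    using f that by (auto simp: Hom_def)
  have b: "v \<odot> f \<in> Hom C (Dom C f) Y" if "v \<in> Hom C (Dom C g) Y" for v Y
    using f that by (auto simp: Hom_def)
  have 1: "g \<odot> f \<in> Lorth C S" if "f \<in> Lorth C S" "g \<in> Lorth C S"
  proof (rule LorthI[OF h(3)])
    fix Y u assume "Y \<in> S" "u \<in> Hom C (Dom C f) Y"
    then show "\<exists>v \<in> Hom C (Cod C g) Y. v \<odot> (g \<odot> f) = u"
      by (metis LorthE[OF that(1) h(1)] LorthE[OF that(2) h(2)] a(1))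
  next
    fix Y v w assume "Y \<in> S" "v \<in> Hom C (Cod C g) Y" "w \<in> Hom C (Cod C g) Y" "v \<odot> (g \<odot> f) = w \<odot> (g \<odot> f)"
    then show "v = w" 
      using Lorth_unique[OF that(1) h(1)] Lorth_unique[OF that(2) h(2)] a category_axioms by metis
  qed
  have 2: "g \<in> Lorth C S" if "f \<in> Lorth C S" "g \<odot> f \<in> Lorth C S"
  proof (rule LorthI[OF h(2)])
    fix Y u assume "Y \<in> S" "u \<in> Hom C (Dom C g) Y"
    then show "\<exists>v \<in> Hom C (Cod C g) Y. v \<odot> g = u"
      using Lorth_unique[OF that(1) h(1)] category_axioms LorthE[OF that(2) h(3)] a b by metis
  next
    fix Y v w assume "Y \<in> S" "v \<in> Hom C (Cod C g) Y" "w \<in> Hom C (Cod C g) Y" "v \<odot> g = w \<odot> g"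
    then show "v = w" 
      using Lorth_unique[OF that(2) h(3)] a category_axioms by metis
  qed
  have 3: "f \<in> Lorth C S" if "g \<in> Lorth C S" "g \<odot> f \<in> Lorth C S"
  proof (rule LorthI[OF h(1)])
    fix Y u assume "Y \<in> S" "u \<in> Hom C (Dom C f) Y"
    then show "\<exists>v \<in> Hom C (Dom C g) Y. v \<odot> f = u"
      using LorthE[OF that(2) h(3)] a by metis
  next
    fix Y v w assume "Y \<in> S" "v \<in> Hom C (Dom C g) Y" "w \<in> Hom C (Dom C g) Y" "v \<odot> f = w \<odot> f"
    then show "v = w" 
      using Lorth_unique[OF that(2) h(3)] LorthE[OF that(1) h(2)] a category_axioms by metis
  qed
  show "(f \<in> Lorth C S \<and> g \<in> Lorth C S \<longrightarrow> g \<odot> f \<in> Lorth C S) \<and>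
        (f \<in> Lorth C S \<and> g \<odot> f \<in> Lorth C S \<longrightarrow> g \<in> Lorth C S) \<and>
        (g \<in> Lorth C S \<and> g \<odot> f \<in> Lorth C S \<longrightarrow> f \<in> Lorth C S)" using 1 2 3 by blast
qed

text \<open>A retract of a bijection is a bijection: to extend \<open>u\<close> along
  \<open>f\<close>, extend \<open>u \<odot> c\<close> along \<open>g\<close> and restrict the result
  along \<open>b\<close>.\<close>

lemma Lorth_retract: "closed_under_retracts C (Lorth C S)"
  unfolding closed_under_retracts_def
proof (intro allI impI)
  fix f g assume fg: "g \<in> Lorth C S \<and> retract_of C f g"
  then obtain a b c d where a: "a \<in> Hom C (Dom C f) (Dom C g)" "b \<in> Hom C (Cod C f) (Cod C g)"
    "c \<in> Hom C (Dom C g) (Dom C f)" "d \<in> Hom C (Cod C g) (Cod C f)"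
    and e: "c \<odot> a = Ident C (Dom C f)" "d \<odot> b = Ident C (Cod C f)"
      "g \<odot> a = b \<odot> f" "f \<odot> c = d \<odot> g"
    by (auto simp: retract_of_def)
  have f: "f \<in> Ar C" "g \<in> Ar C" "g \<in> Hom C (Dom C g) (Cod C g)" using fg by (auto simp: retract_of_def Hom_def)
  show "f \<in> Lorth C S"
  proof (rule LorthI[of f C "Dom C f" "Cod C f"])
    show "f \<in> Hom C (Dom C f) (Cod C f)" using f by (simp add: Hom_def)
    fix Y u assume Y: "Y \<in> S" and u: "u \<in> Hom C (Dom C f) Y"
    then have "u \<odot> c \<in> Hom C (Dom C g) Y" using a by (auto simp: Hom_def)
    then obtain v where v: "v \<in> Hom C (Cod C g) Y" "v \<odot> g = u \<odot> c"
      using fg Y LorthE f by metis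
    have "(v \<odot> b) \<odot> f = v \<odot> (g \<odot> a)" using v(1) a f e by (simp add: Hom_def)
    also have "\<dots> = u" using v(1) v(2)[THEN Cmp_rewrite, of a] a f e u by (simp add: Hom_def)
    finally show "\<exists>v \<in> Hom C (Cod C f) Y. v \<odot> f = u"
      using v a by (intro bexI[of _ "v \<odot> b"]) (auto simp: Hom_def)
  next
    fix Y v w assume v: "Y \<in> S" "v \<in> Hom C (Cod C f) Y" "w \<in> Hom C (Cod C f) Y" "v \<odot> f = w \<odot> f"
    then have "(v \<odot> f) \<odot> c = (w \<odot> f) \<odot> c" by simp
    then have "(v \<odot> d) \<odot> g = (w \<odot> d) \<odot> g" using v(2,3) f a e by (simp add: Hom_def)
    moreover have "v \<odot> d \<in> Hom C (Cod C g) Y" "w \<odot> d \<in> Hom C (Cod C g) Y"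
      using v a by (auto simp: Hom_def)
    ultimately have "v \<odot> d = w \<odot> d"
      using Lorth_unique[of g C S "Dom C g" "Cod C g" Y] fg f v(1) category_axioms by blast
    then have "(v \<odot> d) \<odot> b = (w \<odot> d) \<odot> b" by simp
    then show "v = w" using v(2,3) a e by (simp add: Hom_def)
  qed
qed

lemma Rorth_two_out_of_three: "two_out_of_three C (Rorth C S)"
  using category.Lorth_two_out_of_three[OF category_op, of S] unfolding two_out_of_three_def op_cat_simps Lorth_op
  by metis

lemma Rorth_retract: "closed_under_retracts C (Rorth C S)"
  using category.Lorth_retract[OF category_op, of S] by (simp add: closed_under_retracts_def retract_of_op)

text \<open>Yoneda inside \<open>S\<close>: the extension of the identity of \<open>A\<close> is a
  left inverse, and uniqueness of extensions into \<open>B\<close> makes it a right inverse.\<close>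

lemma Lorth_iso:
  assumes "f \<in> Lorth C S" "f \<in> Hom C A B" "A \<in> S" "B \<in> S"
  shows "iso_arrow C f"
proof -
  have o: "A \<in> Ob C" "B \<in> Ob C" using assms(2) Hom_Ob by auto
  obtain g where g: "g \<in> Hom C B A" "g \<odot> f = Ident C A"
    using LorthE[OF assms(1-3) Ident_Hom] o by auto
  have "f \<odot> g = Ident C B"
    by (rule Lorth_unique[OF assms(1,2,4)]) (use g o assms category_axioms in \<open>auto simp: Hom_def\<close>)
  then show ?thesis using iso_arrowI assms g by blast
qed

lemma Rorth_iso:
  assumes "f \<in> Rorth C S" "f \<in> Hom C A B" "A \<in> S" "B \<in> S"
  shows "iso_arrow C f"
  using category.Lorth_iso[OF category_op, of f S B A] assms by simp

end

section \<open>Additive and abelian categories\<close>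

lemma (in category) pullback_lift:
  assumes "is_pullback C f g p q" "a \<in> Hom C W (Dom C f)" "b \<in> Hom C W (Dom C g)" "f \<odot> a = g \<odot> b"
  obtains u where "u \<in> Hom C W (Dom C p)" "p \<odot> u = a" "q \<odot> u = b"
proof -
  have "a \<in> Ar C" "b \<in> Ar C" "Dom C a = W" "Dom C a = Dom C b \<and> Cod C a = Dom C f \<and> Cod C b = Dom C g \<and> f \<odot> a = g \<odot> b"
    using assms by (auto simp: Hom_def)
  then have "\<exists>!u. u \<in> Hom C W (Dom C p) \<and> p \<odot> u = a \<and> q \<odot> u = b"
    using assms(1) unfolding is_pullback_def by blast
  then show thesis using that by blast
qed

lemma (in category) pullback_unique:
  assumes "is_pullback C f g p q" "u \<in> Hom C W (Dom C p)" "v \<in> Hom C W (Dom C p)"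
    "p \<odot> u = p \<odot> v" "q \<odot> u = q \<odot> v"
  shows "u = v"
proof -
  have h: "f \<in> Ar C" "g \<in> Ar C" "p \<in> Ar C" "q \<in> Ar C" "Dom C q = Dom C p" "Cod C p = Dom C f"
    "Cod C q = Dom C g" "f \<odot> p = g \<odot> q" "Cod C f = Cod C g" "u \<in> Ar C" "Cod C u = Dom C p" "Dom C u = W"
    using assms by (auto simp: is_pullback_def Hom_def)
  have "f \<odot> (p \<odot> u) = g \<odot> (q \<odot> u)"
    using h h(8)[THEN Cmp_rewrite, of u] by simp
  then have "p \<odot> u \<in> Ar C" "q \<odot> u \<in> Ar C" "Dom C (p \<odot> u) = W" 
    "Dom C (p \<odot> u) = Dom C (q \<odot> u) \<and> Cod C (p \<odot> u) = Dom C f \<and> Cod C (q \<odot> u) = Dom C g \<and>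
      f \<odot> (p \<odot> u) = g \<odot> (q \<odot> u)"
    using h by auto
  then have "\<exists>!w. w \<in> Hom C W (Dom C p) \<and> p \<odot> w = p \<odot> u \<and> q \<odot> w = q \<odot> u"
    using assms(1) unfolding is_pullback_def by blast
  then show ?thesis using assms by metis
qed

lemma (in category) pullbackI:
  assumes "f \<in> Hom C X Y" "g \<in> Hom C Z Y" "p \<in> Hom C P X" "q \<in> Hom C P Z" "f \<odot> p = g \<odot> q"
    "\<And>W a b. a \<in> Hom C W X \<Longrightarrow> b \<in> Hom C W Z \<Longrightarrow> f \<odot> a = g \<odot> b \<Longrightarrow>
      \<exists>u \<in> Hom C W P. p \<odot> u = a \<and> q \<odot> u = b"
    "\<And>W u v. u \<in> Hom C W P \<Longrightarrow> v \<in> Hom C W P \<Longrightarrow> p \<odot> u = p \<odot> v \<Longrightarrow> q \<odot> u = q \<odot> v \<Longrightarrow> u = v"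
  shows "is_pullback C f g p q"
proof -
  have ex: "\<exists>!u. u \<in> Hom C W P \<and> p \<odot> u = a \<and> q \<odot> u = b"
    if "a \<in> Hom C W X" "b \<in> Hom C W Z" "f \<odot> a = g \<odot> b" for W a b
    using assms(6)[OF that] assms(7) by metis
  then have "\<exists>!u. u \<in> Hom C (Dom C a) P \<and> p \<odot> u = a \<and> q \<odot> u = b"
    if "a \<in> Ar C" "b \<in> Ar C" "Dom C a = Dom C b" "Cod C a = X" "Cod C b = Z" "f \<odot> a = g \<odot> b" for a b
    using ex[of a "Dom C a" b] that by (simp add: Hom_def)
  moreover have "f \<in> Ar C" "g \<in> Ar C" "p \<in> Ar C" "q \<in> Ar C" "Dom C f = X" "Cod C f = Y" "Dom C g = Z"
    "Cod C g = Y" "Dom C p = P" "Cod C p = X" "Dom C q = P" "Cod C q = Z"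
    using assms(1-4) by (auto simp: Hom_def)
  ultimately show ?thesis using assms(5) unfolding is_pullback_def by simp
qed

lemma (in category) pullback_sym: "is_pullback C f g p q \<Longrightarrow> is_pullback C g f q p"
  unfolding is_pullback_def by (metis (no_types, lifting))

text \<open>\<open>additive_category\<close> only asserts that some addition exists. Here one is
  fixed, so that sums and zero arrows have names.\<close>

locale preabelian = category C for C :: "('o, 'm) cat" (structure) +
  fixes pl :: "'m \<Rightarrow> 'm \<Rightarrow> 'm" and z :: "'o \<Rightarrow> 'o \<Rightarrow> 'm"
  assumes preadditive: "preadditive_with C pl z"
    and has_zero: "\<exists>Z. zero_object C Z"
    and has_biproduct: "X \<in> Ob C \<Longrightarrow> Y \<in> Ob C \<Longrightarrow> \<exists>B \<in> Ob C.
           \<exists>i \<in> Hom C X B. \<exists>j \<in> Hom C Y B. \<exists>p \<in> Hom C B X. \<exists>q \<in> Hom C B Y.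
             p \<odot> i = Ident C X \<and> q \<odot> j = Ident C Y \<and>
             p \<odot> j = z Y X \<and> q \<odot> i = z X Y \<and>
             pl (i \<odot> p) (j \<odot> q) = Ident C B"
    and has_kernel: "f \<in> Ar C \<Longrightarrow> \<exists>k. is_kernel C f k"
    and has_cokernel: "f \<in> Ar C \<Longrightarrow> \<exists>c. is_cokernel C f c"

locale abelian = preabelian C pl z for C :: "('o, 'm) cat" (structure) and pl z +
  assumes mono_normal: "mono_arrow C f \<Longrightarrow> \<exists>g. is_kernel C g f"
    and epi_normal: "epi_arrow C f \<Longrightarrow> \<exists>g. is_cokernel C g f"

lemma preadditive_with_category: "preadditive_with C pl z \<Longrightarrow> category C"
  by (simp add: preadditive_with_def)

lemma pre_abelian_category_iff: "pre_abelian_category C \<longleftrightarrow> (\<exists>pl z. preabelian C pl z)"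
  unfolding pre_abelian_category_def additive_category_def preabelian_def preabelian_axioms_def
  using preadditive_with_category by blast

lemma abelian_category_iff: "abelian_category C \<longleftrightarrow> (\<exists>pl z. abelian C pl z)"
  unfolding abelian_category_def abelian_def abelian_axioms_def pre_abelian_category_iff by blast

section \<open>Zero arrows, kernels and pullbacks in a pre-abelian category\<close>

context preabelian
begin

lemma pl_group: "X \<in> Ob C \<Longrightarrow> Y \<in> Ob C \<Longrightarrow> comm_group \<lparr>carrier = Hom C X Y, mult = pl, one = z X Y\<rparr>"
  using preadditive by (simp add: preadditive_with_def)

lemma pl_Cmp: "f \<in> Hom C X Y \<Longrightarrow> g \<in> Hom C Y Z \<Longrightarrow> h \<in> Hom C Y Z \<Longrightarrow> pl g h \<odot> f = pl (g \<odot> f) (h \<odot> f)"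
  and Cmp_pl: "f \<in> Hom C X Y \<Longrightarrow> g \<in> Hom C X Y \<Longrightarrow> h \<in> Hom C Y Z \<Longrightarrow> h \<odot> pl f g = pl (h \<odot> f) (h \<odot> g)"
  using preadditive Hom_Ob unfolding preadditive_with_def by metis+

lemma z_Hom: "X \<in> Ob C \<Longrightarrow> Y \<in> Ob C \<Longrightarrow> z X Y \<in> Hom C X Y"
  using pl_group[of X Y] by (auto simp: comm_group_def comm_monoid_def monoid_def)

lemma z_Ar [simp]: "X \<in> Ob C \<Longrightarrow> Y \<in> Ob C \<Longrightarrow> z X Y \<in> Ar C"
  and Dom_z [simp]: "X \<in> Ob C \<Longrightarrow> Y \<in> Ob C \<Longrightarrow> Dom C (z X Y) = X"
  and Cod_z [simp]: "X \<in> Ob C \<Longrightarrow> Y \<in> Ob C \<Longrightarrow> Cod C (z X Y) = Y"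
  using z_Hom by (auto simp: Hom_def)

lemma pl_Hom: "f \<in> Hom C X Y \<Longrightarrow> g \<in> Hom C X Y \<Longrightarrow> pl f g \<in> Hom C X Y"
  and pl_z: "f \<in> Hom C X Y \<Longrightarrow> pl f (z X Y) = f"
  and z_pl: "f \<in> Hom C X Y \<Longrightarrow> pl (z X Y) f = f"
  and pl_cancel_right: "f \<in> Hom C X Y \<Longrightarrow> g \<in> Hom C X Y \<Longrightarrow> h \<in> Hom C X Y \<Longrightarrow> pl f h = pl g h \<Longrightarrow> f = g"
  and pl_diff: "f \<in> Hom C X Y \<Longrightarrow> g \<in> Hom C X Y \<Longrightarrow> \<exists>d \<in> Hom C X Y. pl d f = g"
proof -
  assume f: "f \<in> Hom C X Y"
  then interpret comm_group "\<lparr>carrier = Hom C X Y, mult = pl, one = z X Y\<rparr>"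
    using pl_group Hom_Ob by blast
  show "pl f g \<in> Hom C X Y" if "g \<in> Hom C X Y" using m_closed[of f g] f that by simp
  show "pl f (z X Y) = f" "pl (z X Y) f = f" using r_one[of f] l_one[of f] f by simp_all
  show "f = g" if "g \<in> Hom C X Y" "h \<in> Hom C X Y" "pl f h = pl g h"
    using right_cancel[of h f g] f that by simp
  show "\<exists>d \<in> Hom C X Y. pl d f = g" if "g \<in> Hom C X Y"
  proof
    let ?i = "inv\<^bsub>\<lparr>carrier = Hom C X Y, mult = pl, one = z X Y\<rparr>\<^esub> f"
    show "pl g ?i \<in> Hom C X Y" using m_closed[of g ?i] inv_closed[of f] f that by simp
    show "pl (pl g ?i) f = g" using m_assoc[of g ?i f] l_inv[of f] r_one[of g] inv_closed[of f] f that by simp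
  qed
qed

text \<open>The composite \<open>x\<close> satisfies \<open>x + x = x\<close> by distributivity, so
  cancellation in the group of arrows gives zero.\<close>

lemma z_Cmp [simp]:
  assumes "f \<in> Ar C" "Cod C f = Y" "W \<in> Ob C"
  shows "z Y W \<odot> f = z (Dom C f) W"
proof -
  have f: "f \<in> Hom C (Dom C f) Y" and z: "z Y W \<in> Hom C Y W" "z (Dom C f) W \<in> Hom C (Dom C f) W"
    using assms by (auto simp: Hom_def)
  then have h: "z Y W \<odot> f \<in> Hom C (Dom C f) W" using Cmp_Hom by blast
  have "pl (z Y W \<odot> f) (z Y W \<odot> f) = pl (z (Dom C f) W) (z Y W \<odot> f)"
    using pl_Cmp[OF f z(1) z(1)] z_pl[OF z(1)] z_pl[OF h] by simp
  then show ?thesis using pl_cancel_right[OF h z(2) h] by simp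
qed

text \<open>The addition of arrows is kept while the zero arrows exchange their two indices; in a
  biproduct, injections and projections trade places.\<close>

lemma preabelian_op: "preabelian (op_cat C) pl (\<lambda>X Y. z Y X)"
proof -
  have "preadditive_with (op_cat C) pl (\<lambda>X Y. z Y X)"
    unfolding preadditive_with_def using category_op pl_group pl_Cmp Cmp_pl by simp
  moreover have "\<exists>B \<in> Ob C.
           \<exists>i \<in> Hom C B X. \<exists>j \<in> Hom C B Y. \<exists>p \<in> Hom C X B. \<exists>q \<in> Hom C Y B.
             i \<odot> p = Ident C X \<and> j \<odot> q = Ident C Y \<and>
             j \<odot> p = z X Y \<and> i \<odot> q = z Y X \<and>
             pl (p \<odot> i) (q \<odot> j) = Ident C B" if "X \<in> Ob C" "Y \<in> Ob C" for X Y
    using has_biproduct[OF that] by metis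
  ultimately show ?thesis
    using category_op has_zero has_kernel has_cokernel
    by (intro preabelian.intro preabelian_axioms.intro) auto
qed

lemma Cmp_z [simp]:
  assumes "f \<in> Ar C" "Dom C f = Y" "W \<in> Ob C"
  shows "f \<odot> z W Y = z W (Cod C f)"
  using preabelian.z_Cmp[OF preabelian_op, of f Y W] assms by simp

lemma zero_object_iff: "zero_object C Z \<longleftrightarrow> Z \<in> Ob C \<and> Ident C Z = z Z Z"
proof
  assume Z: "zero_object C Z"
  then have "\<exists>!f. f \<in> Hom C Z Z" "Z \<in> Ob C" by (auto simp: zero_object_def)
  then show "Z \<in> Ob C \<and> Ident C Z = z Z Z" using z_Hom Ident_Hom by metis
next
  assume Z: "Z \<in> Ob C \<and> Ident C Z = z Z Z"
  have "f = z Z X" if "f \<in> Hom C Z X" for f X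
    using Ident_right[OF that] that Z by (simp add: Hom_def)
  moreover have "f = z X Z" if "f \<in> Hom C X Z" for f X
    using Ident_left[OF that] that Z by (simp add: Hom_def)
  ultimately show "zero_object C Z" using Z z_Hom unfolding zero_object_def by metis
qed

lemma zero_object_Hom:
  assumes "zero_object C Z"
  shows "f \<in> Hom C X Z \<Longrightarrow> f = z X Z" "f \<in> Hom C Z X \<Longrightarrow> f = z Z X"
  using assms z_Hom Hom_Ob unfolding zero_object_def by metis+

text \<open>Reconciles zero arrows defined by factorization through a zero object with the neutral
  elements of the groups of arrows.\<close>

lemma zero_arrow_iff: "zero_arrow C f \<longleftrightarrow> f \<in> Ar C \<and> f = z (Dom C f) (Cod C f)"
proof
  assume "zero_arrow C f"
  then obtain Z g h where f: "f \<in> Ar C" "zero_object C Z" "g \<in> Hom C (Dom C f) Z" "h \<in> Hom C Z (Cod C f)" "f = h \<odot> g"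
    by (auto simp: zero_arrow_def)
  then have "h = z Z (Cod C f)" using zero_object_Hom by blast
  then have "h \<odot> g = z (Dom C f) (Cod C f)" using f(1,3) by (simp add: Hom_def)
  then show "f \<in> Ar C \<and> f = z (Dom C f) (Cod C f)" using f by simp
next
  assume f: "f \<in> Ar C \<and> f = z (Dom C f) (Cod C f)"
  obtain Z where Z: "zero_object C Z" "Z \<in> Ob C" using has_zero zero_object_iff by auto
  have "f = z Z (Cod C f) \<odot> z (Dom C f) Z" "z Z (Cod C f) \<in> Hom C Z (Cod C f)" "z (Dom C f) Z \<in> Hom C (Dom C f) Z"
    using f Z(2) z_Hom by auto
  then show "zero_arrow C f" using f Z(1) unfolding zero_arrow_def by blast
qed

lemma zero_arrow_Hom: "f \<in> Hom C X Y \<Longrightarrow> zero_arrow C f \<longleftrightarrow> f = z X Y"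
  by (auto simp: zero_arrow_iff Hom_def)

lemma kernel_Hom:
  assumes "is_kernel C f k" "f \<in> Hom C X Y"
  shows "k \<in> Hom C (Dom C k) X" "f \<odot> k = z (Dom C k) Y"
proof -
  show k: "k \<in> Hom C (Dom C k) X" using assms by (auto simp: is_kernel_def Hom_def)
  show "f \<odot> k = z (Dom C k) Y"
    using assms zero_arrow_Hom[OF Cmp_Hom[OF k assms(2)]] by (auto simp: is_kernel_def)
qed

lemma kernel_lift:
  assumes "is_kernel C f k" "f \<in> Hom C X Y" "h \<in> Hom C W X" "f \<odot> h = z W Y"
  obtains u where "u \<in> Hom C W (Dom C k)" "k \<odot> u = h"
proof -
  have "zero_arrow C (f \<odot> h)" using zero_arrow_Hom[OF Cmp_Hom[OF assms(3,2)]] assms by simp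
  moreover have hH: "h \<in> Ar C" "Dom C h = W" "Cod C h = Dom C f" using assms by (auto simp: Hom_def)
  ultimately have "\<exists>!u. u \<in> Hom C (Dom C h) (Dom C k) \<and> k \<odot> u = h"
    using assms(1) unfolding is_kernel_def by blast
  then show thesis using that hH by auto
qed

lemma kernel_mono:
  assumes "is_kernel C f k"
  shows "mono_arrow C k"
proof -
  have fk: "f \<in> Ar C" "k \<in> Ar C" "Cod C k = Dom C f" "f \<odot> k = z (Dom C k) (Cod C f)"
    using assms kernel_Hom[of f k "Dom C f" "Cod C f"] by (auto simp: is_kernel_def Hom_def)
  show ?thesis unfolding mono_arrow_def
  proof (intro conjI ballI impI)
    fix g h assume g: "g \<in> Ar C" "h \<in> Ar C"
      "Dom C g = Dom C h \<and> Cod C g = Dom C k \<and> Cod C h = Dom C k \<and> k \<odot> g = k \<odot> h"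
    have "k \<odot> g \<in> Ar C" "Cod C (k \<odot> g) = Dom C f" "f \<odot> (k \<odot> g) = z (Dom C g) (Cod C f)"
      using g fk fk(4)[THEN Cmp_rewrite, of g] by auto
    then have "zero_arrow C (f \<odot> (k \<odot> g))" using fk g by (simp add: zero_arrow_iff)
    then have "\<exists>!u. u \<in> Hom C (Dom C (k \<odot> g)) (Dom C k) \<and> k \<odot> u = k \<odot> g"
      using assms \<open>k \<odot> g \<in> Ar C\<close> \<open>Cod C (k \<odot> g) = Dom C f\<close> unfolding is_kernel_def by blast
    moreover have "g \<in> Hom C (Dom C (k \<odot> g)) (Dom C k)" "h \<in> Hom C (Dom C (k \<odot> g)) (Dom C k)"
      using g fk by (auto simp: Hom_def)
    ultimately show "g = h" using g by metis
  qed (rule fk)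
qed

lemma kernelI:
  assumes "f \<in> Hom C X Y" "k \<in> Hom C K X" "f \<odot> k = z K Y" "mono_arrow C k"
    "\<And>W h. h \<in> Hom C W X \<Longrightarrow> f \<odot> h = z W Y \<Longrightarrow> \<exists>u \<in> Hom C W K. k \<odot> u = h"
  shows "is_kernel C f k"
  unfolding is_kernel_def
proof (intro conjI ballI impI)
  show "f \<in> Ar C" "k \<in> Ar C" "Cod C k = Dom C f" using assms by (auto simp: Hom_def)
  have K: "K \<in> Ob C" "Y \<in> Ob C" "Dom C k = K" using assms(1,2) by (auto simp: Hom_def)
  then show "zero_arrow C (f \<odot> k)" using assms(3) by (simp add: zero_arrow_iff)
  fix h assume h: "h \<in> Ar C" "Cod C h = Dom C f \<and> zero_arrow C (f \<odot> h)"
  then have hX: "h \<in> Hom C (Dom C h) X" using assms(1) by (auto simp: Hom_def)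
  then have "f \<odot> h = z (Dom C h) Y" using zero_arrow_Hom Cmp_Hom assms(1) h by blast
  then obtain u where u: "u \<in> Hom C (Dom C h) K" "k \<odot> u = h" using assms(5)[OF hX] by blast
  show "\<exists>!u. u \<in> Hom C (Dom C h) (Dom C k) \<and> k \<odot> u = h"
    using u mono_cancel[OF assms(4)] K by (intro ex1I[of _ u]) auto
qed

lemma cokernel_Hom:
  assumes "is_cokernel C f c" "f \<in> Hom C X Y"
  shows "c \<in> Hom C Y (Cod C c)" "c \<odot> f = z X (Cod C c)"
  using preabelian.kernel_Hom[OF preabelian_op, of f c Y X] assms by simp_all

lemma cokernel_lift:
  assumes "is_cokernel C f c" "f \<in> Hom C X Y" "h \<in> Hom C Y W" "h \<odot> f = z X W"
  obtains u where "u \<in> Hom C (Cod C c) W" "u \<odot> c = h"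
  by (rule preabelian.kernel_lift[OF preabelian_op, of f c Y X h W]) (use assms in simp_all)

lemma cokernel_epi: "is_cokernel C f c \<Longrightarrow> epi_arrow C c"
  using preabelian.kernel_mono[OF preabelian_op, of f c] by simp

lemma cokernelI:
  assumes "f \<in> Hom C X Y" "c \<in> Hom C Y Q" "c \<odot> f = z X Q" "epi_arrow C c"
    "\<And>W h. h \<in> Hom C Y W \<Longrightarrow> h \<odot> f = z X W \<Longrightarrow> \<exists>u \<in> Hom C Q W. u \<odot> c = h"
  shows "is_cokernel C f c"
  using preabelian.kernelI[OF preabelian_op, of f Y X c Q] assms by simp

lemma mono_Hom: "mono_arrow C f \<Longrightarrow> f \<in> Hom C X Y \<Longrightarrow> k \<in> Hom C W X \<Longrightarrow> f \<odot> k = z W Y \<Longrightarrow> k = z W X"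
  using mono_cancel[of f k "z W X" W] by (auto simp: Hom_def)

lemma epi_Hom: "epi_arrow C f \<Longrightarrow> f \<in> Hom C X Y \<Longrightarrow> k \<in> Hom C Y W \<Longrightarrow> k \<odot> f = z X W \<Longrightarrow> k = z Y W"
  using epi_cancel[of f k "z Y W" W] by (auto simp: Hom_def)

text \<open>If \<open>f \<odot> g = f \<odot> h\<close>, the difference \<open>d\<close> of
  \<open>g\<close> and \<open>h\<close> is killed by \<open>f\<close>; hence a trivial kernel
  suffices for cancellation.\<close>

lemma monoI:
  assumes f: "f \<in> Hom C X Y" and "\<And>W k. k \<in> Hom C W X \<Longrightarrow> f \<odot> k = z W Y \<Longrightarrow> k = z W X"
  shows "mono_arrow C f"
  unfolding mono_arrow_def
proof (intro conjI ballI impI)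
  fix g h assume g: "g \<in> Ar C" "h \<in> Ar C"
    "Dom C g = Dom C h \<and> Cod C g = Dom C f \<and> Cod C h = Dom C f \<and> f \<odot> g = f \<odot> h"
  let ?W = "Dom C g"
  have gh: "g \<in> Hom C ?W X" "h \<in> Hom C ?W X" using g f by (auto simp: Hom_def)
  then obtain d where d: "d \<in> Hom C ?W X" "pl d h = g" using pl_diff by blast
  have fh: "f \<odot> h \<in> Hom C ?W Y" "f \<odot> d \<in> Hom C ?W Y" "z ?W Y \<in> Hom C ?W Y"
    using gh d f z_Hom by (auto simp: Hom_def)
  have "pl (f \<odot> d) (f \<odot> h) = pl (z ?W Y) (f \<odot> h)"
    using Cmp_pl[OF d(1) gh(2) f] d(2) g z_pl[OF fh(1)] by simp
  then have "f \<odot> d = z ?W Y" using pl_cancel_right[OF fh(2,3,1)] by simp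
  then have "d = z ?W X" using assms(2) d by blast
  then show "g = h" using d z_pl gh by simp
qed (use f in \<open>simp add: Hom_def\<close>)

lemma epiI:
  assumes f: "f \<in> Hom C X Y" and "\<And>W k. k \<in> Hom C Y W \<Longrightarrow> k \<odot> f = z X W \<Longrightarrow> k = z Y W"
  shows "epi_arrow C f"
  using preabelian.monoI[OF preabelian_op, of f Y X] assms by simp

text \<open>Parallel sides of a pullback square have the same kernel: \<open>k0\<close> is the arrow
  into the pullback with components \<open>k\<close> and zero, and an arrow killed by
  \<open>q\<close> has its \<open>p\<close>-component killed by \<open>f\<close>.\<close>

lemma pullback_kernel:
  assumes P: "is_pullback C f g p q" and k: "is_kernel C f k"
  obtains k0 where "k0 \<in> Hom C (Dom C k) (Dom C p)" "p \<odot> k0 = k" "is_kernel C q k0"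
proof -
  define X Y Z P K where "X = Dom C f" and "Y = Cod C f" and "Z = Dom C g" and "P = Dom C p" and "K = Dom C k"
  have h: "f \<in> Hom C X Y" "g \<in> Hom C Z Y" "p \<in> Hom C P X" "q \<in> Hom C P Z" and e: "f \<odot> p = g \<odot> q"
    using P by (auto simp: is_pullback_def Hom_def X_def Y_def Z_def P_def)
  have kH: "k \<in> Hom C K X" "f \<odot> k = z K Y" using kernel_Hom[OF k h(1)] by (simp_all add: K_def)
  have o: "X \<in> Ob C" "Y \<in> Ob C" "Z \<in> Ob C" "K \<in> Ob C" "P \<in> Ob C" using h kH Hom_Ob by blast+
  have "z K Z \<in> Hom C K Z" "g \<odot> z K Z = z K Y" using o h z_Hom by (auto simp: Hom_def)
  then obtain k0 where k0: "k0 \<in> Hom C K P" "p \<odot> k0 = k" "q \<odot> k0 = z K Z"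
    using pullback_lift[OF P, of k K "z K Z"] kH by (metis P_def X_def Z_def)
  have "is_kernel C q k0"
  proof (rule kernelI[OF h(4) k0(1) k0(3)])
    have "mono_arrow C k" by (rule kernel_mono[OF k])
    show "mono_arrow C k0"
    proof (rule monoI[OF k0(1)])
      fix W x assume x: "x \<in> Hom C W K" "k0 \<odot> x = z W P"
      have "k \<odot> x = p \<odot> (k0 \<odot> x)" using k0(1) k0(2)[symmetric] h x(1) by (simp add: Hom_def)
      also have "\<dots> = z W X" using x h Hom_Ob(1)[OF x(1)] by (simp add: Hom_def)
      finally show "x = z W K" using mono_Hom[OF kernel_mono[OF k] kH(1) x(1)] by simp
    qed
    fix W a assume a: "a \<in> Hom C W P" "q \<odot> a = z W Z"
    have pa: "p \<odot> a \<in> Hom C W X" using a h by (auto simp: Hom_def)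
    have "f \<odot> (p \<odot> a) = g \<odot> (q \<odot> a)" using a(1) h e[THEN Cmp_rewrite, of a] by (simp add: Hom_def)
    also have "\<dots> = z W Y" using a h Hom_Ob(1)[OF a(1)] by (simp add: Hom_def)
    finally obtain u where u: "u \<in> Hom C W K" "k \<odot> u = p \<odot> a"
      using kernel_lift[OF k h(1) pa] K_def by metis
    have "k0 \<odot> u = a"
    proof (rule pullback_unique[OF P, of _ W])
      show "k0 \<odot> u \<in> Hom C W (Dom C p)" "a \<in> Hom C W (Dom C p)"
        using k0 u a by (auto simp: Hom_def P_def)
      show "p \<odot> (k0 \<odot> u) = p \<odot> a" using k0(1) k0(2)[THEN Cmp_rewrite, of u] u h by (simp add: Hom_def)
      show "q \<odot> (k0 \<odot> u) = q \<odot> a" using k0(1) k0(3)[THEN Cmp_rewrite, of u] u h a o by (simp add: Hom_def)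
    qed
    then show "\<exists>u \<in> Hom C W K. k0 \<odot> u = a" using u by blast
  qed
  then show thesis using k0 that by (simp add: K_def P_def)
qed

text \<open>The pullback is the kernel of the difference of \<open>f \<odot> a\<close> and
  \<open>g \<odot> b\<close> on the biproduct \<open>B\<close> of \<open>X\<close> and
  \<open>Z\<close>, where \<open>a\<close>, \<open>b\<close> are the projections.\<close>

lemma pullback_exists:
  assumes f: "f \<in> Hom C X Y" and g: "g \<in> Hom C Z Y"
  obtains P p q where "p \<in> Hom C P X" "q \<in> Hom C P Z" "is_pullback C f g p q"
proof -
  have o: "X \<in> Ob C" "Y \<in> Ob C" "Z \<in> Ob C" using f g Hom_Ob by blast+
  obtain B i j a b where B: "B \<in> Ob C" "i \<in> Hom C X B" "j \<in> Hom C Z B" "a \<in> Hom C B X" "b \<in> Hom C B Z"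
    "a \<odot> i = Ident C X" "b \<odot> j = Ident C Z" "a \<odot> j = z Z X" "b \<odot> i = z X Z"
    "pl (i \<odot> a) (j \<odot> b) = Ident C B" using has_biproduct[OF o(1,3)] by blast
  have fa: "f \<odot> a \<in> Hom C B Y" "g \<odot> b \<in> Hom C B Y" using B f g by (auto simp: Hom_def)
  \<comment> \<open>\<open>m\<close> is this difference, recorded by the equation that characterizes
    it, as subtraction has no name.\<close>
  then obtain m where m: "m \<in> Hom C B Y" "pl m (g \<odot> b) = f \<odot> a" using pl_diff by blast
  obtain k where k: "is_kernel C m k" using has_kernel[of m] m by (auto simp: Hom_def)
  define P where "P = Dom C k"
  have kH: "k \<in> Hom C P B" "m \<odot> k = z P Y" using kernel_Hom[OF k m(1)] by (auto simp: P_def)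
  have mh: "pl (m \<odot> h) (g \<odot> (b \<odot> h)) = f \<odot> (a \<odot> h)" if "h \<in> Hom C W B" for W h
  proof -
    have "pl (m \<odot> h) ((g \<odot> b) \<odot> h) = (f \<odot> a) \<odot> h"
      using pl_Cmp[OF that m(1) fa(2)] m(2) by simp
    then show ?thesis using that B(4,5) f g by (simp add: Hom_def)
  qed
  have ab: "pl (i \<odot> (a \<odot> h)) (j \<odot> (b \<odot> h)) = h" if h: "h \<in> Hom C W B" for W h
  proof -
    have "i \<odot> a \<in> Hom C B B" "j \<odot> b \<in> Hom C B B" using B by (auto simp: Hom_def)
    then have "pl ((i \<odot> a) \<odot> h) ((j \<odot> b) \<odot> h) = h"
      using pl_Cmp[OF h, of "i \<odot> a" B "j \<odot> b"] B(10) Ident_left[OF h] by simp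
    then show ?thesis using h B(1-5) by (simp add: Hom_def)
  qed
  have "is_pullback C f g (a \<odot> k) (b \<odot> k)"
  proof (rule pullbackI[OF f g, of _ P])
    show "a \<odot> k \<in> Hom C P X" "b \<odot> k \<in> Hom C P Z" using B kH by (auto simp: Hom_def)
    have "g \<odot> (b \<odot> k) \<in> Hom C P Y" using B(5) kH(1) g by (auto simp: Hom_def)
    then show "f \<odot> (a \<odot> k) = g \<odot> (b \<odot> k)" using mh[OF kH(1)] kH(2) z_pl by simp
  next
    fix W x y assume x: "x \<in> Hom C W X" "y \<in> Hom C W Z" "f \<odot> x = g \<odot> y"
    let ?h = "pl (i \<odot> x) (j \<odot> y)"
    have W: "W \<in> Ob C" using x Hom_Ob by blast
    have ix: "i \<odot> x \<in> Hom C W B" "j \<odot> y \<in> Hom C W B" using x B by (auto simp: Hom_def)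
    then have h: "?h \<in> Hom C W B" by (rule pl_Hom)
    have "a \<odot> ?h = pl (a \<odot> (i \<odot> x)) (a \<odot> (j \<odot> y))" by (rule Cmp_pl[OF ix B(4)])
    also have "\<dots> = pl x (z W X)"
      using x(1,2) B(2-5) B(6,8)[THEN Cmp_rewrite] o by (simp add: Hom_def)
    finally have ah: "a \<odot> ?h = x" using pl_z x by simp
    have "b \<odot> ?h = pl (b \<odot> (i \<odot> x)) (b \<odot> (j \<odot> y))" by (rule Cmp_pl[OF ix B(5)])
    also have "\<dots> = pl (z W Z) y"
      using x(1,2) B(2-5) B(7,9)[THEN Cmp_rewrite] o by (simp add: Hom_def)
    finally have bh: "b \<odot> ?h = y" using z_pl x by simp
    have gy: "g \<odot> y \<in> Hom C W Y" "m \<odot> ?h \<in> Hom C W Y" "z W Y \<in> Hom C W Y"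
      using g x h m z_Hom W o by (auto simp: Hom_def)
    have "pl (m \<odot> ?h) (g \<odot> y) = pl (z W Y) (g \<odot> y)"
      using mh[OF h] ah bh x(3) z_pl[OF gy(1)] by simp
    then have "m \<odot> ?h = z W Y" using pl_cancel_right[OF gy(2,3,1)] by simp
    then obtain u where u: "u \<in> Hom C W P" "k \<odot> u = ?h" using kernel_lift[OF k m(1) h] P_def by metis
    show "\<exists>u \<in> Hom C W P. (a \<odot> k) \<odot> u = x \<and> (b \<odot> k) \<odot> u = y"
      using u kH(1) B(4,5) ah bh by (intro bexI[of _ u]) (auto simp: Hom_def)
  next
    fix W u v assume u: "u \<in> Hom C W P" "v \<in> Hom C W P" "(a \<odot> k) \<odot> u = (a \<odot> k) \<odot> v" "(b \<odot> k) \<odot> u = (b \<odot> k) \<odot> v"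
    have "a \<odot> (k \<odot> u) = a \<odot> (k \<odot> v)" "b \<odot> (k \<odot> u) = b \<odot> (k \<odot> v)"
      using u kH(1) B(4,5) by (simp_all add: Hom_def)
    moreover have "k \<odot> u \<in> Hom C W B" "k \<odot> v \<in> Hom C W B" using u kH by (auto simp: Hom_def)
    ultimately have "k \<odot> u = k \<odot> v" using ab by metis
    then show "u = v" using mono_cancel[OF kernel_mono[OF k]] u P_def by blast
  qed
  moreover have "a \<odot> k \<in> Hom C P X" "b \<odot> k \<in> Hom C P Z" using B kH by (auto simp: Hom_def)
  ultimately show thesis using that by blast
qed

end

section \<open>Images, balance and stability of epimorphisms in an abelian category\<close>

context abelian
begin

lemma abelian_op: "abelian (op_cat C) pl (\<lambda>X Y. z Y X)"
  using preabelian_op mono_normal epi_normal by (intro abelian.intro abelian_axioms.intro) auto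

lemma pushout_exists:
  assumes f: "f \<in> Hom C Y X" and g: "g \<in> Hom C Y Z"
  obtains P p q where "p \<in> Hom C X P" "q \<in> Hom C Z P" "is_pushout C f g p q"
  by (rule preabelian.pullback_exists[OF preabelian_op, of f X Y g Z]) (use assms in simp_all)

text \<open>Normality presents \<open>f\<close> as the cokernel of some \<open>g\<close>. As
  \<open>g\<close> factors through \<open>k\<close>, any arrow killing \<open>k\<close> kills
  \<open>g\<close> and therefore factors through \<open>f\<close>.\<close>

lemma epi_cokernel_of_kernel:
  assumes f: "epi_arrow C f" and k: "is_kernel C f k"
  shows "is_cokernel C k f"
proof -
  define X Y K where "X = Dom C f" and "Y = Cod C f" and "K = Dom C k"
  have fH: "f \<in> Hom C X Y" using f by (auto simp: epi_arrow_def Hom_def X_def Y_def)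
  have kH: "k \<in> Hom C K X" "f \<odot> k = z K Y" using kernel_Hom[OF k fH] by (auto simp: K_def)
  obtain g where g: "is_cokernel C g f" using epi_normal f by blast
  define V where "V = Dom C g"
  have gH: "g \<in> Hom C V X" using g fH by (auto simp: is_cokernel_def Hom_def V_def)
  have fg: "f \<odot> g = z V Y" using cokernel_Hom[OF g gH] fH by (auto simp: Hom_def)
  then obtain g' where g': "g' \<in> Hom C V K" "k \<odot> g' = g" using kernel_lift[OF k fH gH] K_def by metis
  show ?thesis
  proof (rule cokernelI[OF kH(1) fH kH(2) f])
    fix W h assume h: "h \<in> Hom C X W" "h \<odot> k = z K W"
    have "h \<odot> g = (h \<odot> k) \<odot> g'" using h(1) g' kH(1) by (simp add: Hom_def)
    also have "\<dots> = z V W" unfolding h(2) using g' Hom_Ob(2)[OF h(1)] by (simp add: Hom_def)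
    finally have "h \<odot> g = z V W" .
    then show "\<exists>u \<in> Hom C Y W. u \<odot> f = h"
      using cokernel_lift[OF g gH h(1)] fH Hom_def by (metis (mono_tags, lifting) mem_Collect_eq)
  qed
qed

lemma mono_kernel_of_cokernel: "mono_arrow C f \<Longrightarrow> is_cokernel C f c \<Longrightarrow> is_kernel C c f"
  using abelian.epi_cokernel_of_kernel[OF abelian_op, of f c] by simp

text \<open>Being mono, \<open>f\<close> is the kernel of some \<open>g\<close>; being epi, it
  forces \<open>g\<close> to be zero. Then the identity of \<open>Y\<close> factors through
  \<open>f\<close>, which splits it.\<close>

lemma balanced:
  assumes "mono_arrow C f" "epi_arrow C f"
  shows "iso_arrow C f"
proof -
  define X Y where "X = Dom C f" and "Y = Cod C f"
  have fH: "f \<in> Hom C X Y" using assms by (auto simp: epi_arrow_def Hom_def X_def Y_def)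
  have o: "X \<in> Ob C" "Y \<in> Ob C" using fH Hom_Ob by auto
  obtain g where g: "is_kernel C g f" using mono_normal assms by blast
  define V where "V = Cod C g"
  have gH: "g \<in> Hom C Y V" using g fH by (auto simp: is_kernel_def Hom_def V_def)
  then have V: "V \<in> Ob C" using Hom_Ob by blast
  have "g \<odot> f = z X V" using kernel_Hom[OF g gH] fH by (auto simp: Hom_def)
  then have "g = z Y V" using epi_Hom[OF assms(2) fH gH] by simp
  then have "g \<odot> Ident C Y = z Y V" using V o by simp
  then obtain u where u: "u \<in> Hom C Y X" "f \<odot> u = Ident C Y"
    using kernel_lift[OF g gH Ident_Hom[OF o(2)]] fH Hom_def by (metis (mono_tags, lifting) mem_Collect_eq)
  have "u \<odot> f = Ident C X"
  proof (rule mono_cancel[OF assms(1), of _ _ X])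
    show "f \<odot> (u \<odot> f) = f \<odot> Ident C X" using u(1) u(2)[THEN Cmp_rewrite, of f] fH by (simp add: Hom_def)
  qed (use u fH o in \<open>auto simp: Hom_def\<close>)
  then show ?thesis using iso_arrowI[OF fH u(1)] u by simp
qed

text \<open>Let \<open>g \<odot> e\<close> be zero and \<open>n\<close> a kernel of
  \<open>g\<close>. The mono \<open>m \<odot> n\<close>, through which \<open>f\<close> factors, is
  the kernel of its cokernel \<open>h\<close>. Since \<open>h\<close> kills \<open>f\<close> it
  factors through \<open>c\<close>, so it kills \<open>m\<close>; hence \<open>m\<close> factors
  through \<open>m \<odot> n\<close>, \<open>n\<close> has a right inverse, and \<open>g\<close>
  vanishes.\<close>

lemma image_epi:
  assumes f: "f \<in> Hom C X Y" and c: "is_cokernel C f c" and m: "is_kernel C c m"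
    and e: "e \<in> Hom C X (Dom C m)" "m \<odot> e = f"
  shows "epi_arrow C e"
proof (rule epiI[OF e(1)])
  define I Q where "I = Dom C m" and "Q = Cod C c"
  note e = e[folded I_def]
  have cH: "c \<in> Hom C Y Q" "c \<odot> f = z X Q" using cokernel_Hom[OF c f] by (auto simp: Q_def)
  have mH: "m \<in> Hom C I Y" using kernel_Hom[OF m cH(1)] by (auto simp: I_def)
  fix W g assume g: "g \<in> Hom C (Dom C m) W" "g \<odot> e = z X W"
  note g = g[folded I_def]
  obtain n where n: "is_kernel C g n" using has_kernel[of g] g by (auto simp: Hom_def)
  define N where "N = Dom C n"
  have nH: "n \<in> Hom C N I" "g \<odot> n = z N W" using kernel_Hom[OF n g(1)] by (auto simp: N_def)
  obtain e' where e': "e' \<in> Hom C X N" "n \<odot> e' = e" using kernel_lift[OF n g(1) e(1) g(2)] N_def by metis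
  have mn: "m \<odot> n \<in> Hom C N Y" using mH nH by (auto simp: Hom_def)
  have "mono_arrow C (m \<odot> n)"
  proof (rule monoI[OF mn])
    fix V x assume x: "x \<in> Hom C V N" "(m \<odot> n) \<odot> x = z V Y"
    then have "m \<odot> (n \<odot> x) = z V Y" "n \<odot> x \<in> Hom C V I" using mH nH(1) by (auto simp: Hom_def)
    then have "n \<odot> x = z V I" using mono_Hom[OF kernel_mono[OF m] mH] by blast
    then show "x = z V N" using mono_Hom[OF kernel_mono[OF n] nH(1) x(1)] by blast
  qed
  moreover obtain h where h: "is_cokernel C (m \<odot> n) h" using has_cokernel[of "m \<odot> n"] mn by (auto simp: Hom_def)
  ultimately have k: "is_kernel C h (m \<odot> n)" by (rule mono_kernel_of_cokernel)
  define H where "H = Cod C h"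
  have hH: "h \<in> Hom C Y H" "h \<odot> (m \<odot> n) = z N H" using cokernel_Hom[OF h mn] by (auto simp: H_def)
  have H: "H \<in> Ob C" using hH Hom_Ob by blast
  have "h \<odot> f = (h \<odot> (m \<odot> n)) \<odot> e'"
    using hH(1) mH nH(1) e' e e(2)[symmetric] by (simp add: Hom_def)
  also have "\<dots> = z X H" unfolding hH(2) using e' H by (simp add: Hom_def)
  finally obtain h' where h': "h' \<in> Hom C Q H" "h' \<odot> c = h" using cokernel_lift[OF c f hH(1)] Q_def by metis
  have "h \<odot> m = h' \<odot> (c \<odot> m)" using h' h'(2)[symmetric] cH mH by (simp add: Hom_def)
  also have "\<dots> = z I H" using kernel_Hom[OF m cH(1)] h' Hom_Ob(1)[OF mH] I_def by (simp add: Hom_def)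
  finally obtain s where s: "s \<in> Hom C I N" "(m \<odot> n) \<odot> s = m"
    using kernel_lift[OF k hH(1) mH] mn by (auto simp: Hom_def)
  have I: "I \<in> Ob C" "W \<in> Ob C" using mH g Hom_Ob by blast+
  have "n \<odot> s = Ident C I"
    by (rule mono_cancel[OF kernel_mono[OF m], of _ _ I])
      (use s mH nH(1) I in \<open>auto simp: Hom_def\<close>)
  then have "g = g \<odot> (n \<odot> s)" using g(1) I by (simp add: Hom_def)
  also have "\<dots> = z I W" using nH(1) nH(2)[THEN Cmp_rewrite, of s] s(1) g(1) I by (simp add: Hom_def)
  finally show "g = z (Dom C m) W" by (simp add: I_def)
qed

text \<open>The arrow \<open>?s\<close> from the pullback into the biproduct is the kernel of the
  difference \<open>m\<close>, and \<open>m\<close> is epi because it restricts to \<open>f\<close>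
  on \<open>X\<close>; thus \<open>m\<close> is the cokernel of \<open>?s\<close>. If
  \<open>x \<odot> q\<close> is zero, then \<open>x \<odot> b\<close> kills \<open>?s\<close> and
  equals some \<open>y \<odot> m\<close>. Restriction to \<open>X\<close> gives
  \<open>y \<odot> f = 0\<close>, so \<open>y\<close> vanishes, and restriction to \<open>Z\<close>
  then gives \<open>x = 0\<close>.\<close>

lemma pullback_epi:
  assumes P: "is_pullback C f g p q" and epi: "epi_arrow C f"
  shows "epi_arrow C q"
proof -
  define X Y Z P where "X = Dom C f" and "Y = Cod C f" and "Z = Dom C g" and "P = Dom C p"
  have h: "f \<in> Hom C X Y" "g \<in> Hom C Z Y" "p \<in> Hom C P X" "q \<in> Hom C P Z" and e: "f \<odot> p = g \<odot> q"
    using assms(1) by (auto simp: is_pullback_def Hom_def X_def Y_def Z_def P_def)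
  have o: "X \<in> Ob C" "Y \<in> Ob C" "Z \<in> Ob C" "P \<in> Ob C" using h Hom_Ob by blast+
  obtain B i j a b where B: "B \<in> Ob C" "i \<in> Hom C X B" "j \<in> Hom C Z B" "a \<in> Hom C B X" "b \<in> Hom C B Z"
    "a \<odot> i = Ident C X" "b \<odot> j = Ident C Z" "a \<odot> j = z Z X" "b \<odot> i = z X Z"
    "pl (i \<odot> a) (j \<odot> b) = Ident C B" using has_biproduct[OF o(1,3)] by blast
  have fa: "f \<odot> a \<in> Hom C B Y" "g \<odot> b \<in> Hom C B Y" using B h by (auto simp: Hom_def)
  then obtain m where m: "m \<in> Hom C B Y" "pl m (g \<odot> b) = f \<odot> a" using pl_diff by blast
  have mh: "pl (m \<odot> h) (g \<odot> (b \<odot> h)) = f \<odot> (a \<odot> h)" if "h \<in> Hom C W B" for W h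
  proof -
    have "pl (m \<odot> h) ((g \<odot> b) \<odot> h) = (f \<odot> a) \<odot> h"
      using pl_Cmp[OF that m(1) fa(2)] m(2) by simp
    then show ?thesis using that B(4,5) h by (simp add: Hom_def)
  qed
  have "m \<odot> i \<in> Hom C X Y" using m B by (auto simp: Hom_def)
  moreover have "g \<odot> (b \<odot> i) = z X Y" "f \<odot> (a \<odot> i) = f" using B(9,6) h o by (auto simp: Hom_def)
  ultimately have mi: "m \<odot> i = f" using mh[OF B(2)] pl_z by metis
  have mepi: "epi_arrow C m"
  proof (rule epiI[OF m(1)])
    fix W x assume x: "x \<in> Hom C Y W" "x \<odot> m = z B W"
    have "x \<odot> f = (x \<odot> m) \<odot> i" using x(1) m(1) B(2) mi by (simp add: Hom_def)
    also have "\<dots> = z X W" unfolding x(2) using B(2) Hom_Ob(2)[OF x(1)] by (simp add: Hom_def)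
    finally show "x = z Y W" using epi_Hom[OF epi h(1) x(1)] by simp
  qed
  let ?s = "pl (i \<odot> p) (j \<odot> q)"
  have ip: "i \<odot> p \<in> Hom C P B" "j \<odot> q \<in> Hom C P B" using h B by (auto simp: Hom_def)
  then have s: "?s \<in> Hom C P B" by (rule pl_Hom)
  have "a \<odot> ?s = pl (a \<odot> (i \<odot> p)) (a \<odot> (j \<odot> q))" by (rule Cmp_pl[OF ip B(4)])
  also have "\<dots> = pl p (z P X)"
    using h B(2-5) B(6,8)[THEN Cmp_rewrite] o by (simp add: Hom_def)
  finally have as: "a \<odot> ?s = p" using pl_z h by simp
  have "b \<odot> ?s = pl (b \<odot> (i \<odot> p)) (b \<odot> (j \<odot> q))" by (rule Cmp_pl[OF ip B(5)])
  also have "\<dots> = pl (z P Z) q"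
    using h B(2-5) B(7,9)[THEN Cmp_rewrite] o by (simp add: Hom_def)
  finally have bs: "b \<odot> ?s = q" using z_pl h by simp
  have ker: "is_kernel C m ?s"
  proof (rule kernelI[OF m(1) s])
    have gq: "g \<odot> q \<in> Hom C P Y" "m \<odot> ?s \<in> Hom C P Y" "z P Y \<in> Hom C P Y"
      using h m s z_Hom o by (auto simp: Hom_def)
    have "pl (m \<odot> ?s) (g \<odot> q) = pl (z P Y) (g \<odot> q)" using mh[OF s] as bs e z_pl[OF gq(1)] by simp
    then show "m \<odot> ?s = z P Y" using pl_cancel_right[OF gq(2,3,1)] by simp
    show "mono_arrow C ?s"
    proof (rule monoI[OF s])
      fix W x assume x: "x \<in> Hom C W P" "?s \<odot> x = z W B"
      have W: "W \<in> Ob C" using x Hom_Ob by blast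
      have "p \<odot> x = a \<odot> (?s \<odot> x)" using as[THEN Cmp_rewrite, of x] x(1) s B(4) by (simp add: Hom_def)
      also have "\<dots> = z W X" using x(2) B(4) W by (simp add: Hom_def)
      finally have 1: "p \<odot> x = p \<odot> z W P" using h W by (simp add: Hom_def)
      have "q \<odot> x = b \<odot> (?s \<odot> x)" using bs[THEN Cmp_rewrite, of x] x(1) s B(5) by (simp add: Hom_def)
      also have "\<dots> = z W Z" using x(2) B(5) W by (simp add: Hom_def)
      finally have 2: "q \<odot> x = q \<odot> z W P" using h W by (simp add: Hom_def)
      show "x = z W P" using pullback_unique[OF P _ _ 1 2] x z_Hom W o P_def by blast
    qed
    fix W x assume x: "x \<in> Hom C W B" "m \<odot> x = z W Y"
    have ax: "a \<odot> x \<in> Hom C W X" "b \<odot> x \<in> Hom C W Z" "g \<odot> (b \<odot> x) \<in> Hom C W Y" using x B h by (auto simp: Hom_def)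
    have "f \<odot> (a \<odot> x) = g \<odot> (b \<odot> x)" using mh[OF x(1)] x(2) z_pl[OF ax(3)] by simp
    then obtain u where u: "u \<in> Hom C W P" "p \<odot> u = a \<odot> x" "q \<odot> u = b \<odot> x"
      using pullback_lift[OF P, of "a \<odot> x" W "b \<odot> x"] ax P_def X_def Z_def by metis
    have "?s \<odot> u = pl (i \<odot> (p \<odot> u)) (j \<odot> (q \<odot> u))"
      using pl_Cmp[OF u(1) ip] u(1) h B(2,3) by (simp add: Hom_def)
    also have "\<dots> = pl ((i \<odot> a) \<odot> x) ((j \<odot> b) \<odot> x)"
      unfolding u(2,3) using x(1) B(2-5) by (simp add: Hom_def)
    also have "\<dots> = pl (i \<odot> a) (j \<odot> b) \<odot> x"
      using pl_Cmp[OF x(1), of "i \<odot> a" B "j \<odot> b"] B(2-5) by (simp add: Hom_def)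
    also have "\<dots> = x" using B(10) Ident_left[OF x(1)] by simp
    finally show "\<exists>u \<in> Hom C W P. ?s \<odot> u = x" using u by blast
  qed
  have cok: "is_cokernel C ?s m" by (rule epi_cokernel_of_kernel[OF mepi ker])
  show ?thesis
  proof (rule epiI[OF h(4)])
    fix W x assume x: "x \<in> Hom C Z W" "x \<odot> q = z P W"
    have W: "W \<in> Ob C" using x Hom_Ob by blast
    have xb: "x \<odot> b \<in> Hom C B W" using x B by (auto simp: Hom_def)
    have "(x \<odot> b) \<odot> ?s = z P W" using x B(5) s bs by (simp add: Hom_def)
    then obtain y where y: "y \<in> Hom C Y W" "y \<odot> m = x \<odot> b"
      using cokernel_lift[OF cok s xb] m Hom_def by (metis (mono_tags, lifting) mem_Collect_eq)
    have "y \<odot> f = (y \<odot> m) \<odot> i" using y(1) m(1) B(2) mi by (simp add: Hom_def)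
    also have "\<dots> = z X W" unfolding y(2) using x(1) B(2,5,9) o W by (simp add: Hom_def)
    finally have "y = z Y W" using epi_Hom[OF epi h(1) y(1)] by simp
    then have "x \<odot> b = z B W" using y(2) m(1) W by (simp add: Hom_def)
    then have "(x \<odot> b) \<odot> j = z Z W" using B(3) W by (simp add: Hom_def)
    then show "x = z Z W" using x(1) B(3,5,7) by (simp add: Hom_def)
  qed
qed

lemma pushout_cokernel:
  assumes "is_pushout C f g p q" "is_cokernel C f k"
  obtains k0 where "k0 \<in> Hom C (Cod C p) (Cod C k)" "k0 \<odot> p = k" "is_cokernel C q k0"
  by (rule preabelian.pullback_kernel[OF preabelian_op, of f g p q k]) (use assms in simp_all)

lemma pushout_mono: "is_pushout C f g p q \<Longrightarrow> mono_arrow C f \<Longrightarrow> mono_arrow C q"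
  using abelian.pullback_epi[OF abelian_op, of f g p q] by simp

end

section \<open>Orthogonality classes under composition and pullback\<close>

lemma (in category) two_out_of_three_Cmp:
    "two_out_of_three C S \<Longrightarrow> f \<in> Hom C X Y \<Longrightarrow> g \<in> Hom C Y Z \<Longrightarrow> f \<in> S \<Longrightarrow> g \<in> S \<Longrightarrow> g \<odot> f \<in> S"
  and two_out_of_three_left:
    "two_out_of_three C S \<Longrightarrow> f \<in> Hom C X Y \<Longrightarrow> g \<in> Hom C Y Z \<Longrightarrow> f \<in> S \<Longrightarrow> g \<odot> f \<in> S \<Longrightarrow> g \<in> S"
  and two_out_of_three_right:
    "two_out_of_three C S \<Longrightarrow> f \<in> Hom C X Y \<Longrightarrow> g \<in> Hom C Y Z \<Longrightarrow> g \<in> S \<Longrightarrow> g \<odot> f \<in> S \<Longrightarrow> f \<in> S"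
  unfolding two_out_of_three_def Hom_def mem_Collect_eq by metis+

lemmas (in category) Lorth_Cmp = two_out_of_three_Cmp[OF Lorth_two_out_of_three]
  and Lorth_left = two_out_of_three_left[OF Lorth_two_out_of_three]
  and Lorth_right = two_out_of_three_right[OF Lorth_two_out_of_three]
  and Rorth_right = two_out_of_three_right[OF Rorth_two_out_of_three]

text \<open>An arrow into \<open>Z\<close> is lifted by composing it with \<open>g\<close>, lifting
  through \<open>f\<close>, and pairing the lift with the arrow itself.\<close>

lemma (in category) Rorth_pullback:
  assumes P: "is_pullback C f g p q" and f: "f \<in> Rorth C S"
  shows "q \<in> Rorth C S"
proof -
  define X Y Z P where "X = Dom C f" and "Y = Cod C f" and "Z = Dom C g" and "P = Dom C p"
  have h: "f \<in> Hom C X Y" "g \<in> Hom C Z Y" "p \<in> Hom C P X" "q \<in> Hom C P Z" and e: "f \<odot> p = g \<odot> q"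
    using P by (auto simp: is_pullback_def Hom_def X_def Y_def Z_def P_def)
  show ?thesis
  proof (rule RorthI[OF h(4)])
    fix T u assume T: "T \<in> S" "u \<in> Hom C T Z"
    then have "g \<odot> u \<in> Hom C T Y" using h by (auto simp: Hom_def)
    then obtain v where v: "v \<in> Hom C T X" "f \<odot> v = g \<odot> u" using RorthE[OF f h(1) T(1)] by blast
    then show "\<exists>v \<in> Hom C T P. q \<odot> v = u"
      using pullback_lift[OF P, of v T u] T by (metis P_def X_def Z_def)
  next
    fix T v w assume T: "T \<in> S" "v \<in> Hom C T P" "w \<in> Hom C T P" "q \<odot> v = q \<odot> w"
    have "f \<odot> (p \<odot> v) = g \<odot> (q \<odot> v)" "f \<odot> (p \<odot> w) = g \<odot> (q \<odot> w)"
      using e[THEN Cmp_rewrite, of v] e[THEN Cmp_rewrite, of w] h T(2,3) by (auto simp: Hom_def)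
    moreover have "p \<odot> v \<in> Hom C T X" "p \<odot> w \<in> Hom C T X" using h T by (auto simp: Hom_def)
    ultimately have "p \<odot> v = p \<odot> w" using Rorth_unique[OF f h(1) T(1)] T(4) category_axioms by metis
    then show "v = w" using pullback_unique[OF P, of v T w] T by (simp add: P_def)
  qed
qed

text \<open>Exchanges the apex of a pullback along an isomorphism. This is how an arrow of
  \<open>Rorth C T\<close> will itself be recognized as a side of a pullback square over
  torsion-free objects.\<close>

lemma (in category) pullback_iso:
  assumes P: "is_pullback C f g p q" and u: "iso_arrow C u" "Cod C u = Dom C p"
  shows "is_pullback C f g (p \<odot> u) (q \<odot> u)"
proof -
  define X Y Z P U where "X = Dom C f" and "Y = Cod C f" and "Z = Dom C g" and "P = Dom C p" and "U = Dom C u"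
  have h: "f \<in> Hom C X Y" "g \<in> Hom C Z Y" "p \<in> Hom C P X" "q \<in> Hom C P Z" and e: "f \<odot> p = g \<odot> q"
    using P by (auto simp: is_pullback_def Hom_def X_def Y_def Z_def P_def)
  have uH: "u \<in> Hom C U P" using u by (auto simp: Hom_def iso_arrow_def P_def U_def)
  obtain u' where u': "u' \<in> Hom C P U" "u' \<odot> u = Ident C U" "u \<odot> u' = Ident C P"
    using iso_arrowE[OF u(1) uH] by metis
  show ?thesis
  proof (rule pullbackI[OF h(1,2), of _ U])
    show "p \<odot> u \<in> Hom C U X" "q \<odot> u \<in> Hom C U Z" using h uH by (auto simp: Hom_def)
    show "f \<odot> (p \<odot> u) = g \<odot> (q \<odot> u)" using h uH e[THEN Cmp_rewrite, of u] by (auto simp: Hom_def)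
  next
    fix W a b assume a: "a \<in> Hom C W X" "b \<in> Hom C W Z" "f \<odot> a = g \<odot> b"
    then obtain w where w: "w \<in> Hom C W P" "p \<odot> w = a" "q \<odot> w = b"
      using pullback_lift[OF P, of a W b] by (metis P_def X_def Z_def)
    have "(p \<odot> u) \<odot> (u' \<odot> w) = a" "(q \<odot> u) \<odot> (u' \<odot> w) = b"
      using w h uH u'(1) u'(3)[THEN Cmp_rewrite, of w] by (auto simp: Hom_def)
    moreover have "u' \<odot> w \<in> Hom C W U" using u' w by (auto simp: Hom_def)
    ultimately show "\<exists>v \<in> Hom C W U. (p \<odot> u) \<odot> v = a \<and> (q \<odot> u) \<odot> v = b" by blast
  next
    fix W v w assume v: "v \<in> Hom C W U" "w \<in> Hom C W U" "(p \<odot> u) \<odot> v = (p \<odot> u) \<odot> w" "(q \<odot> u) \<odot> v = (q \<odot> u) \<odot> w"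
    have "u \<odot> v = u \<odot> w"
      by (rule pullback_unique[OF P, of _ W]) (use v uH h P_def in \<open>auto simp: Hom_def\<close>)
    moreover have "u' \<odot> (u \<odot> v) = v" "u' \<odot> (u \<odot> w) = w"
      using v(1,2) uH u'(1) u'(2)[THEN Cmp_rewrite] by (auto simp: Hom_def)
    ultimately show "v = w" by metis
  qed
qed

text \<open>An epimorphism is the cokernel of its kernel, and arrows into \<open>S\<close> kill that
  kernel, so they descend uniquely along \<open>f\<close>.\<close>

lemma (in abelian) LorthI_epi:
  assumes f: "epi_arrow C f" and k: "is_kernel C f k" and S: "S \<subseteq> Ob C"
    and "\<And>Y g. Y \<in> S \<Longrightarrow> g \<in> Hom C (Dom C k) Y \<Longrightarrow> g = z (Dom C k) Y"
  shows "f \<in> Lorth C S"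
proof -
  define X Y K where "X = Dom C f" and "Y = Cod C f" and "K = Dom C k"
  have fH: "f \<in> Hom C X Y" using f by (auto simp: epi_arrow_def Hom_def X_def Y_def)
  have kH: "k \<in> Hom C K X" using kernel_Hom[OF k fH] by (auto simp: K_def)
  note c = epi_cokernel_of_kernel[OF f k]
  show ?thesis
  proof (rule LorthI[OF fH])
    fix V u assume u: "V \<in> S" "u \<in> Hom C X V"
    then have "u \<odot> k \<in> Hom C K V" using kH by (auto simp: Hom_def)
    then have "u \<odot> k = z K V" using assms(4) u K_def by blast
    then show "\<exists>v \<in> Hom C Y V. v \<odot> f = u" using cokernel_lift[OF c kH u(2)] Y_def by metis
  next
    fix V v w assume "v \<in> Hom C Y V" "w \<in> Hom C Y V" "v \<odot> f = w \<odot> f"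
    then show "v = w" using epi_cancel[OF f] Y_def by blast
  qed
qed

section \<open>Torsion pairs\<close>

locale torsion = abelian C pl z for C :: "('o, 'm) cat" (structure) and pl z +
  fixes T F :: "'o set"
  assumes torsion_pair: "torsion_pair C T F"
begin

lemma torsion_op: "torsion (op_cat C) pl (\<lambda>X Y. z Y X) F T"
  using abelian_op torsion_pair_op[OF category_axioms torsion_pair]
  by (intro torsion.intro torsion_axioms.intro)

lemma T_Ob: "X \<in> T \<Longrightarrow> X \<in> Ob C" and F_Ob: "X \<in> F \<Longrightarrow> X \<in> Ob C"
  using torsion_pair by (auto simp: torsion_pair_def)

lemma Hom_T_F: "X \<in> T \<Longrightarrow> Y \<in> F \<Longrightarrow> f \<in> Hom C X Y \<Longrightarrow> f = z X Y"
  using torsion_pair zero_arrow_Hom unfolding torsion_pair_def by blast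

lemma torsion_sequence:
  assumes "X \<in> Ob C"
  obtains A B i p where "A \<in> T" "B \<in> F" "i \<in> Hom C A X" "p \<in> Hom C X B" "is_kernel C p i" "is_cokernel C i p"
  using torsion_pair assms unfolding torsion_pair_def short_exact_def by blast

text \<open>For such an \<open>X\<close> the projection \<open>p\<close> onto the torsion-free
  quotient is zero. Arrows killing \<open>i\<close> factor through \<open>p\<close>, so
  \<open>i\<close> is epi as well as mono, and \<open>X\<close> is isomorphic to its torsion
  part.\<close>

lemma T_I:
  assumes X: "X \<in> Ob C" and 0: "\<And>Y f. Y \<in> F \<Longrightarrow> f \<in> Hom C X Y \<Longrightarrow> f = z X Y"
  shows "X \<in> T"
proof -
  obtain A B i p where s: "A \<in> T" "B \<in> F" "i \<in> Hom C A X" "p \<in> Hom C X B" "is_kernel C p i" "is_cokernel C i p"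
    using torsion_sequence[OF X] .
  have p: "p = z X B" using 0 s by blast
  have "epi_arrow C i"
  proof (rule epiI[OF s(3)])
    fix W k assume k: "k \<in> Hom C X W" "k \<odot> i = z A W"
    then obtain u where "u \<in> Hom C B W" "u \<odot> p = k"
      using cokernel_lift[OF s(6,3) k] s(4) by (auto simp: Hom_def)
    then show "k = z X W" using p X F_Ob[OF s(2)] by (auto simp: Hom_def)
  qed
  then have "iso_arrow C i" using balanced kernel_mono[OF s(5)] by blast
  then have "isomorphic C A X" using s unfolding isomorphic_def by blast
  then show ?thesis using torsion_pair s X unfolding torsion_pair_def by blast
qed

lemma F_I:
  assumes "X \<in> Ob C" "\<And>Y f. Y \<in> T \<Longrightarrow> f \<in> Hom C Y X \<Longrightarrow> f = z Y X"
  shows "X \<in> F"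
  by (rule torsion.T_I[OF torsion_op]) (use assms in simp_all)

lemma T_quotient:
  assumes "epi_arrow C e" "e \<in> Hom C X Y" "X \<in> T"
  shows "Y \<in> T"
proof (rule T_I)
  show "Y \<in> Ob C" using assms Hom_Ob by blast
  fix V f assume f: "V \<in> F" "f \<in> Hom C Y V"
  then have "f \<odot> e \<in> Hom C X V" using assms by (auto simp: Hom_def)
  then show "f = z Y V" using Hom_T_F[OF assms(3) f(1)] epi_Hom[OF assms(1,2) f(2)] by simp
qed

lemma F_sub: "mono_arrow C m \<Longrightarrow> m \<in> Hom C X Y \<Longrightarrow> Y \<in> F \<Longrightarrow> X \<in> F"
  using torsion.T_quotient[OF torsion_op, of m Y X] by simp

lemma T_extension:
  assumes e: "epi_arrow C e" "e \<in> Hom C X Y" "is_kernel C e k" and "Dom C k \<in> T" "Y \<in> T"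
  shows "X \<in> T"
proof (rule T_I)
  show "X \<in> Ob C" using assms Hom_Ob by blast
  fix V f assume f: "V \<in> F" "f \<in> Hom C X V"
  have k: "k \<in> Hom C (Dom C k) X" using kernel_Hom[OF e(3,2)] by simp
  then have "f \<odot> k \<in> Hom C (Dom C k) V" using f by (auto simp: Hom_def)
  then have "f \<odot> k = z (Dom C k) V" using Hom_T_F assms f by blast
  then obtain g where g: "g \<in> Hom C Y V" "g \<odot> e = f"
    using cokernel_lift[OF epi_cokernel_of_kernel[OF e(1,3)] k f(2)] e(2) by (auto simp: Hom_def)
  then have "g = z Y V" using Hom_T_F assms f by blast
  then show "f = z X V" using g e(2) F_Ob[OF f(1)] by (auto simp: Hom_def)
qed

lemma zero_T: "zero_object C Z \<Longrightarrow> Z \<in> T"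
  using T_I zero_object_Hom zero_object_iff by metis

lemma zero_F: "zero_object C Z \<Longrightarrow> Z \<in> F"
  using torsion.zero_T[OF torsion_op] by simp

lemma T_subset: "T \<subseteq> Ob C" and F_subset: "F \<subseteq> Ob C"
  using T_Ob F_Ob by auto

lemma epi_Lorth:
  assumes "epi_arrow C f" "is_kernel C f k" "Dom C k \<in> T"
  shows "f \<in> Lorth C F"
  by (rule LorthI_epi[OF assms(1,2) F_subset]) (use assms Hom_T_F in blast)

lemma mono_Rorth: "mono_arrow C f \<Longrightarrow> is_cokernel C f c \<Longrightarrow> Cod C c \<in> F \<Longrightarrow> f \<in> Rorth C T"
  using torsion.epi_Lorth[OF torsion_op, of f c] by simp

lemma sequence_orth:
  assumes "is_kernel C p i" "is_cokernel C i p" "i \<in> Hom C A X" "p \<in> Hom C X B" "A \<in> T" "B \<in> F"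
  shows "p \<in> Lorth C F" "i \<in> Rorth C T"
  using epi_Lorth[OF cokernel_epi[OF assms(2)] assms(1)] mono_Rorth[OF kernel_mono[OF assms(1)] assms(2)] assms(3-)
  by (auto simp: Hom_def)

text \<open>Extending \<open>p\<close> along \<open>w\<close> and lifting \<open>i'\<close> through
  \<open>w\<close> shows that \<open>w\<close> compares both ends of the two torsion sequences
  faithfully. An arrow \<open>k\<close> killed by \<open>w\<close> is killed by
  \<open>p = r \<odot> w\<close>, so it factors through the torsion part as \<open>k'\<close>. As
  \<open>i'\<close> is mono, \<open>t \<odot> k'\<close> vanishes, and
  \<open>l \<odot> t = i\<close> then makes \<open>k\<close> vanish.\<close>

lemma orth_mono:
  assumes w: "w \<in> Lorth C F" "w \<in> Rorth C T"
  shows "mono_arrow C w"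
proof -
  define X Y where "X = Dom C w" and "Y = Cod C w"
  have wH: "w \<in> Hom C X Y" using Lorth_Ar[OF w(1)] by (auto simp: Hom_def X_def Y_def)
  have o: "X \<in> Ob C" "Y \<in> Ob C" using wH Hom_Ob by auto
  obtain A B i p where s: "A \<in> T" "B \<in> F" "i \<in> Hom C A X" "p \<in> Hom C X B" "is_kernel C p i" "is_cokernel C i p"
    using torsion_sequence[OF o(1)] .
  obtain A' B' i' p' where s': "A' \<in> T" "B' \<in> F" "i' \<in> Hom C A' Y" "p' \<in> Hom C Y B'" "is_kernel C p' i'" "is_cokernel C i' p'"
    using torsion_sequence[OF o(2)] .
  obtain r where r: "r \<in> Hom C Y B" "r \<odot> w = p" using LorthE[OF w(1) wH s(2,4)] .
  obtain l where l: "l \<in> Hom C A' X" "w \<odot> l = i'" using RorthE[OF w(2) wH s'(1,3)] .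
  have "w \<odot> i \<in> Hom C A Y" using wH s by (auto simp: Hom_def)
  then obtain t where t: "t \<in> Hom C A A'" "i' \<odot> t = w \<odot> i"
    using RorthE[OF sequence_orth(2)[OF s'(5,6,3,4,1,2)] s'(3) s(1)] by blast
  have lt: "l \<odot> t = i"
  proof (rule Rorth_unique[OF w(2) wH s(1)])
    show "w \<odot> (l \<odot> t) = w \<odot> i" using t(2) l(1) l(2)[THEN Cmp_rewrite, of t] t(1) wH by (simp add: Hom_def)
  qed (use l t s category_axioms in \<open>auto simp: Hom_def\<close>)
  show ?thesis
  proof (rule monoI[OF wH])
    fix W k assume k: "k \<in> Hom C W X" "w \<odot> k = z W Y"
    have W: "W \<in> Ob C" using k Hom_Ob by blast
    have "p \<odot> k = r \<odot> (w \<odot> k)" using r(1) r(2)[symmetric] wH k(1) by (simp add: Hom_def)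
    also have "\<dots> = z W B" using k(2) r(1) W by (simp add: Hom_def)
    finally obtain k' where k': "k' \<in> Hom C W A" "i \<odot> k' = k"
      using kernel_lift[OF s(5,4) k(1)] s(3) by (auto simp: Hom_def)
    have "i' \<odot> (t \<odot> k') = w \<odot> (i \<odot> k')"
      using t(1) t(2)[THEN Cmp_rewrite, of k'] s(3) s'(3) k'(1) wH by (simp add: Hom_def)
    also have "\<dots> = z W Y" using k k' by simp
    finally have "t \<odot> k' = z W A'"
      using mono_Hom[OF kernel_mono[OF s'(5)] s'(3) Cmp_Hom[OF k'(1) t(1)]] by simp
    then have "l \<odot> (t \<odot> k') = z W X" using l(1) W by (simp add: Hom_def)
    then show "k = z W X" using lt[THEN Cmp_rewrite, of k'] k' t(1) l(1) by (simp add: Hom_def)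
  qed
qed

lemma orth_iso:
  assumes "w \<in> Lorth C F" "w \<in> Rorth C T"
  shows "iso_arrow C w"
  using balanced[OF orth_mono] torsion.orth_mono[OF torsion_op, of w] assms by simp

text \<open>The middle object is the pullback of \<open>r f\<close> along \<open>Y \<rightarrow> r Y\<close>.\<close>

lemma reflection_factorization:
  assumes f: "f \<in> Hom C X Y"
  obtains E B B' p p' r i b e where
    "B \<in> F" "B' \<in> F" "p \<in> Hom C X B" "p' \<in> Hom C Y B'" "r \<in> Hom C B B'"
    "p \<in> Lorth C F" "is_pullback C p' r b e" "i \<in> Hom C X E" "b \<in> Hom C E Y" "e \<in> Hom C E B"
    "b \<odot> i = f" "e \<odot> i = p" "i \<in> Lorth C F" "b \<in> Rorth C T"
proof -
  have o: "X \<in> Ob C" "Y \<in> Ob C" using f Hom_Ob by auto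
  obtain A B a p where s: "A \<in> T" "B \<in> F" "a \<in> Hom C A X" "p \<in> Hom C X B" "is_kernel C p a" "is_cokernel C a p"
    using torsion_sequence[OF o(1)] .
  obtain A' B' a' p' where s': "A' \<in> T" "B' \<in> F" "a' \<in> Hom C A' Y" "p' \<in> Hom C Y B'" "is_kernel C p' a'" "is_cokernel C a' p'"
    using torsion_sequence[OF o(2)] .
  have p: "p \<in> Lorth C F" by (rule sequence_orth(1)[OF s(5,6,3,4,1,2)])
  have "p' \<odot> f \<in> Hom C X B'" using f s' by (auto simp: Hom_def)
  then obtain r where r: "r \<in> Hom C B B'" "r \<odot> p = p' \<odot> f" using LorthE[OF p s(4) s'(2)] by blast
  obtain E b e where E: "b \<in> Hom C E Y" "e \<in> Hom C E B" "is_pullback C p' r b e"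
    using pullback_exists[OF s'(4) r(1)] by blast
  obtain i where i: "i \<in> Hom C X E" "b \<odot> i = f" "e \<odot> i = p"
    using pullback_lift[OF E(3), of f X p] f s(4) r s'(4) E(1) unfolding Hom_def by (auto simp: Hom_def)
  \<comment> \<open>Both ends of \<open>r\<close> lie in \<open>F\<close>, so the relevant hom sets
    out of \<open>T\<close> consist of zero arrows only; pulling back passes the property to
    \<open>b\<close>.\<close>
  have "r \<in> Rorth C T"
  proof (rule RorthI[OF r(1)])
    fix V u assume V: "V \<in> T" "u \<in> Hom C V B'"
    have "z V B \<in> Hom C V B" "r \<odot> z V B = u"
      using Hom_T_F[OF V(1) s'(2) V(2)] r(1) T_Ob[OF V(1)] F_Ob[OF s(2)] z_Hom by (auto simp: Hom_def)
    then show "\<exists>v \<in> Hom C V B. r \<odot> v = u" by blast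
  next
    fix V v w assume "V \<in> T" "v \<in> Hom C V B" "w \<in> Hom C V B"
    then show "v = w" using Hom_T_F s(2) by metis
  qed
  then have b: "b \<in> Rorth C T" by (rule Rorth_pullback[OF pullback_sym[OF E(3)]])
  obtain k0 where k0: "k0 \<in> Hom C A' E" "is_kernel C e k0"
    using pullback_kernel[OF E(3) s'(5)] s'(3) E(1) by (auto simp: Hom_def)
  \<comment> \<open>\<open>e\<close> is the pullback of the epimorphism \<open>p'\<close> and has
    the same kernel, the torsion part \<open>A'\<close> of \<open>Y\<close>. Two-out-of-three
    applied to \<open>e \<odot> i = p\<close> then yields the claim for \<open>i\<close>.\<close>
  have e: "e \<in> Lorth C F"
    by (rule epi_Lorth[OF pullback_epi[OF E(3) cokernel_epi[OF s'(6)]] k0(2)])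
      (use k0 s' in \<open>auto simp: Hom_def\<close>)
  have "i \<in> Lorth C F" using Lorth_right[OF i(1) E(2) e] i(3) p by simp
  then show thesis using that[OF s(2) s'(2) s(4) s'(4) r(1) p E(3) i(1) E(1,2) i(2,3)] b by blast
qed

lemma Lorth_Rorth_factors: "factors_through C (Lorth C F) (Rorth C T)"
  unfolding factors_through_def
proof
  fix f assume "f \<in> Ar C"
  then have f: "f \<in> Hom C (Dom C f) (Cod C f)" by (simp add: Hom_def)
  obtain E i b where "i \<in> Hom C (Dom C f) E" "b \<in> Hom C E (Cod C f)"
    "b \<odot> i = f" "i \<in> Lorth C F" "b \<in> Rorth C T"
    using reflection_factorization[OF f] by metis
  then show "\<exists>i \<in> Lorth C F. \<exists>p \<in> Rorth C T. Cod C i = Dom C p \<and> f = p \<odot> i"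
    by (intro bexI[of _ i] bexI[of _ b]) (auto simp: Hom_def)
qed

text \<open>For \<open>p\<close> in \<open>Rorth C T\<close> the left factor \<open>w\<close> of its
  factorization lies in both classes, hence is an isomorphism. So \<open>p\<close> itself is the
  pullback of an arrow \<open>r\<close> between objects of \<open>F\<close>. A diagonal into that
  pullback consists of \<open>v\<close> and an extension \<open>t\<close> of
  \<open>q \<odot> u\<close> along \<open>i\<close>, and extensions along \<open>i\<close> into
  objects of \<open>F\<close> exist uniquely.\<close>

lemma Lorth_Rorth_lifts: "lifts_uniquely C (Lorth C F) (Rorth C T)"
  unfolding lifts_uniquely_def
proof (intro ballI allI impI)
  fix i p u v assume i: "i \<in> Lorth C F" and p: "p \<in> Rorth C T" and sq: "lift_square C i p u v"
  define X Y A B where "X = Dom C p" and "Y = Cod C p" and "A = Dom C i" and "B = Cod C i"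
  have h: "i \<in> Hom C A B" "p \<in> Hom C X Y" "u \<in> Hom C A X" "v \<in> Hom C B Y" and e: "p \<odot> u = v \<odot> i"
    using Lorth_Ar[OF i] Rorth_Ar[OF p] sq by (auto simp: lift_square_def Hom_def X_def Y_def A_def B_def)
  obtain E R R' q q' r w b c where s:
    "R \<in> F" "R' \<in> F" "q \<in> Hom C X R" "q' \<in> Hom C Y R'" "r \<in> Hom C R R'"
    "q \<in> Lorth C F" "is_pullback C q' r b c" "w \<in> Hom C X E" "b \<in> Hom C E Y" "c \<in> Hom C E R"
    "b \<odot> w = p" "c \<odot> w = q" "w \<in> Lorth C F" "b \<in> Rorth C T"
    using reflection_factorization[OF h(2)] .
  have "w \<in> Rorth C T" using Rorth_right[OF s(8,9,14)] s(11) p by simp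
  then have "iso_arrow C w" using orth_iso s(13) by blast
  then have P: "is_pullback C q' r p q" using pullback_iso[OF s(7), of w] s(8-12) by (simp add: Hom_def)
  have qu: "q \<odot> u \<in> Hom C A R" using s h by (auto simp: Hom_def)
  obtain t where t: "t \<in> Hom C B R" "t \<odot> i = q \<odot> u" using LorthE[OF i h(1) s(1) qu] .
  have qp: "q' \<odot> p = r \<odot> q" using P by (simp add: is_pullback_def)
  \<comment> \<open>The two arrows end in \<open>R'\<close>, an object of \<open>F\<close>, so it is
    enough to compare them after \<open>i\<close>.\<close>
  have "r \<odot> t = q' \<odot> v"
  proof (rule Lorth_unique[OF i h(1) s(2)])
    have "(r \<odot> t) \<odot> i = (r \<odot> q) \<odot> u" using s(3,5) t h by (simp add: Hom_def)
    also have "\<dots> = (q' \<odot> v) \<odot> i" unfolding qp[symmetric] using s(4) e h by (simp add: Hom_def)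
    finally show "(r \<odot> t) \<odot> i = (q' \<odot> v) \<odot> i" .
  qed (use s t h category_axioms in \<open>auto simp: Hom_def\<close>)
  then obtain x where x: "x \<in> Hom C B X" "p \<odot> x = v" "q \<odot> x = t"
    using pullback_lift[OF P, of v B t] h t s(4,5) by (auto simp: Hom_def)
  have xi: "x \<odot> i = u"
  proof (rule pullback_unique[OF P, of _ A])
    show "p \<odot> (x \<odot> i) = p \<odot> u" using x(1) x(2)[THEN Cmp_rewrite, of i] h e by (simp add: Hom_def)
    show "q \<odot> (x \<odot> i) = q \<odot> u" using x(1) x(3)[THEN Cmp_rewrite, of i] h(1) t s(3) by (simp add: Hom_def)
  qed (use x h in \<open>auto simp: Hom_def\<close>)
  have "is_lifting C i p u v x" using x xi by (simp add: is_lifting_def B_def X_def)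
  moreover have "y = x" if "is_lifting C i p u v y" for y
  proof -
    have y: "y \<in> Hom C B X" "y \<odot> i = u" "p \<odot> y = v" using that by (simp_all add: is_lifting_def B_def X_def)
    have "q \<odot> y = q \<odot> x"
    proof (rule Lorth_unique[OF i h(1) s(1)])
      show "(q \<odot> y) \<odot> i = (q \<odot> x) \<odot> i" using Cmp_assoc[OF h(1) y(1) s(3)] Cmp_assoc[OF h(1) x(1) s(3)] y(2) xi by simp
    qed (use s(3) x(1) y(1) category_axioms in \<open>auto simp: Hom_def\<close>)
    then show "y = x" using pullback_unique[OF P, of y B x] x y X_def by metis
  qed
  ultimately show "\<exists>!h. is_lifting C i p u v h" by blast
qed

end

section \<open>The functors of a torsion pair\<close>

text \<open>In the opposite category the torsion pair is \<open>(F, T)\<close>; the chosen sequences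
  serve again once their two ends are exchanged.\<close>

definition swap_seqs :: "('o, 'm) torsion_seqs \<Rightarrow> ('o, 'm) torsion_seqs" where
  "swap_seqs d = \<lparr>tor_ob = free_ob d, tor_inc = free_proj d, free_ob = tor_ob d, free_proj = tor_inc d\<rparr>"

lemma swap_swap: "swap_seqs (swap_seqs d) = d"
  by (simp add: swap_seqs_def)

lemma is_torsion_seqs_op: "is_torsion_seqs C T F d \<Longrightarrow> is_torsion_seqs (op_cat C) F T (swap_seqs d)"
  by (auto simp: is_torsion_seqs_def swap_seqs_def)

lemma FO_functors [simp]: "FO (free_functor C d) = free_ob d" "FO (tor_functor C d) = tor_ob d"
  by (simp_all add: free_functor_def tor_functor_def)

lemma free_functor_op: "free_functor (op_cat C) (swap_seqs d) = tor_functor C d"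
  by (simp add: free_functor_def tor_functor_def swap_seqs_def)

context torsion
begin

context
  fixes d assumes d: "is_torsion_seqs C T F d"
begin

lemma seqs:
  assumes "X \<in> Ob C"
  shows "tor_ob d X \<in> T" "free_ob d X \<in> F" "tor_inc d X \<in> Hom C (tor_ob d X) X"
    "free_proj d X \<in> Hom C X (free_ob d X)" "is_kernel C (free_proj d X) (tor_inc d X)"
    "is_cokernel C (tor_inc d X) (free_proj d X)" "free_proj d X \<in> Lorth C F" "tor_inc d X \<in> Rorth C T"
    "epi_arrow C (free_proj d X)" "mono_arrow C (tor_inc d X)"
proof -
  show 1: "tor_ob d X \<in> T" "free_ob d X \<in> F" "tor_inc d X \<in> Hom C (tor_ob d X) X"
    "free_proj d X \<in> Hom C X (free_ob d X)" "is_kernel C (free_proj d X) (tor_inc d X)"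
    "is_cokernel C (tor_inc d X) (free_proj d X)"
    using d assms by (auto simp: is_torsion_seqs_def short_exact_def)
  show "free_proj d X \<in> Lorth C F" "tor_inc d X \<in> Rorth C T"
    using sequence_orth[OF 1(5,6,3,4,1,2)] by auto
  show "epi_arrow C (free_proj d X)" "mono_arrow C (tor_inc d X)"
    using 1 cokernel_epi kernel_mono by auto
qed

text \<open>The functor acts on arrows by a definite description. As the projection is epi, any
  arrow fitting into the square is the one described.\<close>

lemma free_unique:
  assumes f: "f \<in> Hom C X Y" and g: "g \<in> Hom C (free_ob d X) (free_ob d Y)" "g \<odot> free_proj d X = free_proj d Y \<odot> f"
  shows "FM (free_functor C d) f = g"
proof -
  have D: "Dom C f = X" "Cod C f = Y" "X \<in> Ob C" using f by (auto simp: Hom_def)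
  have "FM (free_functor C d) f = (THE g. g \<in> Hom C (free_ob d X) (free_ob d Y) \<and> g \<odot> free_proj d X = free_proj d Y \<odot> f)"
    by (simp add: free_functor_def D)
  also have "\<dots> = g"
  proof (rule the_equality)
    fix h assume h: "h \<in> Hom C (free_ob d X) (free_ob d Y) \<and> h \<odot> free_proj d X = free_proj d Y \<odot> f"
    then show "h = g"
      using epi_cancel[OF seqs(9)[OF D(3)], of h g "free_ob d Y"] g seqs(4)[OF D(3)] by (auto simp: Hom_def)
  qed (use g in blast)
  finally show ?thesis .
qed

lemma free_map:
  assumes f: "f \<in> Hom C X Y"
  shows "FM (free_functor C d) f \<in> Hom C (free_ob d X) (free_ob d Y)"
    "FM (free_functor C d) f \<odot> free_proj d X = free_proj d Y \<odot> f"
proof -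
  have o: "X \<in> Ob C" "Y \<in> Ob C" using f Hom_Ob by auto
  have "free_proj d Y \<odot> f \<in> Hom C X (free_ob d Y)" using f seqs[OF o(2)] by (auto simp: Hom_def)
  then obtain g where "g \<in> Hom C (free_ob d X) (free_ob d Y)" "g \<odot> free_proj d X = free_proj d Y \<odot> f"
    using LorthE[OF seqs(7,4)[OF o(1)] seqs(2)[OF o(2)]] by blast
  then show "FM (free_functor C d) f \<in> Hom C (free_ob d X) (free_ob d Y)"
    "FM (free_functor C d) f \<odot> free_proj d X = free_proj d Y \<odot> f"
    using free_unique[OF f] by auto
qed

lemma free_is_functor: "is_functor C C (free_functor C d)"
  unfolding is_functor_def FO_functors
proof (intro conjI ballI impI)
  show "free_ob d X \<in> Ob C" if "X \<in> Ob C" for X using seqs F_Ob that by blast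
  show "FM (free_functor C d) f \<in> Hom C (free_ob d (Dom C f)) (free_ob d (Cod C f))" if "f \<in> Ar C" for f
    using free_map(1) that by (simp add: Hom_def)
  show "FM (free_functor C d) (Ident C X) = Ident C (free_ob d X)" if "X \<in> Ob C" for X
    by (rule free_unique[OF Ident_Hom[OF that]]) (use seqs[OF that] F_Ob in \<open>auto simp: Hom_def\<close>)
  fix f g assume a: "f \<in> Ar C" "g \<in> Ar C" "Cod C f = Dom C g"
  then have H: "f \<in> Hom C (Dom C f) (Dom C g)" "g \<in> Hom C (Dom C g) (Cod C g)" by (auto simp: Hom_def)
  note m = free_map[OF H(1)] free_map[OF H(2)]
  show "FM (free_functor C d) (g \<odot> f) = FM (free_functor C d) g \<odot> FM (free_functor C d) f"
  proof (rule free_unique[OF Cmp_Hom[OF H]])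
    show "FM (free_functor C d) g \<odot> FM (free_functor C d) f \<in> Hom C (free_ob d (Dom C f)) (free_ob d (Cod C g))"
      using m by (auto simp: Hom_def)
    have "(FM (free_functor C d) g \<odot> FM (free_functor C d) f) \<odot> free_proj d (Dom C f)
        = FM (free_functor C d) g \<odot> (free_proj d (Dom C g) \<odot> f)"
      using m(1,2,3) seqs(4)[of "Dom C f"] a(1) by (simp add: Hom_def)
    also have "\<dots> = free_proj d (Cod C g) \<odot> (g \<odot> f)"
      using m(3) m(4)[THEN Cmp_rewrite, of f] seqs(4)[of "Dom C g"] seqs(4)[of "Cod C g"] a by (simp add: Hom_def)
    finally show "(FM (free_functor C d) g \<odot> FM (free_functor C d) f) \<odot> free_proj d (Dom C f)
        = free_proj d (Cod C g) \<odot> (g \<odot> f)" .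
  qed
qed

text \<open>The projections on both sides of the square relating \<open>f\<close> to
  \<open>r f\<close> lie in \<open>Lorth C S\<close>, so two-out-of-three passes membership across
  it. The freedom in \<open>S\<close> matters in dual form: with two pairs,
  \<open>Rorth C T2\<close> is tested on the torsion functor of the pair with the larger class
  \<open>T1\<close>.\<close>

lemma free_Lorth:
  assumes f: "f \<in> Hom C X Y" and S: "S \<subseteq> F"
  shows "FM (free_functor C d) f \<in> Lorth C S \<longleftrightarrow> f \<in> Lorth C S"
proof -
  have o: "X \<in> Ob C" "Y \<in> Ob C" using f Hom_Ob by auto
  note s = seqs[OF o(1)] seqs[OF o(2)]
  note m = free_map[OF f]
  have p: "free_proj d X \<in> Lorth C S" "free_proj d Y \<in> Lorth C S"
    by (rule subsetD[OF Lorth_anti_mono[OF S]], rule s)+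
  show ?thesis
    using Lorth_Cmp[OF s(4) m(1) p(1)] Lorth_left[OF s(4) m(1) p(1)]
      Lorth_Cmp[OF f s(14) _ p(2)] Lorth_right[OF f s(14) p(2)] m(2) by metis
qed

text \<open>Between objects of \<open>F\<close> the isomorphisms are exactly the arrows of
  \<open>Lorth C F\<close>, and \<open>free_Lorth\<close> moves this condition from
  \<open>r f\<close> to \<open>f\<close>.\<close>

lemma free_iso:
  assumes f: "f \<in> Hom C X Y"
  shows "iso_arrow C (FM (free_functor C d) f) \<longleftrightarrow> f \<in> Lorth C F"
proof -
  have "iso_arrow C (FM (free_functor C d) f) \<longleftrightarrow> FM (free_functor C d) f \<in> Lorth C F"
    using iso_Lorth Lorth_iso[OF _ free_map(1)[OF f]] seqs(2) Hom_Ob[OF f] by blast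
  then show ?thesis using free_Lorth[OF f] by simp
qed

end

lemma tor_unique:
  assumes "is_torsion_seqs C T F d" "f \<in> Hom C X Y" "g \<in> Hom C (tor_ob d X) (tor_ob d Y)"
    "tor_inc d Y \<odot> g = f \<odot> tor_inc d X"
  shows "FM (tor_functor C d) f = g"
  using torsion.free_unique[OF torsion_op is_torsion_seqs_op[OF assms(1)], of f Y X g] assms(2-)
  by (simp add: free_functor_op) (simp add: swap_seqs_def)

lemma tor_map:
  assumes "is_torsion_seqs C T F d" "f \<in> Hom C X Y"
  shows "FM (tor_functor C d) f \<in> Hom C (tor_ob d X) (tor_ob d Y)"
    "tor_inc d Y \<odot> FM (tor_functor C d) f = f \<odot> tor_inc d X"
  using torsion.free_map[OF torsion_op is_torsion_seqs_op[OF assms(1)], of f Y X] assms(2-)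
  by (simp_all add: free_functor_op) (simp_all add: swap_seqs_def)

lemma tor_is_functor:
  assumes "is_torsion_seqs C T F d"
  shows "is_functor C C (tor_functor C d)"
  using torsion.free_is_functor[OF torsion_op is_torsion_seqs_op[OF assms(1)]]
  unfolding free_functor_op is_functor_def by simp

lemma tor_Rorth:
  assumes "is_torsion_seqs C T F d" "f \<in> Hom C X Y" "S \<subseteq> T"
  shows "FM (tor_functor C d) f \<in> Rorth C S \<longleftrightarrow> f \<in> Rorth C S"
  using torsion.free_Lorth[OF torsion_op is_torsion_seqs_op[OF assms(1)], of f Y X S] assms(2-)
  by (simp add: free_functor_op)

lemma tor_iso:
  assumes "is_torsion_seqs C T F d" "f \<in> Hom C X Y"
  shows "iso_arrow C (FM (tor_functor C d) f) \<longleftrightarrow> f \<in> Rorth C T"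
  using torsion.free_iso[OF torsion_op is_torsion_seqs_op[OF assms(1)], of f Y X] assms(2-)
  by (simp add: free_functor_op)

lemma seqs_exist: "\<exists>d. is_torsion_seqs C T F d"
proof -
  have "\<forall>X. \<exists>A i B p. X \<in> Ob C \<longrightarrow> A \<in> T \<and> B \<in> F \<and> i \<in> Hom C A X \<and> p \<in> Hom C X B \<and> short_exact C i p"
    using torsion_pair unfolding torsion_pair_def by blast
  then obtain A i B p where "\<forall>X. X \<in> Ob C \<longrightarrow> A X \<in> T \<and> B X \<in> F \<and> i X \<in> Hom C (A X) X \<and> p X \<in> Hom C X (B X) \<and> short_exact C (i X) (p X)"
    by metis
  then show ?thesis
    by (intro exI[of _ "\<lparr>tor_ob = A, tor_inc = i, free_ob = B, free_proj = p\<rparr>"]) (auto simp: is_torsion_seqs_def)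
qed

end

section \<open>Torsion factorization systems\<close>

lemma two_out_of_three_op: "two_out_of_three (op_cat C) S = two_out_of_three C S"
  unfolding two_out_of_three_def op_cat_simps by (intro iffI ballI impI) metis+

lemma closed_under_retracts_op: "closed_under_retracts (op_cat C) S = closed_under_retracts C S"
  by (simp add: closed_under_retracts_def retract_of_op)

lemma retract_ofI:
  assumes "f \<in> Hom C X Y" "g \<in> Hom C V W" "a \<in> Hom C X V" "b \<in> Hom C Y W" "c \<in> Hom C V X" "d \<in> Hom C W Y"
    and "c \<odot>\<^bsub>C\<^esub> a = Ident C X" "d \<odot>\<^bsub>C\<^esub> b = Ident C Y" "g \<odot>\<^bsub>C\<^esub> a = b \<odot>\<^bsub>C\<^esub> f" "f \<odot>\<^bsub>C\<^esub> c = d \<odot>\<^bsub>C\<^esub> g"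
  shows "retract_of C f g"
proof -
  have "f \<in> Ar C" "g \<in> Ar C" "Dom C f = X" "Cod C f = Y" "Dom C g = V" "Cod C g = W"
    using assms(1,2) by (auto simp: Hom_def)
  then show ?thesis using assms(3-) unfolding retract_of_def by blast
qed

lemma lifts_uniquely_op: "lifts_uniquely (op_cat C) R L = lifts_uniquely C L R"
  unfolding lifts_uniquely_def lift_square_op is_lifting_op by blast

lemma factors_through_op: "factors_through (op_cat C) R L = factors_through C L R"
  unfolding factors_through_def by (auto; metis)

lemma zero_ob_op [simp]: "zero_ob (op_cat C) = zero_ob C"
  by (simp add: zero_ob_def)

lemma from_zero_op [simp]: "from_zero (op_cat C) X = to_zero C X"
  and to_zero_op [simp]: "to_zero (op_cat C) X = from_zero C X"
  by (simp_all add: from_zero_def to_zero_def)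

lemma (in preabelian) zero_ob: "zero_object C (zero_ob C)" "zero_ob C \<in> Ob C"
  using someI_ex[OF has_zero] by (auto simp: zero_ob_def zero_object_iff)

lemma (in preabelian) from_zero_eq: "X \<in> Ob C \<Longrightarrow> from_zero C X = z (zero_ob C) X"
  unfolding from_zero_def using z_Hom zero_ob zero_object_Hom by blast

lemma (in preabelian) to_zero_eq: "X \<in> Ob C \<Longrightarrow> to_zero C X = z X (zero_ob C)"
  unfolding to_zero_def using z_Hom zero_ob zero_object_Hom by blast

text \<open>Both pairs \<open>(CoFib, Fib \<inter> Weq)\<close> and
  \<open>(CoFib \<inter> Weq, Fib)\<close> of a torsion model structure are instances, so a torsion
  pair needs to be reconstructed only once.\<close>

locale torsion_factorization = abelian C pl z for C :: "('o, 'm) cat" (structure) and pl z +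
  fixes L R :: "'m set"
  assumes L_Ar: "L \<subseteq> Ar C" and R_Ar: "R \<subseteq> Ar C"
    and L_two_out_of_three: "two_out_of_three C L" and R_two_out_of_three: "two_out_of_three C R"
    and L_retracts: "closed_under_retracts C L" and R_retracts: "closed_under_retracts C R"
    and L_R_lifts: "lifts_uniquely C L R" and L_R_factors: "factors_through C L R"
begin

definition "TL = {X \<in> Ob C. from_zero C X \<in> L}"
definition "FR = {X \<in> Ob C. to_zero C X \<in> R}"

lemma torsion_factorization_op: "torsion_factorization (op_cat C) pl (\<lambda>X Y. z Y X) R L"
  using abelian_op L_Ar R_Ar L_two_out_of_three R_two_out_of_three L_retracts R_retracts L_R_lifts L_R_factors
  by (intro torsion_factorization.intro torsion_factorization_axioms.intro)
    (simp_all add: two_out_of_three_op closed_under_retracts_op lifts_uniquely_op factors_through_op)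

lemma TL_op: "torsion_factorization.TL (op_cat C) R = FR" and FR_op: "torsion_factorization.FR (op_cat C) L = TL"
  using torsion_factorization.TL_def[OF torsion_factorization_op] torsion_factorization.FR_def[OF torsion_factorization_op]
  by (simp_all add: TL_def FR_def)

lemma factor:
  assumes f: "f \<in> Hom C X Y"
  obtains E i p where "i \<in> Hom C X E" "p \<in> Hom C E Y" "i \<in> L" "p \<in> R" "p \<odot> i = f"
proof -
  obtain i p where ip: "i \<in> L" "p \<in> R" "Cod C i = Dom C p" "f = p \<odot> i"
    using L_R_factors f unfolding factors_through_def Hom_def by blast
  then have a: "i \<in> Ar C" "p \<in> Ar C" using L_Ar R_Ar by auto
  then have "i \<in> Hom C X (Dom C p)" "p \<in> Hom C (Dom C p) Y" using f ip(3,4) by (auto simp: Hom_def)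
  then show thesis using that ip by metis
qed

text \<open>Isomorphisms are not put into \<open>L\<close> by assumption. For a factorization
  \<open>f = p \<odot> i\<close>, the isomorphism \<open>f\<close> is a retract of \<open>i\<close>,
  by means of identities on the domains and \<open>i \<odot> g\<close>, \<open>p\<close> on the
  codomains.\<close>

lemma iso_L:
  assumes f: "iso_arrow C f"
  shows "f \<in> L"
proof -
  define X Y where "X = Dom C f" and "Y = Cod C f"
  have fH: "f \<in> Hom C X Y" using f by (auto simp: iso_arrow_def Hom_def X_def Y_def)
  obtain g where g: "g \<in> Hom C Y X" "g \<odot> f = Ident C X" "f \<odot> g = Ident C Y" using iso_arrowE[OF f fH] by metis
  obtain E i p where ip: "i \<in> Hom C X E" "p \<in> Hom C E Y" "i \<in> L" "p \<odot> i = f"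
    using factor[OF fH] by metis
  have o: "X \<in> Ob C" "Y \<in> Ob C" using fH Hom_Ob by auto
  have "retract_of C f i"
  proof (rule retract_ofI[OF fH ip(1) Ident_Hom _ Ident_Hom ip(2)])
    show "p \<odot> (i \<odot> g) = Ident C Y"
      using ip(1,2) ip(4)[THEN Cmp_rewrite, of g] g(1,3) fH by (simp add: Hom_def)
    show "i \<odot> Ident C X = (i \<odot> g) \<odot> f" using ip(1) g(1,2) fH by (simp add: Hom_def)
    show "f \<odot> Ident C X = p \<odot> i" using ip fH by (simp add: Hom_def)
  qed (use fH ip g o in \<open>auto simp: Hom_def\<close>)
  then show ?thesis using L_retracts ip unfolding closed_under_retracts_def by blast
qed

text \<open>Extending \<open>u\<close> along \<open>f\<close> is lifting \<open>f\<close> against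
  the arrow from \<open>V\<close> to zero, which lies in \<open>R\<close>; squares over a zero
  object commute automatically.\<close>

lemma L_Lorth:
  assumes f: "f \<in> L"
  shows "f \<in> Lorth C FR"
proof -
  define X Y where "X = Dom C f" and "Y = Cod C f"
  have fH: "f \<in> Hom C X Y" using f L_Ar by (auto simp: Hom_def X_def Y_def)
  have o: "X \<in> Ob C" "Y \<in> Ob C" using fH Hom_Ob by auto
  have ex: "\<exists>!v. v \<in> Hom C Y V \<and> v \<odot> f = u" if V: "V \<in> FR" and u: "u \<in> Hom C X V" for V u
  proof -
    let ?p = "z V (zero_ob C)"
    have Vo: "V \<in> Ob C" "?p \<in> R" using V to_zero_eq by (auto simp: FR_def)
    have "lift_square C f ?p u (z Y (zero_ob C))"
      using fH u Vo zero_ob o by (auto simp: lift_square_def Hom_def)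
    then have "\<exists>!h. is_lifting C f ?p u (z Y (zero_ob C)) h"
      using L_R_lifts f Vo unfolding lifts_uniquely_def by blast
    moreover have "is_lifting C f ?p u (z Y (zero_ob C)) h \<longleftrightarrow> h \<in> Hom C Y V \<and> h \<odot> f = u" for h
      using fH Vo zero_ob o by (auto simp: is_lifting_def Hom_def)
    ultimately show ?thesis by simp
  qed
  have "v = w" if "V \<in> FR" "v \<in> Hom C Y V" "w \<in> Hom C Y V" "v \<odot> f = w \<odot> f" for V v w
    using ex[OF that(1) Cmp_Hom[OF fH that(2)]] that by metis
  then show ?thesis by (intro LorthI[OF fH]) (use ex in blast)+
qed

lemma R_Rorth: "f \<in> R \<Longrightarrow> f \<in> Rorth C TL"
  using torsion_factorization.L_Lorth[OF torsion_factorization_op, of f] by (simp add: FR_op)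

text \<open>The arrow from zero to \<open>X\<close> is in \<open>L\<close>, and any two arrows from
  \<open>X\<close> to \<open>Y\<close> agree after it.\<close>

lemma TL_FR_zero:
  assumes "X \<in> TL" "Y \<in> FR" "g \<in> Hom C X Y"
  shows "g = z X Y"
proof -
  let ?Z = "zero_ob C"
  have X: "X \<in> Ob C" "z ?Z X \<in> L" "Y \<in> Ob C" using assms from_zero_eq by (auto simp: TL_def FR_def)
  show ?thesis
    by (rule Lorth_unique[OF L_Lorth[OF X(2)] _ assms(2,3)])
      (use X zero_ob assms(3) category_axioms in \<open>auto simp: Hom_def\<close>)
qed

text \<open>Factor the arrow from \<open>X\<close> to zero as \<open>l\<close> followed by
  \<open>r\<close>. The middle object \<open>Y\<close> lies in \<open>FR\<close>, so
  \<open>l\<close> is zero, and uniqueness of extensions along \<open>l\<close> makes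
  \<open>Y\<close> a zero object. Thus \<open>l\<close> and its composite with the arrow from zero
  to \<open>X\<close> are in \<open>L\<close>, hence so is that arrow. This last cancellation is the
  direction of two-out-of-three that the left class of a general orthogonal factorization system may
  lack.\<close>

lemma TL_I:
  assumes X: "X \<in> Ob C" and 0: "\<And>Y f. Y \<in> FR \<Longrightarrow> f \<in> Hom C X Y \<Longrightarrow> f = z X Y"
  shows "X \<in> TL"
proof -
  let ?Z = "zero_ob C"
  note Z = zero_ob(2)
  obtain Y l r where lr: "l \<in> Hom C X Y" "r \<in> Hom C Y ?Z" "l \<in> L" "r \<in> R"
    using factor[OF z_Hom[OF X Z]] by metis
  have Y: "Y \<in> Ob C" using lr Hom_Ob by blast
  have "r = z Y ?Z" using zero_object_Hom zero_ob lr by blast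
  then have YF: "Y \<in> FR" using Y lr to_zero_eq by (auto simp: FR_def)
  then have l: "l = z X Y" using 0 lr by blast
  have "Ident C Y = z Y Y"
    by (rule Lorth_unique[OF L_Lorth[OF lr(3)] lr(1) YF])
      (use l X Y category_axioms in \<open>auto simp: Hom_def\<close>)
  then have "iso_arrow C (z ?Z Y)"
    using Y Z zero_ob(1)[unfolded zero_object_iff]
    by (intro iso_arrowI[of _ ?Z Y "z Y ?Z"]) (auto simp: Hom_def)
  then have "l \<odot> z ?Z X \<in> L" using iso_L X Y Z l by simp
  then have "z ?Z X \<in> L"
    using two_out_of_three_right[OF L_two_out_of_three z_Hom[OF Z X] lr(1) lr(3)] by blast
  then show ?thesis using X from_zero_eq by (simp add: TL_def)
qed

lemma FR_I: "X \<in> Ob C \<Longrightarrow> (\<And>Y f. Y \<in> TL \<Longrightarrow> f \<in> Hom C Y X \<Longrightarrow> f = z Y X) \<Longrightarrow> X \<in> FR"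
  using torsion_factorization.TL_I[OF torsion_factorization_op, of X] by (simp add: FR_op TL_op)

lemma TL_isomorphic:
  assumes "X \<in> TL" "Y \<in> Ob C" "isomorphic C X Y"
  shows "Y \<in> TL"
proof (rule TL_I[OF assms(2)])
  fix V g assume g: "V \<in> FR" "g \<in> Hom C Y V"
  obtain f where f: "f \<in> Hom C X Y" "iso_arrow C f" using assms(3) by (auto simp: isomorphic_def)
  obtain f' where f': "f' \<in> Hom C Y X" "f \<odot> f' = Ident C Y" using iso_arrowE[OF f(2,1)] by metis
  have gf: "g \<odot> f \<in> Hom C X V" using f g by (auto simp: Hom_def)
  have "(g \<odot> f) \<odot> f' = z Y V"
    unfolding TL_FR_zero[OF assms(1) g(1) gf] using f' g Hom_Ob(2)[OF g(2)] by (simp add: Hom_def)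
  then show "g = z Y V" using f f' g by (simp add: Hom_def)
qed

lemma FR_isomorphic: "X \<in> FR \<Longrightarrow> Y \<in> Ob C \<Longrightarrow> isomorphic C X Y \<Longrightarrow> Y \<in> FR"
  using torsion_factorization.TL_isomorphic[OF torsion_factorization_op, of X Y] isomorphic_sym by (simp add: TL_op)

text \<open>The cokernel \<open>Q\<close> of \<open>A \<rightarrow> X\<close> lies in \<open>FR\<close>: a map \<open>V \<rightarrow> Q\<close> from \<open>TL\<close> pulls back along
  \<open>X \<rightarrow> Q\<close> to an extension of objects of \<open>TL\<close>, whose map to \<open>X\<close> factors through \<open>A\<close>.\<close>

lemma TL_FR_sequence:
  assumes X: "X \<in> Ob C"
  shows "\<exists>A \<in> TL. \<exists>B \<in> FR. \<exists>i \<in> Hom C A X. \<exists>p \<in> Hom C X B. short_exact C i p"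
proof -
  let ?Z = "zero_ob C"
  note Z = zero_ob(2)
  obtain A l r where lr: "l \<in> Hom C ?Z A" "r \<in> Hom C A X" "l \<in> L" "r \<in> R"
    using factor[OF z_Hom[OF Z X]] by metis
  have Ao: "A \<in> Ob C" using lr Hom_Ob by blast
  have "l = z ?Z A" using zero_object_Hom zero_ob lr by blast
  then have A: "A \<in> TL" using Ao lr from_zero_eq by (auto simp: TL_def)
  obtain c where c: "is_cokernel C r c" using has_cokernel[of r] lr by (auto simp: Hom_def)
  define Q where "Q = Cod C c"
  have cH: "c \<in> Hom C X Q" "c \<odot> r = z A Q" using cokernel_Hom[OF c lr(2)] by (auto simp: Q_def)
  \<comment> \<open>The arrow \<open>r\<close> from \<open>A\<close> to \<open>X\<close> is not
    known to be mono, so the sequence is built with its image \<open>I\<close>, which is again in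
    \<open>TL\<close> as a quotient of \<open>A\<close>.\<close>
  obtain m where m: "is_kernel C c m" using has_kernel[of c] cH by (auto simp: Hom_def)
  define I where "I = Dom C m"
  have mH: "m \<in> Hom C I X" using kernel_Hom[OF m cH(1)] by (auto simp: I_def)
  have o: "I \<in> Ob C" "Q \<in> Ob C" using mH cH Hom_Ob by auto
  obtain e where e: "e \<in> Hom C A I" "m \<odot> e = r" using kernel_lift[OF m cH(1) lr(2) cH(2)] I_def by metis
  have epi: "epi_arrow C e" using image_epi[OF lr(2) c m] e I_def by blast
  have I: "I \<in> TL"
  proof (rule TL_I[OF o(1)])
    fix Y g assume g: "Y \<in> FR" "g \<in> Hom C I Y"
    then have "g \<odot> e \<in> Hom C A Y" using e by (auto simp: Hom_def)
    then show "g = z I Y" using TL_FR_zero[OF A g(1)] epi_Hom[OF epi e(1) g(2)] by blast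
  qed
  have Q: "Q \<in> FR"
  proof (rule FR_I[OF o(2)])
    fix V y assume V: "V \<in> TL" "y \<in> Hom C V Q"
    obtain E p q where E: "p \<in> Hom C E X" "q \<in> Hom C E V" "is_pullback C c y p q"
      using pullback_exists[OF cH(1) V(2)] .
    have q: "epi_arrow C q" by (rule pullback_epi[OF E(3) cokernel_epi[OF c]])
    obtain k where k: "k \<in> Hom C I E" "is_kernel C q k"
      using pullback_kernel[OF E(3) m] E(1) by (auto simp: I_def Hom_def)
    have "E \<in> TL"
    proof (rule TL_I)
      show "E \<in> Ob C" using E Hom_Ob by blast
      fix Y g assume g: "Y \<in> FR" "g \<in> Hom C E Y"
      then have "g \<odot> k \<in> Hom C I Y" using k by (auto simp: Hom_def)
      then have "g \<odot> k = z I Y" using TL_FR_zero[OF I g(1)] by blast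
      then obtain h where h: "h \<in> Hom C V Y" "h \<odot> q = g"
        using cokernel_lift[OF epi_cokernel_of_kernel[OF q k(2)] k(1) g(2)] E(2) by (auto simp: Hom_def)
      then have "h = z V Y" using TL_FR_zero V g by blast
      then show "g = z E Y" using h E(2) Hom_Ob(2)[OF g(2)] by (auto simp: Hom_def)
    qed
    \<comment> \<open>As \<open>r\<close> is orthogonal to \<open>TL\<close>, the arrow from the
      extension \<open>E\<close> to \<open>X\<close> lifts to \<open>A\<close>, so its composite
      with \<open>c\<close> vanishes; \<open>q\<close> is epi and therefore \<open>y\<close>
      vanishes.\<close>
    then obtain s where s: "s \<in> Hom C E A" "r \<odot> s = p" using RorthE[OF R_Rorth[OF lr(4)] lr(2) _ E(1)] by blast
    have "y \<odot> q = c \<odot> p" using E(3) by (simp add: is_pullback_def)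
    also have "\<dots> = (c \<odot> r) \<odot> s" using s cH(1) lr(2) by (auto simp: Hom_def)
    also have "\<dots> = z E Q" unfolding cH(2) using s o by (simp add: Hom_def)
    finally show "y = z V Q" using epi_Hom[OF q E(2) V(2)] by blast
  qed
  have "short_exact C m c" using m epi_cokernel_of_kernel[OF cokernel_epi[OF c] m] by (simp add: short_exact_def)
  then show ?thesis using I Q mH cH by blast
qed

lemma torsion_pair_TL_FR: "torsion_pair C TL FR"
  unfolding torsion_pair_def
  using TL_isomorphic FR_isomorphic TL_FR_zero zero_arrow_Hom TL_FR_sequence
  by (auto simp: TL_def FR_def)

text \<open>If \<open>f\<close> is in \<open>Lorth C FR\<close>, so is its right factor
  \<open>p\<close> by two-out-of-three. Then \<open>p\<close> lies in both orthogonality classes of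
  the torsion pair just found, is an isomorphism, and belongs to \<open>L\<close>.\<close>

lemma L_eq: "L = Lorth C FR"
proof
  show "L \<subseteq> Lorth C FR" using L_Lorth by blast
  interpret T: torsion C pl z TL FR
    using torsion_pair_TL_FR abelian_axioms by (intro torsion.intro torsion_axioms.intro)
  show "Lorth C FR \<subseteq> L"
  proof
    fix f assume f: "f \<in> Lorth C FR"
    then have fH: "f \<in> Hom C (Dom C f) (Cod C f)" using Lorth_Ar by (simp add: Hom_def)
    obtain E i p where ip: "i \<in> Hom C (Dom C f) E" "p \<in> Hom C E (Cod C f)" "i \<in> L" "p \<in> R" "p \<odot> i = f"
      using factor[OF fH] .
    have "p \<in> Lorth C FR" using Lorth_left[OF ip(1,2) L_Lorth[OF ip(3)]] ip(5) f by simp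
    then have "p \<in> L" using T.orth_iso R_Rorth[OF ip(4)] iso_L by blast
    then show "f \<in> L" using two_out_of_three_Cmp[OF L_two_out_of_three ip(1,2,3)] ip(5) by simp
  qed
qed

lemma R_eq: "R = Rorth C TL"
  using torsion_factorization.L_eq[OF torsion_factorization_op] by (simp add: FR_op)

end

section \<open>Twin torsion pairs and torsion model structures\<close>

locale twin = abelian C pl z for C :: "('o, 'm) cat" (structure) and pl z +
  fixes T1 F1 T2 F2 :: "'o set"
  assumes pair1: "torsion_pair C T1 F1" and pair2: "torsion_pair C T2 F2" and T2_T1: "T2 \<subseteq> T1"

sublocale twin \<subseteq> P1: torsion C pl z T1 F1
  using pair1 by unfold_locales

sublocale twin \<subseteq> P2: torsion C pl z T2 F2
  using pair2 by unfold_locales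

text \<open>The composites of a trivial cofibration and a trivial fibration; unlike the description of \<open>Weq\<close>
  by \<open>H\<close>, this needs no choice of exact sequences.\<close>

definition twin_weq :: "('o, 'm) cat \<Rightarrow> 'o set \<Rightarrow> 'o set \<Rightarrow> 'm set" where
  "twin_weq C T1 F2 = {p \<odot>\<^bsub>C\<^esub> i | i p. i \<in> Lorth C F2 \<and> p \<in> Rorth C T1 \<and> Cod C i = Dom C p}"

lemma twin_weq_op: "twin_weq (op_cat C) F2 T1 = twin_weq C T1 F2"
  unfolding twin_weq_def by (auto; metis)

section \<open>Classes of arrows inverted by a functor, and full subcategories\<close>

lemma functor_Ob: "is_functor C D F \<Longrightarrow> X \<in> Ob C \<Longrightarrow> FO F X \<in> Ob D"
  and functor_Hom: "is_functor C D F \<Longrightarrow> f \<in> Hom C X Y \<Longrightarrow> FM F f \<in> Hom D (FO F X) (FO F Y)"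
  and functor_Ident: "is_functor C D F \<Longrightarrow> X \<in> Ob C \<Longrightarrow> FM F (Ident C X) = Ident D (FO F X)"
  and functor_Cmp: "is_functor C D F \<Longrightarrow> f \<in> Hom C X Y \<Longrightarrow> g \<in> Hom C Y Z \<Longrightarrow>
    FM F (g \<odot>\<^bsub>C\<^esub> f) = FM F g \<odot>\<^bsub>D\<^esub> FM F f"
  unfolding is_functor_def Hom_def mem_Collect_eq by metis+

lemma is_functor_comp:
  assumes "is_functor C D F" "is_functor D E G"
  shows "is_functor C E (comp_functor G F)"
  using assms unfolding is_functor_def by (auto simp: comp_functor_def Hom_def)

lemma (in category) functor_iso:
  assumes F: "is_functor C D F" and D: "category D" and f: "iso_arrow C f"
  shows "iso_arrow D (FM F f)"
proof -
  define X Y where "X = Dom C f" and "Y = Cod C f"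
  have fH: "f \<in> Hom C X Y" using f by (auto simp: iso_arrow_def Hom_def X_def Y_def)
  obtain g where g: "g \<in> Hom C Y X" "g \<odot> f = Ident C X" "f \<odot> g = Ident C Y" using iso_arrowE[OF f fH] by metis
  show ?thesis
    by (rule category.iso_arrowI[OF D functor_Hom[OF F fH] functor_Hom[OF F g(1)]])
      (use functor_Cmp[OF F fH g(1)] functor_Cmp[OF F g(1) fH] functor_Ident[OF F] g Hom_Ob[OF fH] in simp_all)
qed

lemma functor_retract:
  assumes F: "is_functor C D F" and C: "category C" and "retract_of C f g"
  shows "retract_of D (FM F f) (FM F g)"
proof -
  interpret category C by fact
  obtain a b c d where a: "a \<in> Hom C (Dom C f) (Dom C g)" "b \<in> Hom C (Cod C f) (Cod C g)"
    "c \<in> Hom C (Dom C g) (Dom C f)" "d \<in> Hom C (Cod C g) (Cod C f)"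
    and e: "c \<odot>\<^bsub>C\<^esub> a = Ident C (Dom C f)" "d \<odot>\<^bsub>C\<^esub> b = Ident C (Cod C f)"
      "g \<odot>\<^bsub>C\<^esub> a = b \<odot>\<^bsub>C\<^esub> f" "f \<odot>\<^bsub>C\<^esub> c = d \<odot>\<^bsub>C\<^esub> g" and f: "f \<in> Ar C" "g \<in> Ar C"
    using assms(3) by (auto simp: retract_of_def)
  have fH: "f \<in> Hom C (Dom C f) (Cod C f)" "g \<in> Hom C (Dom C g) (Cod C g)" using f by (auto simp: Hom_def)
  note h = functor_Hom[OF F]
  show ?thesis
    by (rule retract_ofI[OF h[OF fH(1)] h[OF fH(2)] h[OF a(1)] h[OF a(2)] h[OF a(3)] h[OF a(4)]])
      (use functor_Cmp[OF F a(1,3)] functor_Cmp[OF F a(2,4)] functor_Cmp[OF F a(1) fH(2)] functor_Cmp[OF F fH(1) a(2)]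
        functor_Cmp[OF F a(3) fH(1)] functor_Cmp[OF F fH(2) a(4)] functor_Ident[OF F] e f in simp_all)
qed

lemma functor_inverts_two_out_of_three:
  assumes F: "is_functor C D F" and C: "category C" and D: "category D"
  shows "two_out_of_three C {f \<in> Ar C. iso_arrow D (FM F f)}"
  unfolding two_out_of_three_def
proof (intro ballI impI)
  interpret D: category D by fact
  fix f g assume f: "f \<in> Ar C" "g \<in> Ar C" "Cod C f = Dom C g"
  then have H: "f \<in> Hom C (Dom C f) (Dom C g)" "g \<in> Hom C (Dom C g) (Cod C g)" by (auto simp: Hom_def)
  note h = functor_Hom[OF F H(1)] functor_Hom[OF F H(2)] functor_Cmp[OF F H]
  have a: "FM F f \<in> Ar D" "FM F g \<in> Ar D" "Cod D (FM F f) = Dom D (FM F g)" using h by (auto simp: Hom_def)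
  let ?S = "{f \<in> Ar C. iso_arrow D (FM F f)}"
  show "(f \<in> ?S \<and> g \<in> ?S \<longrightarrow> g \<odot>\<^bsub>C\<^esub> f \<in> ?S) \<and> (f \<in> ?S \<and> g \<odot>\<^bsub>C\<^esub> f \<in> ?S \<longrightarrow> g \<in> ?S) \<and>
    (g \<in> ?S \<and> g \<odot>\<^bsub>C\<^esub> f \<in> ?S \<longrightarrow> f \<in> ?S)"
    using D.iso_Cmp[of "FM F f" "FM F g"] D.iso_two_out_of_three[OF a] a f h(3)
      category.Cmp_Ar[OF C f] by auto
qed

lemma functor_inverts_retracts:
  assumes "is_functor C D F" "category C" "category D"
  shows "closed_under_retracts C {f \<in> Ar C. iso_arrow D (FM F f)}"
  using functor_retract[OF assms(1,2)] category.iso_retract[OF assms(3)]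
  unfolding closed_under_retracts_def retract_of_def[of C] by blast

lemma full_subcat_simps [simp]:
  "Ob (full_subcat C S) = Ob C \<inter> S" "Dom (full_subcat C S) = Dom C" "Cod (full_subcat C S) = Cod C"
  "Ident (full_subcat C S) = Ident C" "g \<odot>\<^bsub>full_subcat C S\<^esub> f = g \<odot>\<^bsub>C\<^esub> f"
  "f \<in> Ar (full_subcat C S) \<longleftrightarrow> f \<in> Ar C \<and> Dom C f \<in> S \<and> Cod C f \<in> S"
  by (auto simp: full_subcat_def)

lemma Hom_full_subcat [simp]: "f \<in> Hom (full_subcat C S) X Y \<longleftrightarrow> f \<in> Hom C X Y \<and> X \<in> S \<and> Y \<in> S"
  by (auto simp: Hom_def)

lemma (in category) category_full_subcat: "category (full_subcat C S)"
  by unfold_locales (auto simp: Hom_def)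

lemma iso_full_subcat: "iso_arrow (full_subcat C S) f \<longleftrightarrow> iso_arrow C f \<and> Dom C f \<in> S \<and> Cod C f \<in> S"
  unfolding iso_arrow_def by auto

lemma nat_isomorphic_inverts:
  assumes "nat_isomorphic C D H G" "category D" "f \<in> Ar C" "category C"
  shows "iso_arrow D (FM H f) \<longleftrightarrow> iso_arrow D (FM G f)"
proof -
  interpret C: category C by fact
  interpret D: category D by fact
  define X Y where "X = Dom C f" and "Y = Cod C f"
  have f: "f \<in> Hom C X Y" "X \<in> Ob C" "Y \<in> Ob C" using assms(3) by (auto simp: X_def Y_def Hom_def)
  obtain a where H: "is_functor C D H" "is_functor C D G"
    and a: "\<And>X. X \<in> Ob C \<Longrightarrow> a X \<in> Hom D (FO H X) (FO G X) \<and> iso_arrow D (a X)"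
    and e: "a Y \<odot>\<^bsub>D\<^esub> FM H f = FM G f \<odot>\<^bsub>D\<^esub> a X"
    using assms(1,3) unfolding nat_isomorphic_def X_def Y_def by blast
  note h = functor_Hom[OF H(1) f(1)] functor_Hom[OF H(2) f(1)] a[OF f(2)] a[OF f(3)]
  have 1: "FM H f \<in> Ar D" "a Y \<in> Ar D" "Cod D (FM H f) = Dom D (a Y)"
    and 2: "a X \<in> Ar D" "FM G f \<in> Ar D" "Cod D (a X) = Dom D (FM G f)"
    using h by (auto simp: Hom_def)
  show ?thesis
    using D.iso_Cmp[OF _ _ 1(3)] D.iso_Cmp[OF _ _ 2(3)] D.iso_two_out_of_three[OF 1] D.iso_two_out_of_three[OF 2] h e
    by metis
qed

section \<open>Weak equivalences of a twin torsion pair\<close>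

context twin
begin

lemma F1_F2: "F1 \<subseteq> F2"
proof
  fix Y assume Y: "Y \<in> F1"
  show "Y \<in> F2" by (rule P2.F_I) (use Y P1.F_Ob P1.Hom_T_F T2_T1 in blast)+
qed

lemma twin_op: "twin (op_cat C) pl (\<lambda>X Y. z Y X) F2 T2 F1 T1"
  using abelian_op torsion_pair_op[OF category_axioms pair1] torsion_pair_op[OF category_axioms pair2] F1_F2
  by (intro twin.intro twin_axioms.intro)

lemma Rorth_T1_T2: "f \<in> Rorth C T1 \<Longrightarrow> f \<in> Rorth C T2"
  using Rorth_anti_mono[OF T2_T1, of C] by blast

context
  fixes d1 d2 assumes d1: "is_torsion_seqs C T1 F1 d1" and d2: "is_torsion_seqs C T2 F2 d2"
begin

text \<open>The pullback of \<open>X \<rightarrow> r\<^sub>2 X\<close> along \<open>t\<^sub>1 r\<^sub>2 X \<rightarrow> r\<^sub>2 X\<close> is an extension of objects of \<open>T1\<close>,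
  hence equal to \<open>t\<^sub>1 X\<close>.\<close>

lemma tor_proj_Lorth:
  assumes X: "X \<in> Ob C"
  shows "FM (tor_functor C d1) (free_proj d2 X) \<in> Lorth C F2"
proof -
  define R where "R = free_ob d2 X"
  note s = P2.seqs[OF d2 X, folded R_def]
  have R: "R \<in> Ob C" using s P2.F_Ob by blast
  note u = P1.seqs[OF d1 X] and v = P1.seqs[OF d1 R]
  let ?t = "FM (tor_functor C d1) (free_proj d2 X)"
  note t = P1.tor_map[OF d1 s(4)]
  obtain P a b where P: "a \<in> Hom C P X" "b \<in> Hom C P (tor_ob d1 R)" "is_pullback C (free_proj d2 X) (tor_inc d1 R) a b"
    using pullback_exists[OF s(4) v(3)] .
  obtain k where k: "k \<in> Hom C (tor_ob d2 X) P" "is_kernel C b k"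
  proof (rule pullback_kernel[OF P(3) s(5)])
    fix k assume "k \<in> Hom C (Dom C (tor_inc d2 X)) (Dom C a)" "is_kernel C b k"
    moreover have "Dom C (tor_inc d2 X) = tor_ob d2 X" "Dom C a = P" using s(3) P(1) by (simp_all add: Hom_def)
    ultimately have "k \<in> Hom C (tor_ob d2 X) P" by metis
    then show thesis using that[of k] \<open>is_kernel C b k\<close> by blast
  qed
  then have Dk: "Dom C k \<in> T2" using s(1) by (simp add: Hom_def)
  have b: "epi_arrow C b" by (rule pullback_epi[OF P(3) s(9)])
  have bL: "b \<in> Lorth C F2" by (rule P2.epi_Lorth[OF b k(2) Dk])
  have PT: "P \<in> T1" using P1.T_extension[OF b P(2) k(2)] Dk T2_T1 v(1) by blast
  have a: "a \<in> Rorth C T1" by (rule Rorth_pullback[OF pullback_sym[OF P(3)] v(8)])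
  obtain w where w: "w \<in> Hom C (tor_ob d1 X) P" "a \<odot> w = tor_inc d1 X" using RorthE[OF a P(1) u(1,3)] .
  \<comment> \<open>\<open>a\<close> and the inclusion of the torsion part of \<open>X\<close> are
    both in \<open>Rorth C T1\<close>, hence so is \<open>w\<close>. Its ends lie in
    \<open>T1\<close>, so it is an isomorphism, and \<open>b \<odot> w\<close> is in
    \<open>Lorth C F2\<close> together with \<open>b\<close>.\<close>
  have "w \<in> Rorth C T1" using Rorth_right[OF w(1) P(1) a] w(2) u(8) by simp
  then have "w \<in> Lorth C F2" using iso_Lorth Rorth_iso[OF _ w(1) u(1) PT] by blast
  then have bw: "b \<odot> w \<in> Lorth C F2" using Lorth_Cmp[OF w(1) P(2)] bL by blast
  have c: "free_proj d2 X \<odot> a = tor_inc d1 R \<odot> b" using P(3) by (simp add: is_pullback_def)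
  have "tor_inc d1 R \<odot> (b \<odot> w) = (tor_inc d1 R \<odot> b) \<odot> w" using v(3) P(2) w(1) by (simp add: Hom_def)
  also have "\<dots> = free_proj d2 X \<odot> tor_inc d1 X" unfolding c[symmetric] using s(4) P(1) w by (simp add: Hom_def)
  finally have "tor_inc d1 R \<odot> (b \<odot> w) = tor_inc d1 R \<odot> ?t" using t(2) by metis
  moreover have "Dom C (tor_inc d1 R) = tor_ob d1 R" using v(3) by (simp add: Hom_def)
  ultimately have "b \<odot> w = ?t"
    using mono_cancel[OF v(10)] Cmp_Hom[OF w(1) P(2)] t(1) by metis
  then show ?thesis using bw by simp
qed

text \<open>The second torsion-free functor inverts \<open>f\<close>. Applying the first torsion
  functor to the square joining \<open>f\<close> to its torsion-free part leaves three sides known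
  to be in \<open>Lorth C F2\<close>, so two-out-of-three gives the fourth.\<close>

lemma tor_Lorth:
  assumes f: "f \<in> Hom C X Y" "f \<in> Lorth C F2"
  shows "FM (tor_functor C d1) f \<in> Lorth C F2"
proof -
  have o: "X \<in> Ob C" "Y \<in> Ob C" using f Hom_Ob by auto
  let ?t = "FM (tor_functor C d1)" and ?r = "FM (free_functor C d2)"
  note F = P1.tor_is_functor[OF d1]
  note p = P2.seqs(4)[OF d2 o(1)] P2.seqs(4)[OF d2 o(2)]
  note r = P2.free_map[OF d2 f(1)]
  have "iso_arrow C (?r f)" using P2.free_iso[OF d2 f(1)] f(2) by blast
  then have "?t (?r f) \<in> Lorth C F2" using functor_iso[OF F category_axioms] iso_Lorth by blast
  then have "?t (?r f) \<odot> ?t (free_proj d2 X) \<in> Lorth C F2"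
    using Lorth_Cmp[OF functor_Hom[OF F p(1)] functor_Hom[OF F r(1)]] tor_proj_Lorth[OF o(1)] by blast
  then have "?t (free_proj d2 Y) \<odot> ?t f \<in> Lorth C F2"
    using functor_Cmp[OF F p(1) r(1)] functor_Cmp[OF F f(1) p(2)] r(2) by simp
  then show ?thesis
    using Lorth_right[OF functor_Hom[OF F f(1)] functor_Hom[OF F p(2)]] tor_proj_Lorth[OF o(2)] by blast
qed

lemma Fib_Weq:
  assumes f: "f \<in> Hom C X Y" "f \<in> Rorth C T2" "FM (tor_functor C d1) f \<in> Lorth C F2"
  shows "f \<in> Rorth C T1"
  using P1.tor_Rorth[OF d1 f(1) T2_T1] P2.orth_iso[OF f(3)] P1.tor_iso[OF d1 f(1)] f(2) by blast

lemma free_tor_iso: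
  assumes f: "f \<in> Hom C X Y"
  shows "iso_arrow C (FM (comp_functor (free_functor C d2) (tor_functor C d1)) f) \<longleftrightarrow>
    FM (tor_functor C d1) f \<in> Lorth C F2"
  using P2.free_iso[OF d2 P1.tor_map(1)[OF d1 f]] by (simp add: comp_functor_def)

lemma free_tor_functor: "is_functor C C (comp_functor (free_functor C d2) (tor_functor C d1))"
  by (rule is_functor_comp[OF P1.tor_is_functor[OF d1] P2.free_is_functor[OF d2]])

text \<open>Makes two-out-of-three and closure under retracts available. For the inclusion from
  right to left, \<open>f\<close> is factored by the second pair. The left factor is inverted, hence
  so is the right one, and a fibration that is inverted is in \<open>Rorth C T1\<close> by
  \<open>Fib_Weq\<close>.\<close>

lemma twin_weq_free_tor:
  "twin_weq C T1 F2 = {f \<in> Ar C. iso_arrow C (FM (comp_functor (free_functor C d2) (tor_functor C d1)) f)}"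
    (is "_ = ?W")
proof -
  have W: "f \<in> ?W \<longleftrightarrow> f \<in> Ar C \<and> FM (tor_functor C d1) f \<in> Lorth C F2" for f
    using free_tor_iso[of f "Dom C f" "Cod C f"] by (auto simp: Hom_def)
  note W3 = functor_inverts_two_out_of_three[OF free_tor_functor category_axioms category_axioms]
  show ?thesis
  proof (intro equalityI subsetI)
    fix f assume "f \<in> twin_weq C T1 F2"
    then obtain i p where f: "f = p \<odot> i" "i \<in> Lorth C F2" "p \<in> Rorth C T1" "Cod C i = Dom C p"
      by (auto simp: twin_weq_def)
    have h: "i \<in> Hom C (Dom C i) (Dom C p)" "p \<in> Hom C (Dom C p) (Cod C p)"
      using Lorth_Ar[OF f(2)] Rorth_Ar[OF f(3)] f(4) by (auto simp: Hom_def)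
    have "i \<in> ?W" using tor_Lorth[OF h(1) f(2)] h W by (auto simp: Hom_def)
    moreover have "p \<in> ?W" using P1.tor_iso[OF d1 h(2)] f(3) iso_Lorth h W by (auto simp: Hom_def)
    ultimately show "f \<in> ?W" using two_out_of_three_Cmp[OF W3 h] f(1) by blast
  next
    fix f assume f: "f \<in> ?W"
    then have fH: "f \<in> Hom C (Dom C f) (Cod C f)" by (auto simp: Hom_def)
    obtain i p where ip: "i \<in> Lorth C F2" "p \<in> Rorth C T2" "Cod C i = Dom C p" "f = p \<odot> i"
      using P2.Lorth_Rorth_factors f unfolding factors_through_def by blast
    have h: "i \<in> Hom C (Dom C i) (Dom C p)" "p \<in> Hom C (Dom C p) (Cod C p)"
      using Lorth_Ar[OF ip(1)] Rorth_Ar[OF ip(2)] ip(3) by (auto simp: Hom_def)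
    have "i \<in> ?W" using tor_Lorth[OF h(1) ip(1)] h W by (auto simp: Hom_def)
    then have "p \<in> ?W" using two_out_of_three_left[OF W3 h] f ip(4) by blast
    then have "p \<in> Rorth C T1" using Fib_Weq[OF h(2) ip(2)] W by blast
    then show "f \<in> twin_weq C T1 F2" using ip unfolding twin_weq_def by blast
  qed
qed

end

text \<open>Exact sequences are chosen only within the argument; neither side depends on
  them.\<close>

lemma Fib_Weq_eq: "Rorth C T2 \<inter> twin_weq C T1 F2 = Rorth C T1"
proof -
  obtain d1 d2 where d: "is_torsion_seqs C T1 F1 d1" "is_torsion_seqs C T2 F2 d2"
    using P1.seqs_exist P2.seqs_exist by blast
  show ?thesis
  proof (intro equalityI subsetI)
    fix f assume f: "f \<in> Rorth C T2 \<inter> twin_weq C T1 F2"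
    then have fH: "f \<in> Hom C (Dom C f) (Cod C f)" using Rorth_Ar by (auto simp: Hom_def)
    show "f \<in> Rorth C T1"
      using Fib_Weq[OF d fH] free_tor_iso[OF d fH] f unfolding twin_weq_free_tor[OF d] by blast
  next
    fix f assume f: "f \<in> Rorth C T1"
    then have fH: "f \<in> Hom C (Dom C f) (Cod C f)" using Rorth_Ar by (auto simp: Hom_def)
    have "FM (tor_functor C d1) f \<in> Lorth C F2" using P1.tor_iso[OF d(1) fH] f iso_Lorth by blast
    then show "f \<in> Rorth C T2 \<inter> twin_weq C T1 F2"
      using free_tor_iso[OF d fH] Rorth_T1_T2[OF f] Rorth_Ar[OF f] unfolding twin_weq_free_tor[OF d] by blast
  qed
qed

lemma CoFib_Weq_eq: "Lorth C F1 \<inter> twin_weq C T1 F2 = Lorth C F2"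
  using twin.Fib_Weq_eq[OF twin_op] by (simp add: twin_weq_op)

text \<open>The opposite of the composite \<open>r_2 t_1\<close> for the dual twin pair is
  \<open>t_1 r_2\<close>, while \<open>twin_weq\<close> is self-dual. Hence the two composites
  invert the same arrows even before they are compared by a natural isomorphism.\<close>

lemma twin_weq_tor_free:
  assumes "is_torsion_seqs C T1 F1 d1" "is_torsion_seqs C T2 F2 d2"
  shows "twin_weq C T1 F2 = {f \<in> Ar C. iso_arrow C (FM (comp_functor (tor_functor C d1) (free_functor C d2)) f)}"
proof -
  have "tor_functor (op_cat C) (swap_seqs d2) = free_functor C d2"
    using free_functor_op[of "op_cat C" "swap_seqs d2"] by (simp add: swap_swap)
  then show ?thesis
    using twin.twin_weq_free_tor[OF twin_op is_torsion_seqs_op[OF assms(2)] is_torsion_seqs_op[OF assms(1)]]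
    by (simp add: twin_weq_op free_functor_op comp_functor_def)
qed

text \<open>Counterpart of \<open>Phi\<close> free of choices. The arrows inverted by
  \<open>r_1\<close>, \<open>t_2\<close> and \<open>t_1 r_2\<close> depend on the pairs alone, which
  is why \<open>Phi\<close> may pick its sequences by \<open>SOME\<close>.\<close>

definition model where "model = (Lorth C F1, Rorth C T2, twin_weq C T1 F2)"

lemma torsion_model: "torsion_model_structure C model"
proof -
  obtain d1 d2 where d: "is_torsion_seqs C T1 F1 d1" "is_torsion_seqs C T2 F2 d2"
    using P1.seqs_exist P2.seqs_exist by blast
  note W = twin_weq_free_tor[OF d] and Ft = free_tor_functor[OF d]
  have lift: "lifts C L R" if "lifts_uniquely C L R" for L R
    using that unfolding lifts_def lifts_uniquely_def by blast
  have "two_out_of_three C (twin_weq C T1 F2)"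
    unfolding W by (rule functor_inverts_two_out_of_three[OF Ft category_axioms category_axioms])
  moreover have "closed_under_retracts C (twin_weq C T1 F2)"
    unfolding W by (rule functor_inverts_retracts[OF Ft category_axioms category_axioms])
  moreover have "twin_weq C T1 F2 \<subseteq> Ar C" unfolding W by blast
  moreover have "Lorth C F1 \<subseteq> Ar C" "Rorth C T2 \<subseteq> Ar C" using Lorth_Ar[of _ C] Rorth_Ar[of _ C] by blast+
  ultimately show ?thesis
    unfolding model_def
    using Lorth_two_out_of_three Rorth_two_out_of_three Lorth_retract Rorth_retract
      lift[OF P1.Lorth_Rorth_lifts] lift[OF P2.Lorth_Rorth_lifts] P1.Lorth_Rorth_lifts P2.Lorth_Rorth_lifts
      P1.Lorth_Rorth_factors P2.Lorth_Rorth_factors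
    by (simp add: Fib_Weq_eq CoFib_Weq_eq)
qed

lemma model_of_seqs_eq:
  assumes d: "is_torsion_seqs C T1 F1 d1" "is_torsion_seqs C T2 F2 d2"
    and H: "\<And>f. f \<in> Ar C \<Longrightarrow>
      iso_arrow C (FM H f) \<longleftrightarrow> iso_arrow C (FM (comp_functor (tor_functor C d1) (free_functor C d2)) f)"
  shows "model_of_seqs C d1 d2 H = model"
proof -
  have "iso_arrow C (FM (free_functor C d1) f) \<longleftrightarrow> f \<in> Lorth C F1"
    "iso_arrow C (FM (tor_functor C d2) f) \<longleftrightarrow> f \<in> Rorth C T2" if "f \<in> Ar C" for f
    using P1.free_iso[OF d(1), of f "Dom C f" "Cod C f"] P2.tor_iso[OF d(2), of f "Dom C f" "Cod C f"] that
    by (simp_all add: Hom_def)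
  then have "{f \<in> Ar C. iso_arrow C (FM (free_functor C d1) f)} = Lorth C F1"
    "{f \<in> Ar C. iso_arrow C (FM (tor_functor C d2) f)} = Rorth C T2"
    using Lorth_Ar[of _ C] Rorth_Ar[of _ C] by blast+
  moreover have "{f \<in> Ar C. iso_arrow C (FM H f)} = twin_weq C T1 F2"
    unfolding twin_weq_tor_free[OF d] using H by blast
  ultimately show ?thesis by (simp add: model_of_seqs_def model_def)
qed

lemma Phi_eq: "Phi C (T1, F1, T2, F2) = model"
  using model_of_seqs_eq[OF someI_ex[OF P1.seqs_exist] someI_ex[OF P2.seqs_exist]] by (simp add: Let_def)

end

text \<open>There is a single arrow from zero to \<open>Y\<close>, so bijectivity of
  \<open>Hom(f, Y)\<close> says that only the zero arrow goes from \<open>X\<close> to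
  \<open>Y\<close>; for all \<open>Y\<close> in \<open>F\<close> this describes
  \<open>T\<close>.\<close>

lemma (in torsion) from_zero_Lorth:
  assumes "zero_object C Z" "f \<in> Hom C Z X"
  shows "f \<in> Lorth C F \<longleftrightarrow> X \<in> T"
proof
  have o: "X \<in> Ob C" "Z \<in> Ob C" using assms Hom_Ob by auto
  have Z: "g = z Z Y" if "g \<in> Hom C Z Y" for g Y using zero_object_Hom assms that by blast
  assume f: "f \<in> Lorth C F"
  show "X \<in> T"
  proof (rule T_I[OF o(1)])
    fix Y g assume g: "Y \<in> F" "g \<in> Hom C X Y"
    have Yo: "Y \<in> Ob C" using g Hom_Ob by blast
    have "g \<odot> f = z X Y \<odot> f" using Z[OF Cmp_Hom[OF assms(2) g(2)]] Z[OF Cmp_Hom[OF assms(2) z_Hom[OF o(1) Yo]]] by simp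
    then show "g = z X Y" using Lorth_unique[OF f assms(2) g(1,2) z_Hom[OF o(1) Yo]] category_axioms by blast
  qed
next
  have o: "X \<in> Ob C" "Z \<in> Ob C" using assms Hom_Ob by auto
  have Z: "g = z Z Y" if "g \<in> Hom C Z Y" for g Y using zero_object_Hom assms that by blast
  assume X: "X \<in> T"
  show "f \<in> Lorth C F"
  proof (rule LorthI[OF assms(2)])
    fix Y u assume u: "Y \<in> F" "u \<in> Hom C Z Y"
    then have "z X Y \<in> Hom C X Y" using z_Hom o Hom_Ob by blast
    moreover from this have "z X Y \<odot> f = u" using Z u Cmp_Hom[OF assms(2)] by metis
    ultimately show "\<exists>v \<in> Hom C X Y. v \<odot> f = u" by blast
  next
    fix Y v w assume "Y \<in> F" "v \<in> Hom C X Y" "w \<in> Hom C X Y"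
    then show "v = w" using Hom_T_F X by metis
  qed
qed

lemma (in torsion) to_zero_Rorth: "zero_object C Z \<Longrightarrow> f \<in> Hom C X Z \<Longrightarrow> f \<in> Rorth C T \<longleftrightarrow> X \<in> F"
  using torsion.from_zero_Lorth[OF torsion_op, of Z f X] by simp

lemma (in twin) zero_orth:
  assumes "X \<in> Ob C"
  shows "from_zero C X \<in> Lorth C F1 \<longleftrightarrow> X \<in> T1" "from_zero C X \<in> Lorth C F2 \<longleftrightarrow> X \<in> T2"
    "to_zero C X \<in> Rorth C T1 \<longleftrightarrow> X \<in> F1" "to_zero C X \<in> Rorth C T2 \<longleftrightarrow> X \<in> F2"
  using P1.from_zero_Lorth P2.from_zero_Lorth P1.to_zero_Rorth P2.to_zero_Rorth
    from_zero_eq[OF assms] to_zero_eq[OF assms] z_Hom assms zero_ob by simp_all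

lemma (in twin) Psi_model: "Psi C model = (T1, F1, T2, F2)"
  using zero_orth P1.T_Ob P2.T_Ob P1.F_Ob P2.F_Ob
  by (auto simp: model_def Fib_Weq_eq CoFib_Weq_eq)

text \<open>Every torsion model structure consists of two torsion factorization systems,
  and \<open>Weq\<close> is recovered as \<open>TFib \<circ> TCoFib\<close>.\<close>

lemma (in abelian) torsion_model_structure_twin:
  assumes M: "torsion_model_structure C (CoFib, Fib, Weq)"
    and P: "Psi C (CoFib, Fib, Weq) = (T1, F1, T2, F2)"
  shows "twin C pl z T1 F1 T2 F2" "(CoFib, Fib, Weq) = twin.model C T1 F1 T2 F2"
proof -
  have sub: "CoFib \<subseteq> Ar C" "Fib \<subseteq> Ar C" "Weq \<subseteq> Ar C" using M by simp_all
  have tt: "two_out_of_three C CoFib" "two_out_of_three C Fib" "two_out_of_three C Weq" using M by simp_all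
  have tt': "two_out_of_three C (A \<inter> B)" if "two_out_of_three C A" "two_out_of_three C B" for A B
    using that unfolding two_out_of_three_def by blast
  have rr: "closed_under_retracts C (A \<inter> B)" if "closed_under_retracts C A" "closed_under_retracts C B" for A B
    using that unfolding closed_under_retracts_def by blast
  interpret A: torsion_factorization C pl z CoFib "Fib \<inter> Weq"
    by unfold_locales (use M sub tt tt' rr in auto)
  interpret B: torsion_factorization C pl z "CoFib \<inter> Weq" Fib
    by unfold_locales (use M sub tt tt' rr in auto)
  have e: "T1 = A.TL" "F1 = A.FR" "T2 = B.TL" "F2 = B.FR"
    using P unfolding A.TL_def A.FR_def B.TL_def B.FR_def by simp_all
  \<comment> \<open>The inclusion \<open>T2 \<subseteq> T1\<close> comes from that of
    \<open>CoFib \<inter> Weq\<close> in \<open>CoFib\<close>.\<close>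
  show tw: "twin C pl z T1 F1 T2 F2"
    unfolding e using A.torsion_pair_TL_FR B.torsion_pair_TL_FR
    by (intro twin.intro twin_axioms.intro abelian_axioms) (auto simp: A.TL_def B.TL_def)
  have "Weq = twin_weq C T1 F2"
  proof (intro equalityI subsetI)
    fix f assume f: "f \<in> Weq"
    then have fH: "f \<in> Hom C (Dom C f) (Cod C f)" using sub by (auto simp: Hom_def)
    obtain E i p where ip: "i \<in> Hom C (Dom C f) E" "p \<in> Hom C E (Cod C f)" "i \<in> CoFib \<inter> Weq" "p \<in> Fib" "p \<odot> i = f"
      using B.factor[OF fH] .
    then have "p \<in> Fib \<inter> Weq" using two_out_of_three_left[OF tt(3) ip(1,2)] f by blast
    then have "i \<in> Lorth C F2" "p \<in> Rorth C T1" using A.R_eq B.L_eq e ip(3) by blast+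
    moreover have "Cod C i = Dom C p" using ip(1,2) by (auto simp: Hom_def)
    ultimately show "f \<in> twin_weq C T1 F2" using ip(5) unfolding twin_weq_def by blast
  next
    fix f assume "f \<in> twin_weq C T1 F2"
    then obtain i p where f: "f = p \<odot> i" "i \<in> CoFib \<inter> Weq" "p \<in> Fib \<inter> Weq" "Cod C i = Dom C p"
      using A.R_eq B.L_eq e unfolding twin_weq_def by blast
    then have "i \<in> Hom C (Dom C i) (Dom C p)" "p \<in> Hom C (Dom C p) (Cod C p)"
      using sub by (auto simp: Hom_def)
    then show "f \<in> Weq" using two_out_of_three_Cmp[OF tt(3)] f by blast
  qed
  moreover have "CoFib = Lorth C F1" unfolding e(2) by (rule A.L_eq)
  moreover have "Fib = Rorth C T2" unfolding e(3) by (rule B.R_eq)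
  ultimately show "(CoFib, Fib, Weq) = twin.model C T1 F1 T2 F2" unfolding twin.model_def[OF tw] by blast
qed

section \<open>The natural isomorphism between the two composite functors\<close>

lemma nat_isomorphic_sym:
  assumes "nat_isomorphic C D F G" "category C" "category D"
  shows "nat_isomorphic C D G F"
proof -
  interpret C: category C by fact
  interpret D: category D by fact
  obtain a where FG: "is_functor C D F" "is_functor C D G"
    and a: "\<And>X. X \<in> Ob C \<Longrightarrow> a X \<in> Hom D (FO F X) (FO G X) \<and> iso_arrow D (a X)"
    and n: "\<And>f. f \<in> Ar C \<Longrightarrow> a (Cod C f) \<odot>\<^bsub>D\<^esub> FM F f = FM G f \<odot>\<^bsub>D\<^esub> a (Dom C f)"
    using assms(1) unfolding nat_isomorphic_def by blast
  have "\<exists>b. X \<in> Ob C \<longrightarrow> b \<in> Hom D (FO G X) (FO F X) \<and> b \<odot>\<^bsub>D\<^esub> a X = Ident D (FO F X) \<and>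
      a X \<odot>\<^bsub>D\<^esub> b = Ident D (FO G X) \<and> iso_arrow D b" for X
    using a[of X] D.iso_arrowE[of "a X" "FO F X" "FO G X"] by metis
  then obtain b where b: "\<And>X. X \<in> Ob C \<Longrightarrow> b X \<in> Hom D (FO G X) (FO F X) \<and> b X \<odot>\<^bsub>D\<^esub> a X = Ident D (FO F X) \<and>
      a X \<odot>\<^bsub>D\<^esub> b X = Ident D (FO G X) \<and> iso_arrow D (b X)" by metis
  have "b (Cod C f) \<odot>\<^bsub>D\<^esub> FM G f = FM F f \<odot>\<^bsub>D\<^esub> b (Dom C f)" if f: "f \<in> Ar C" for f
  proof -
    define X Y where "X = Dom C f" and "Y = Cod C f"
    have fH: "f \<in> Hom C X Y" "X \<in> Ob C" "Y \<in> Ob C" using f by (auto simp: X_def Y_def Hom_def)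
    note h = functor_Hom[OF FG(1) fH(1)] functor_Hom[OF FG(2) fH(1)]
    have aX: "a X \<in> Hom D (FO F X) (FO G X)" and aY: "a Y \<in> Hom D (FO F Y) (FO G Y)" using a fH by auto
    have bX: "b X \<in> Hom D (FO G X) (FO F X)" "a X \<odot>\<^bsub>D\<^esub> b X = Ident D (FO G X)"
      and bY: "b Y \<in> Hom D (FO G Y) (FO F Y)" "b Y \<odot>\<^bsub>D\<^esub> a Y = Ident D (FO F Y)" using b fH by auto
    have e: "a Y \<odot>\<^bsub>D\<^esub> FM F f = FM G f \<odot>\<^bsub>D\<^esub> a X" using n[OF f] by (simp add: X_def Y_def)
    have "b Y \<odot>\<^bsub>D\<^esub> FM G f = b Y \<odot>\<^bsub>D\<^esub> ((FM G f \<odot>\<^bsub>D\<^esub> a X) \<odot>\<^bsub>D\<^esub> b X)"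
      using h aX bX bY(1) by (simp add: Hom_def)
    also have "\<dots> = (b Y \<odot>\<^bsub>D\<^esub> a Y) \<odot>\<^bsub>D\<^esub> (FM F f \<odot>\<^bsub>D\<^esub> b X)"
      unfolding e[symmetric] using h aY bX(1) bY(1) by (simp add: Hom_def)
    also have "\<dots> = FM F f \<odot>\<^bsub>D\<^esub> b X" unfolding bY(2) using h bX(1) by (simp add: Hom_def)
    finally show ?thesis by (simp add: X_def Y_def)
  qed
  then show ?thesis using FG b unfolding nat_isomorphic_def by blast
qed

lemma functor_full_subcat:
  assumes "is_functor C B F" "\<And>X. X \<in> Ob C \<Longrightarrow> FO F X \<in> S" "category C"
  shows "is_functor C (full_subcat B S) F"
  using assms category.Dom_Ob[OF assms(3)] category.Cod_Ob[OF assms(3)]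
  unfolding is_functor_def by simp

context twin
begin

context
  fixes d1 d2 assumes d1: "is_torsion_seqs C T1 F1 d1" and d2: "is_torsion_seqs C T2 F2 d2"
begin

text \<open>Torsion-free classes contain subobjects: the torsion part of an object of
  \<open>F2\<close> stays in \<open>F2\<close>.\<close>

lemma tor_free_Ob:
  assumes "X \<in> Ob C"
  shows "tor_ob d1 (free_ob d2 X) \<in> T1 \<inter> F2"
proof -
  have R: "free_ob d2 X \<in> F2" "free_ob d2 X \<in> Ob C" using P2.seqs(2)[OF d2 assms] P2.F_Ob by auto
  note s = P1.seqs[OF d1 R(2)]
  show ?thesis using s(1) P2.F_sub[OF s(10,3) R(1)] by blast
qed

lemma free_tor_Ob:
  assumes "X \<in> Ob C"
  shows "free_ob d2 (tor_ob d1 X) \<in> T1 \<inter> F2"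
proof -
  have R: "tor_ob d1 X \<in> T1" "tor_ob d1 X \<in> Ob C" using P1.seqs(1)[OF d1 assms] P1.T_Ob by auto
  note s = P2.seqs[OF d2 R(2)]
  show ?thesis using s(2) P1.T_quotient[OF s(9,4) R(1)] by blast
qed

lemma tor_free_is_functor: "is_functor C (full_subcat C (T1 \<inter> F2)) (comp_functor (tor_functor C d1) (free_functor C d2))"
  by (rule functor_full_subcat[OF is_functor_comp[OF P2.free_is_functor[OF d2] P1.tor_is_functor[OF d1]] _ category_axioms])
    (use tor_free_Ob in \<open>simp add: comp_functor_def\<close>)

lemma free_tor_is_functor: "is_functor C (full_subcat C (T1 \<inter> F2)) (comp_functor (free_functor C d2) (tor_functor C d1))"
  by (rule functor_full_subcat[OF free_tor_functor[OF d1 d2] _ category_axioms])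
    (use free_tor_Ob in \<open>simp add: comp_functor_def\<close>)

text \<open>The image of the projection under the first torsion functor ends in \<open>F2\<close>,
  so it factors through the torsion-free quotient of its source. Both it and that quotient map lie
  in \<open>Lorth C F2\<close>, hence so does the comparison \<open>a\<close>, whose ends are in
  \<open>F2\<close>.\<close>

lemma tor_free_comparison:
  assumes X: "X \<in> Ob C"
  shows "\<exists>a \<in> Hom C (free_ob d2 (tor_ob d1 X)) (tor_ob d1 (free_ob d2 X)).
    iso_arrow C a \<and> a \<odot> free_proj d2 (tor_ob d1 X) = FM (tor_functor C d1) (free_proj d2 X)"
proof -
  let ?t = "FM (tor_functor C d1) (free_proj d2 X)"
  have T: "tor_ob d1 X \<in> Ob C" using P1.seqs(1)[OF d1 X] P1.T_Ob by blast
  note s = P2.seqs[OF d2 X] and u = P2.seqs[OF d2 T]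
  have t: "?t \<in> Hom C (tor_ob d1 X) (tor_ob d1 (free_ob d2 X))" by (rule P1.tor_map(1)[OF d1 s(4)])
  have F: "tor_ob d1 (free_ob d2 X) \<in> F2" using tor_free_Ob[OF X] by blast
  obtain a where a: "a \<in> Hom C (free_ob d2 (tor_ob d1 X)) (tor_ob d1 (free_ob d2 X))"
    "a \<odot> free_proj d2 (tor_ob d1 X) = ?t"
    using LorthE[OF u(7,4) F t] .
  have "a \<in> Lorth C F2" using Lorth_left[OF u(4) a(1) u(7)] a(2) tor_proj_Lorth[OF d1 d2 X] by simp
  then have "iso_arrow C a" using Lorth_iso[OF _ a(1) u(2) F] by blast
  then show ?thesis using a by blast
qed

lemma tor_free_nat_isomorphic:
  "nat_isomorphic C (full_subcat C (T1 \<inter> F2))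
    (comp_functor (tor_functor C d1) (free_functor C d2)) (comp_functor (free_functor C d2) (tor_functor C d1))"
proof -
  let ?D = "full_subcat C (T1 \<inter> F2)"
  let ?t = "FM (tor_functor C d1)" and ?r = "FM (free_functor C d2)"
  have "\<forall>X. \<exists>a. X \<in> Ob C \<longrightarrow> a \<in> Hom C (free_ob d2 (tor_ob d1 X)) (tor_ob d1 (free_ob d2 X)) \<and>
    iso_arrow C a \<and> a \<odot> free_proj d2 (tor_ob d1 X) = ?t (free_proj d2 X)"
    using tor_free_comparison by blast
  then obtain a where a: "\<And>X. X \<in> Ob C \<Longrightarrow> a X \<in> Hom C (free_ob d2 (tor_ob d1 X)) (tor_ob d1 (free_ob d2 X)) \<and>
    iso_arrow C (a X) \<and> a X \<odot> free_proj d2 (tor_ob d1 X) = ?t (free_proj d2 X)" by metis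
  have nat: "a (Cod C f) \<odot> ?r (?t f) = ?t (?r f) \<odot> a (Dom C f)" if f: "f \<in> Ar C" for f
  proof -
    define X Y where "X = Dom C f" and "Y = Cod C f"
    have fH: "f \<in> Hom C X Y" "X \<in> Ob C" "Y \<in> Ob C" using f by (auto simp: X_def Y_def Hom_def)
    note aX = a[OF fH(2)] and aY = a[OF fH(3)]
    note F = P1.tor_is_functor[OF d1]
    have o: "tor_ob d1 X \<in> Ob C" "tor_ob d1 Y \<in> Ob C" using P1.seqs(1)[OF d1] P1.T_Ob fH by blast+
    note p = P2.seqs(4)[OF d2 fH(2)] P2.seqs(4)[OF d2 fH(3)]
      P2.seqs(4)[OF d2 o(1)] P2.seqs(4)[OF d2 o(2)]
    note e = P2.seqs(9)[OF d2 o(1)]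
    note r = P2.free_map[OF d2 fH(1)]
    have t: "?t f \<in> Hom C (tor_ob d1 X) (tor_ob d1 Y)" using functor_Hom[OF F fH(1)] by simp
    note rt = P2.free_map[OF d2 t]
    have tr: "?t (?r f) \<in> Hom C (tor_ob d1 (free_ob d2 X)) (tor_ob d1 (free_ob d2 Y))"
      using functor_Hom[OF F r(1)] by simp
    \<comment> \<open>Naturality is verified after the epimorphic projection, where \<open>a\<close>
      turns into the image of a projection and functoriality of the torsion functor applies.\<close>
    have "(a Y \<odot> ?r (?t f)) \<odot> free_proj d2 (tor_ob d1 X) = a Y \<odot> (?r (?t f) \<odot> free_proj d2 (tor_ob d1 X))"
      using aY rt(1) p by (simp add: Hom_def)
    also have "\<dots> = (a Y \<odot> free_proj d2 (tor_ob d1 Y)) \<odot> ?t f"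
      unfolding rt(2) using conjunct1[OF aY] p t by (simp add: Hom_def)
    also have "\<dots> = ?t (free_proj d2 Y) \<odot> ?t f" using aY by simp
    also have "\<dots> = ?t (free_proj d2 Y \<odot> f)" using functor_Cmp[OF F fH(1) p(2)] by simp
    also have "\<dots> = ?t (?r f) \<odot> ?t (free_proj d2 X)" using functor_Cmp[OF F p(1) r(1)] r(2) by simp
    also have "\<dots> = ?t (?r f) \<odot> (a X \<odot> free_proj d2 (tor_ob d1 X))" using aX by simp
    also have "\<dots> = (?t (?r f) \<odot> a X) \<odot> free_proj d2 (tor_ob d1 X)" using conjunct1[OF aX] p tr by (simp add: Hom_def)
    finally have *: "(a Y \<odot> ?r (?t f)) \<odot> free_proj d2 (tor_ob d1 X) = (?t (?r f) \<odot> a X) \<odot> free_proj d2 (tor_ob d1 X)" .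
    have "Cod C (free_proj d2 (tor_ob d1 X)) = free_ob d2 (tor_ob d1 X)" using p by (simp add: Hom_def)
    then show ?thesis
      using epi_cancel[OF e *] Cmp_Hom rt(1) aY aX tr unfolding X_def[symmetric] Y_def[symmetric] by metis
  qed
  have "nat_isomorphic C ?D (comp_functor (free_functor C d2) (tor_functor C d1))
      (comp_functor (tor_functor C d1) (free_functor C d2))"
    unfolding nat_isomorphic_def
    using free_tor_is_functor tor_free_is_functor a nat tor_free_Ob free_tor_Ob
    by (intro conjI exI[of _ a]) (auto simp: comp_functor_def iso_full_subcat Hom_def)
  then show ?thesis using nat_isomorphic_sym category_axioms category_full_subcat by blast
qed

lemma model_of_seqs_nat_isomorphic:
  assumes "nat_isomorphic C (full_subcat C (T1 \<inter> F2)) H (comp_functor (tor_functor C d1) (free_functor C d2))"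
  shows "model_of_seqs C d1 d2 H = model"
proof (rule model_of_seqs_eq[OF d1 d2])
  fix f assume f: "f \<in> Ar C"
  let ?D = "full_subcat C (T1 \<inter> F2)"
  have "is_functor C ?D H" using assms by (simp add: nat_isomorphic_def)
  then have "FM H f \<in> Ar ?D" using f by (auto simp: is_functor_def Hom_def)
  moreover have "FM (comp_functor (tor_functor C d1) (free_functor C d2)) f \<in> Ar ?D"
    using tor_free_is_functor f unfolding is_functor_def Hom_def by blast
  ultimately show "iso_arrow C (FM H f) = iso_arrow C (FM (comp_functor (tor_functor C d1) (free_functor C d2)) f)"
    using nat_isomorphic_inverts[OF assms category_full_subcat f category_axioms] by (simp add: iso_full_subcat)
qed

end

end

section \<open>Bi-reflectivity and the three classes of objects\<close>

text \<open>Such a \<open>p\<close> is the torsion part of \<open>Y\<close> up to isomorphism: it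
  factors through \<open>i\<close> by an arrow \<open>w\<close> that is in \<open>Rorth C T\<close>
  and joins objects of \<open>T\<close>. Monicity and the cokernel are inherited from
  \<open>i\<close>.\<close>

lemma (in torsion) Rorth_from_T:
  assumes p: "p \<in> Rorth C T" "p \<in> Hom C X Y" and X: "X \<in> T"
  obtains c where "mono_arrow C p" "is_cokernel C p c" "Cod C c \<in> F"
proof -
  have Y: "Y \<in> Ob C" using p Hom_Ob by blast
  obtain A B i q where s: "A \<in> T" "B \<in> F" "i \<in> Hom C A Y" "q \<in> Hom C Y B" "is_kernel C q i" "is_cokernel C i q"
    using torsion_sequence[OF Y] .
  have iR: "i \<in> Rorth C T" by (rule sequence_orth(2)[OF s(5,6,3,4,1,2)])
  obtain w where w: "w \<in> Hom C X A" "i \<odot> w = p" using RorthE[OF iR s(3) X p(2)] .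
  have "w \<in> Rorth C T" using Rorth_right[OF w(1) s(3) iR] w(2) p(1) by simp
  then have iso: "iso_arrow C w" using Rorth_iso w(1) X s(1) by blast
  obtain w' where w': "w' \<in> Hom C A X" "w \<odot> w' = Ident C A" using iso_arrowE[OF iso w(1)] by metis
  have o: "X \<in> Ob C" "B \<in> Ob C" using p s Hom_Ob by auto
  have mono: "mono_arrow C p"
  proof (rule monoI[OF p(2)])
    fix W k assume k: "k \<in> Hom C W X" "p \<odot> k = z W Y"
    have "i \<odot> (w \<odot> k) = z W Y" using w(1) w(2)[THEN Cmp_rewrite, of k] k s(3) by (simp add: Hom_def)
    then have "w \<odot> k = z W A" using mono_Hom[OF kernel_mono[OF s(5)] s(3) Cmp_Hom[OF k(1) w(1)]] by blast
    then show "k = z W X" using mono_Hom[OF iso_mono[OF iso] w(1) k(1)] by blast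
  qed
  have cok: "is_cokernel C p q"
  proof (rule cokernelI[OF p(2) s(4)])
    have "q \<odot> p = (q \<odot> i) \<odot> w" using w s(3,4) by (auto simp: Hom_def)
    also have "\<dots> = z X B" unfolding kernel_Hom(2)[OF s(5,4)] using w(1) s(3) o by (simp add: Hom_def)
    finally show "q \<odot> p = z X B" .
    show "epi_arrow C q" by (rule cokernel_epi[OF s(6)])
    fix W h assume h: "h \<in> Hom C Y W" "h \<odot> p = z X W"
    have "h \<odot> i = (h \<odot> p) \<odot> w'"
      using w w' h(1) s(3) w(2)[symmetric] by (simp add: Hom_def)
    also have "\<dots> = z A W" unfolding h(2) using w'(1) Hom_Ob(2)[OF h(1)] by (simp add: Hom_def)
    finally show "\<exists>u \<in> Hom C B W. u \<odot> q = h"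
      using cokernel_lift[OF s(6,3) h(1)] s(4) by (auto simp: Hom_def)
  qed
  have "Cod C q \<in> F" using s by (simp add: Hom_def)
  then show thesis using that mono cok by blast
qed

text \<open>The condition on the domain makes \<open>p\<close> mono with cokernel in
  \<open>F\<close>. A pushout preserves monicity and the cokernel, so \<open>b\<close> has the same
  form.\<close>

lemma (in torsion) pushout_Rorth:
  assumes P: "is_pushout C p u a b" and p: "p \<in> Rorth C T" "Dom C p \<in> T"
  shows "b \<in> Rorth C T"
proof -
  have "p \<in> Hom C (Dom C p) (Cod C p)" using Rorth_Ar[OF p(1)] by (simp add: Hom_def)
  then obtain c where c: "mono_arrow C p" "is_cokernel C p c" "Cod C c \<in> F"
    using Rorth_from_T p by blast
  obtain k where k: "k \<in> Hom C (Cod C a) (Cod C c)" "is_cokernel C b k" using pushout_cokernel[OF P c(2)] by blast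
  show ?thesis
    by (rule mono_Rorth[OF pushout_mono[OF P c(1)] k(2)]) (use k(1) c(3) in \<open>simp add: Hom_def\<close>)
qed

lemma (in torsion) pullback_Lorth:
  assumes "is_pullback C i v a b" "i \<in> Lorth C F" "Cod C i \<in> F"
  shows "b \<in> Lorth C F"
  using torsion.pushout_Rorth[OF torsion_op, of i v a b] assms by simp

context twin
begin

lemma cofibrant_model: "cofibrant_objects C model = T1"
  using zero_orth P1.T_Ob by (auto simp: model_def)

lemma fibrant_model: "fibrant_objects C model = F2"
  using zero_orth P2.F_Ob by (auto simp: model_def)

text \<open>A factorization of the arrow from zero to \<open>X\<close> through \<open>E\<close> puts
  \<open>E\<close> in \<open>T2\<close>. As \<open>E\<close> is then in \<open>T1\<close>, the
  remaining arrow is mono with cokernel in \<open>F1\<close>, which is the required exact sequence.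
  Conversely, an exact sequence provides such a factorization.\<close>

lemma trivial_model: "trivial_objects C model = extension_class C T2 F1"
proof (intro equalityI subsetI)
  let ?Z = "zero_ob C"
  fix X assume X: "X \<in> trivial_objects C model"
  then have Xo: "X \<in> Ob C" "from_zero C X \<in> twin_weq C T1 F2" by (auto simp: model_def)
  then obtain i p where ip: "z ?Z X = p \<odot> i" "i \<in> Lorth C F2" "p \<in> Rorth C T1" "Cod C i = Dom C p"
    using from_zero_eq by (auto simp: twin_weq_def)
  define E where "E = Dom C p"
  have a: "i \<in> Ar C" "p \<in> Ar C" using Lorth_Ar[OF ip(2)] Rorth_Ar[OF ip(3)] by auto
  then have h: "i \<in> Hom C ?Z E" "p \<in> Hom C E X"
    using Dom_Cmp[OF a ip(4)] Cod_Cmp[OF a ip(4)] a ip(4) Dom_z[OF zero_ob(2) Xo(1)] Cod_z[OF zero_ob(2) Xo(1)]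
    unfolding ip(1) by (auto simp: Hom_def E_def)
  have E: "E \<in> T2" using P2.from_zero_Lorth[OF zero_ob(1) h(1)] ip by blast
  obtain c where c: "mono_arrow C p" "is_cokernel C p c" "Cod C c \<in> F1"
    using P1.Rorth_from_T[OF ip(3) h(2)] E T2_T1 by blast
  have "short_exact C p c" using c mono_kernel_of_cokernel by (simp add: short_exact_def)
  then show "X \<in> extension_class C T2 F1"
    using E c(3) h(2) cokernel_Hom(1)[OF c(2) h(2)] Xo unfolding extension_class_def by blast
next
  let ?Z = "zero_ob C"
  fix X assume "X \<in> extension_class C T2 F1"
  then obtain A B i p where s: "X \<in> Ob C" "A \<in> T2" "B \<in> F1" "i \<in> Hom C A X" "p \<in> Hom C X B" "is_kernel C p i" "is_cokernel C i p"
    unfolding extension_class_def short_exact_def by blast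
  have A: "A \<in> Ob C" using s Hom_Ob by blast
  have "i \<in> Rorth C T1" by (rule P1.mono_Rorth[OF kernel_mono[OF s(6)] s(7)]) (use s in \<open>simp add: Hom_def\<close>)
  moreover have "z ?Z A \<in> Lorth C F2" using P2.from_zero_Lorth[OF zero_ob(1) z_Hom[OF zero_ob(2) A]] s by blast
  moreover have "z ?Z X = i \<odot> z ?Z A" "Cod C (z ?Z A) = Dom C i" using s A zero_ob by (auto simp: Hom_def)
  ultimately have "z ?Z X \<in> twin_weq C T1 F2" unfolding twin_weq_def by blast
  then show "X \<in> trivial_objects C model" using s from_zero_eq by (simp add: model_def)
qed

text \<open>The inclusion of \<open>t_1 A\<close> and the projection onto \<open>r_2 A\<close> are
  the cofibrant and fibrant replacements; the conditions on pushouts and pullbacks are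
  \<open>pushout_Rorth\<close> and its dual.\<close>

lemma bireflective_model: "bireflective_model_structure C model"
proof -
  obtain d1 d2 where d: "is_torsion_seqs C T1 F1 d1" "is_torsion_seqs C T2 F2 d2"
    using P1.seqs_exist P2.seqs_exist by blast
  have 0: "orthogonal_model_structure C model" using torsion_model unfolding model_def by simp
  have 1: "\<exists>X \<in> T1. \<exists>p \<in> Hom C X A. p \<in> Rorth C T1" if "A \<in> Ob C" for A
    using P1.seqs(1,3,8)[OF d(1) that] by blast
  have 2: "\<exists>X \<in> F2. \<exists>i \<in> Hom C A X. i \<in> Lorth C F2" if "A \<in> Ob C" for A
    using P2.seqs(2,4,7)[OF d(2) that] by blast
  have 3: "\<exists>a b. is_pushout C p u a b" if "p \<in> Rorth C T1" "u \<in> Lorth C F1" "Dom C u = Dom C p" for p u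
    using pushout_exists[of p "Dom C p" "Cod C p" u "Cod C u"] Rorth_Ar[OF that(1)] Lorth_Ar[OF that(2)] that(3)
    by (metis (mono_tags, lifting) Hom_def mem_Collect_eq)
  have 4: "\<exists>a b. is_pullback C i v a b" if "i \<in> Lorth C F2" "v \<in> Rorth C T2" "Cod C v = Cod C i" for i v
    using pullback_exists[of i "Dom C i" "Cod C i" v "Dom C v"] Rorth_Ar[OF that(2)] Lorth_Ar[OF that(1)] that(3)
    by (metis (mono_tags, lifting) Hom_def mem_Collect_eq)
  show ?thesis
    using 0 cofibrant_model fibrant_model unfolding model_def bireflective_model_structure.simps
    unfolding Fib_Weq_eq CoFib_Weq_eq
    using 1 2 3 4 Lorth_two_out_of_three Rorth_two_out_of_three P1.pushout_Rorth P2.pullback_Lorth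
    by simp
qed

end

section \<open>The homotopy category\<close>

text \<open>On \<open>T\<close> the sequence is replaced by \<open>X\<close> with its identity and
  quotient zero, so that the torsion functor fixes objects of \<open>T\<close> strictly and not just
  up to isomorphism.\<close>

lemma (in torsion) seqs_normalized_T:
  "\<exists>d. is_torsion_seqs C T F d \<and> (\<forall>X \<in> T. tor_ob d X = X \<and> tor_inc d X = Ident C X)"
proof -
  obtain d where d: "is_torsion_seqs C T F d" using seqs_exist by blast
  let ?Z = "zero_ob C"
  define d' where "d' = \<lparr>tor_ob = (\<lambda>X. if X \<in> T then X else tor_ob d X),
    tor_inc = (\<lambda>X. if X \<in> T then Ident C X else tor_inc d X),
    free_ob = (\<lambda>X. if X \<in> T then ?Z else free_ob d X),
    free_proj = (\<lambda>X. if X \<in> T then z X ?Z else free_proj d X)\<rparr>"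
  have "short_exact C (Ident C X) (z X ?Z)" if X: "X \<in> T" for X
  proof -
    have o: "X \<in> Ob C" using X T_Ob by blast
    have 0: "z X ?Z \<odot> Ident C X = z X ?Z" using o zero_ob by simp
    have "is_kernel C (z X ?Z) (Ident C X)"
      by (rule kernelI[OF z_Hom[OF o zero_ob(2)] Ident_Hom[OF o] 0 iso_mono[OF iso_Ident[OF o]]])
        (use Ident_left in blast)
    moreover have "is_cokernel C (Ident C X) (z X ?Z)"
    proof (rule cokernelI[OF Ident_Hom[OF o] z_Hom[OF o zero_ob(2)] 0])
      show "epi_arrow C (z X ?Z)"
        by (rule epiI[OF z_Hom[OF o zero_ob(2)]]) (use zero_object_Hom zero_ob in blast)
      fix W h assume h: "h \<in> Hom C X W" "h \<odot> Ident C X = z X W"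
      have W: "W \<in> Ob C" using h Hom_Ob by blast
      have "h = z X W" using h Ident_right by metis
      then show "\<exists>u \<in> Hom C ?Z W. u \<odot> z X ?Z = h"
        using z_Hom[OF zero_ob(2) W] o zero_ob W by (intro bexI[of _ "z ?Z W"]) auto
    qed
    ultimately show ?thesis by (simp add: short_exact_def)
  qed
  then have "is_torsion_seqs C T F d'"
    using d Ident_Hom z_Hom zero_ob zero_F unfolding is_torsion_seqs_def d'_def by simp
  then show ?thesis by (intro exI[of _ d']) (simp add: d'_def)
qed

lemma (in torsion) seqs_normalized_F:
  "\<exists>d. is_torsion_seqs C T F d \<and> (\<forall>X \<in> F. free_ob d X = X \<and> free_proj d X = Ident C X)"
proof -
  obtain d where d: "is_torsion_seqs (op_cat C) F T d" "\<forall>X \<in> F. tor_ob d X = X \<and> tor_inc d X = Ident C X"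
    using torsion.seqs_normalized_T[OF torsion_op] by auto
  show ?thesis
    using is_torsion_seqs_op[OF d(1)] d(2) by (intro exI[of _ "swap_seqs d"]) (simp add: swap_seqs_def)
qed

lemma localization_simps [simp]:
  "Ob (localization C W) = Ob C" "Dom (localization C W) (zclass C W X p Y) = X"
  "Cod (localization C W) (zclass C W X p Y) = Y" "Ident (localization C W) X = zclass C W X [] X"
  "FO (loc_functor C W) = (\<lambda>X. X)"
  by (simp_all add: localization_def zclass_def loc_functor_def)

text \<open>The two-dimensional part of the universal property. Naturality on images of arrows of
  \<open>C\<close> extends to formal inverses by conjugating the square, and then to zigzags by
  induction on their length.\<close>

lemma (in category) localization_natural:
  assumes W: "W \<subseteq> Ar C" and E: "category E"
    and K: "is_functor (localization C W) E K" and K': "is_functor (localization C W) E K'"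
    and a: "\<And>X. X \<in> Ob C \<Longrightarrow> a X \<in> Hom E (FO K X) (FO K' X)"
    and nat: "\<And>f. f \<in> Ar C \<Longrightarrow> a (Cod C f) \<odot>\<^bsub>E\<^esub> FM K (FM (loc_functor C W) f) =
      FM K' (FM (loc_functor C W) f) \<odot>\<^bsub>E\<^esub> a (Dom C f)"
    and f: "f \<in> Ar (localization C W)"
  shows "a (Cod (localization C W) f) \<odot>\<^bsub>E\<^esub> FM K f = FM K' f \<odot>\<^bsub>E\<^esub> a (Dom (localization C W) f)"
proof -
  let ?L = "localization C W"
  interpret L: category ?L by (rule category_localization[OF W])
  interpret E: category E by (rule E)
  have zin: "zclass C W X p Y \<in> Hom ?L X Y" if "zigzag C W X p Y" for X p Y
    using that by (auto simp: localization_Hom)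
  have lf: "FM (loc_functor C W) f = zclass C W (Dom C f) [Fwd f] (Cod C f)" for f
    by (simp add: loc_functor_def)
  have one: "a (ztgt C s) \<odot>\<^bsub>E\<^esub> FM K (zclass C W (zsrc C s) [s] (ztgt C s)) =
      FM K' (zclass C W (zsrc C s) [s] (ztgt C s)) \<odot>\<^bsub>E\<^esub> a (zsrc C s)"
    if s: "s \<in> Fwd ` Ar C \<union> Bwd ` W" for s
  proof (cases s)
    case (Fwd f)
    then show ?thesis using s nat[of f] by (auto simp: lf)
  next
    case (Bwd w)
    then have w: "w \<in> W" "w \<in> Ar C" using s W by auto
    define X Y where "X = Dom C w" and "Y = Cod C w"
    let ?w = "FM (loc_functor C W) w" and ?b = "zclass C W Y [Bwd w] X"
    have o: "X \<in> Ob C" "Y \<in> Ob C" using w by (auto simp: X_def Y_def)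
    have h: "?w \<in> Hom ?L X Y" "?b \<in> Hom ?L Y X"
      using w o by (auto simp: lf X_def Y_def intro!: zin)
    note inv = loc_functor_inverts(2,3)[OF W w(1), folded X_def Y_def]
    note k = functor_Hom[OF K h(1)] functor_Hom[OF K h(2)] functor_Hom[OF K' h(1)] functor_Hom[OF K' h(2)]
    note aX = a[OF o(1)] and aY = a[OF o(2)]
    have i: "FM K ?w \<odot>\<^bsub>E\<^esub> FM K ?b = Ident E (FO K Y)" "FM K' ?b \<odot>\<^bsub>E\<^esub> FM K' ?w = Ident E (FO K' X)"
      using functor_Cmp[OF K h(2,1)] functor_Cmp[OF K' h] inv functor_Ident[OF K, of Y] functor_Ident[OF K', of X] o
      by simp_all
    have n: "a Y \<odot>\<^bsub>E\<^esub> FM K ?w = FM K' ?w \<odot>\<^bsub>E\<^esub> a X" using nat[OF w(2)] by (simp add: X_def Y_def)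
    \<comment> \<open>The square of \<open>w\<close> is multiplied on either side by the images of
      its formal inverse.\<close>
    have "FM K' ?b \<odot>\<^bsub>E\<^esub> a Y = (FM K' ?b \<odot>\<^bsub>E\<^esub> (a Y \<odot>\<^bsub>E\<^esub> FM K ?w)) \<odot>\<^bsub>E\<^esub> FM K ?b"
      using k aX aY i(1) by (simp add: Hom_def)
    also have "\<dots> = (FM K' ?b \<odot>\<^bsub>E\<^esub> FM K' ?w) \<odot>\<^bsub>E\<^esub> (a X \<odot>\<^bsub>E\<^esub> FM K ?b)"
      unfolding n using k aX by (simp add: Hom_def)
    also have "\<dots> = a X \<odot>\<^bsub>E\<^esub> FM K ?b"
      unfolding i(2) using k aX by (simp add: Hom_def)
    finally show ?thesis using Bwd by (simp add: X_def Y_def)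
  qed
  have "a Y \<odot>\<^bsub>E\<^esub> FM K (zclass C W X p Y) = FM K' (zclass C W X p Y) \<odot>\<^bsub>E\<^esub> a X" if "zigzag C W X p Y" for X p Y
    using that
  proof (induction p arbitrary: X)
    case Nil
    then have X: "X \<in> Ob C" "Y = X" by auto
    have "FM K (zclass C W X [] X) = Ident E (FO K X)" "FM K' (zclass C W X [] X) = Ident E (FO K' X)"
      using functor_Ident[OF K, of X] functor_Ident[OF K', of X] X by simp_all
    then show ?case using X a[OF X(1)] by (simp add: Hom_def)
  next
    case (Cons s p)
    define V where "V = ztgt C s"
    have s: "s \<in> Fwd ` Ar C \<union> Bwd ` W" "zsrc C s = X" and p: "zigzag C W V p Y"
      using Cons.prems by (auto simp: V_def)
    have o: "V \<in> Ob C" "Y \<in> Ob C" "X \<in> Ob C" using zigzag_Ob[OF W p] zigzag_Ob[OF W Cons.prems] by auto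
    have zz: "zigzag C W X [s] V" using s o by (auto simp: V_def)
    define g h where "g = zclass C W V p Y" and "h = zclass C W X [s] V"
    have gh: "h \<in> Hom ?L X V" "g \<in> Hom ?L V Y" using zin p zz by (auto simp: g_def h_def)
    have c: "zclass C W X (s # p) Y = g \<odot>\<^bsub>?L\<^esub> h" using zclass_Cmp[OF zz p] by (simp add: g_def h_def)
    note k = functor_Hom[OF K gh(1)] functor_Hom[OF K gh(2)] functor_Hom[OF K' gh(1)] functor_Hom[OF K' gh(2)]
    note aa = a[OF o(1)] a[OF o(2)] a[OF o(3)]
    have 1: "a V \<odot>\<^bsub>E\<^esub> FM K h = FM K' h \<odot>\<^bsub>E\<^esub> a X" using one[OF s(1)] s(2) by (simp add: V_def h_def)
    have 2: "a Y \<odot>\<^bsub>E\<^esub> FM K g = FM K' g \<odot>\<^bsub>E\<^esub> a V" using Cons.IH[OF p] by (simp add: g_def)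
    have "a Y \<odot>\<^bsub>E\<^esub> (FM K g \<odot>\<^bsub>E\<^esub> FM K h) = (a Y \<odot>\<^bsub>E\<^esub> FM K g) \<odot>\<^bsub>E\<^esub> FM K h" using k aa by (simp add: Hom_def)
    also have "\<dots> = FM K' g \<odot>\<^bsub>E\<^esub> (a V \<odot>\<^bsub>E\<^esub> FM K h)" unfolding 2 using k aa by (simp add: Hom_def)
    also have "\<dots> = (FM K' g \<odot>\<^bsub>E\<^esub> FM K' h) \<odot>\<^bsub>E\<^esub> a X" unfolding 1 using k aa by (simp add: Hom_def)
    finally show ?case unfolding c functor_Cmp[OF K gh] functor_Cmp[OF K' gh] .
  qed
  then show ?thesis using f by (auto simp: localization_def zclass_def)
qed

lemma functor_restrict: "is_functor C D J \<Longrightarrow> is_functor (full_subcat C S) D J"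
  unfolding is_functor_def by simp

lemma id_functor_simps [simp]: "FO id_functor X = X" "FM id_functor f = f"
  by (simp_all add: id_functor_def)

lemma comp_functor_simps [simp]: "FO (comp_functor G F) X = FO G (FO F X)" "FM (comp_functor G F) f = FM G (FM F f)"
  by (simp_all add: comp_functor_def)

lemma (in category) is_functor_id: "is_functor C C id_functor"
  unfolding is_functor_def by (auto simp: Hom_def)

lemma (in twin) Weq_Ar: "twin_weq C T1 F2 \<subseteq> Ar C"
  unfolding twin_weq_def using Lorth_Ar[of _ C] Rorth_Ar[of _ C] by auto

text \<open>\<open>G\<close> is \<open>t_1 r_2\<close> descended to the localization, and
  \<open>J\<close> is the inclusion into \<open>C\<close> followed by the localization functor.
  Surjectivity of \<open>G\<close> on objects is claimed separately because an equivalence alone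
  would not give it.\<close>

lemma (in twin) Ho_equivalence:
  defines "L \<equiv> localization C (twin_weq C T1 F2)" and "D \<equiv> full_subcat C (T1 \<inter> F2)"
  shows "\<exists>G J. is_functor L D G \<and> is_functor D L J \<and> nat_isomorphic L L (comp_functor J G) id_functor \<and>
    nat_isomorphic D D (comp_functor G J) id_functor \<and> (\<forall>X \<in> Ob D. \<exists>Y \<in> Ob L. FO G Y = X)"
proof -
  obtain d1 where d1: "is_torsion_seqs C T1 F1 d1" "\<And>X. X \<in> T1 \<Longrightarrow> tor_ob d1 X = X \<and> tor_inc d1 X = Ident C X"
    using P1.seqs_normalized_T by blast
  obtain d2 where d2: "is_torsion_seqs C T2 F2 d2" "\<And>X. X \<in> F2 \<Longrightarrow> free_ob d2 X = X \<and> free_proj d2 X = Ident C X"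
    using P2.seqs_normalized_F by blast
  define W where "W = twin_weq C T1 F2"
  have W: "W \<subseteq> Ar C" using Weq_Ar by (simp add: W_def)
  define H where "H = comp_functor (tor_functor C d1) (free_functor C d2)"
  have H: "is_functor C D H" unfolding H_def D_def by (rule tor_free_is_functor[OF d1(1) d2(1)])
  have L_def': "L = localization C W" by (simp add: L_def W_def)
  interpret L: category L unfolding L_def' by (rule category_localization[OF W])
  interpret D: category D unfolding D_def by (rule category_full_subcat)
  have "iso_arrow D (FM H w)" if "w \<in> W" for w
  proof -
    have "iso_arrow C (FM H w)" "w \<in> Ar C"
      using that twin_weq_tor_free[OF d1(1) d2(1)] unfolding W_def H_def by auto
    moreover from this have "FM H w \<in> Ar D" using H by (simp add: is_functor_def Hom_def)
    ultimately show ?thesis unfolding D_def iso_full_subcat by simp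
  qed
  then obtain G where G: "is_functor L D G" "\<And>X. X \<in> Ob C \<Longrightarrow> FO G X = FO H X"
    "\<And>f. f \<in> Ar C \<Longrightarrow> FM G (FM (loc_functor C W) f) = FM H f"
    using localization_universal(1)[OF category_axioms D.category_axioms W H] unfolding L_def' by auto
  let ?l = "FM (loc_functor C W)"
  have l: "is_functor C L (loc_functor C W)" unfolding L_def' by (rule loc_functor_is_functor[OF W])
  define J where "J = loc_functor C W"
  have J: "is_functor D L J" unfolding J_def D_def by (rule functor_restrict[OF l])
  have onto: "FO H X = X" "X \<in> Ob C" if "X \<in> Ob D" for X
    using that d1(2) d2(2) by (auto simp: H_def D_def)
  \<comment> \<open>With the normalized sequences identities stand in place of projections and
    inclusions, so an arrow of \<open>D\<close> fits into its own defining squares.\<close>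
  have fix_arrows: "FM H f = f" if f: "f \<in> Ar D" for f
  proof -
    define X Y where "X = Dom C f" and "Y = Cod C f"
    have S: "X \<in> T1" "X \<in> F2" "Y \<in> T1" "Y \<in> F2" "f \<in> Hom C X Y" using f by (auto simp: D_def X_def Y_def Hom_def)
    have "FM (free_functor C d2) f = f"
      by (rule P2.free_unique[OF d2(1) S(5)]) (use S d2(2) in \<open>auto simp: Hom_def\<close>)
    moreover have "FM (tor_functor C d1) f = f"
      by (rule P1.tor_unique[OF d1(1) S(5)]) (use S d1(2) in \<open>auto simp: Hom_def\<close>)
    ultimately show ?thesis by (simp add: H_def)
  qed
  have "nat_isomorphic D D (comp_functor G J) id_functor"
    unfolding nat_isomorphic_def
  proof (intro conjI exI[of _ "Ident C"] ballI)
    show "is_functor D D (comp_functor G J)" by (rule is_functor_comp[OF J G(1)])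
    show "is_functor D D id_functor" by (rule D.is_functor_id)
    fix X assume X: "X \<in> Ob D"
    then show "Ident C X \<in> Hom D (FO (comp_functor G J) X) (FO id_functor X)"
      using G(2) onto Ident_Hom by (simp add: J_def) (simp add: D_def)
    show "iso_arrow D (Ident C X)" using X iso_Ident by (simp add: D_def iso_full_subcat)
  next
    fix f assume f: "f \<in> Ar D"
    then have "FM G (FM J f) = f" using G(3) fix_arrows by (simp add: J_def) (simp add: D_def)
    then show "Ident C (Cod D f) \<odot>\<^bsub>D\<^esub> FM (comp_functor G J) f = FM id_functor f \<odot>\<^bsub>D\<^esub> Ident C (Dom D f)"
      using f by (simp add: D_def)
  qed
  moreover have "nat_isomorphic L L (comp_functor J G) id_functor"
  proof -
    \<comment> \<open>The projection from \<open>X\<close> to \<open>r_2 X\<close> is a trivial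
      cofibration and the inclusion of \<open>t_1 r_2 X\<close> a trivial fibration. In the
      localization both are invertible, and this zigzag is the component at \<open>X\<close> of the
      isomorphism to the identity functor.\<close>
    define P where "P X = ?l (free_proj d2 X)" for X
    define I where "I X = ?l (tor_inc d1 (free_ob d2 X))" for X
    have o: "free_ob d2 X \<in> Ob C" if "X \<in> Ob C" for X using P2.seqs(2)[OF d2(1) that] P2.F_Ob by blast
    have inW: "f \<in> W" if "f \<in> Lorth C F2 \<or> f \<in> Rorth C T1" for f
      using that Fib_Weq_eq CoFib_Weq_eq unfolding W_def by blast
    have isoW: "iso_arrow L (?l w)" if "w \<in> W" for w unfolding L_def' by (rule loc_functor_inverts(1)[OF W that])
    have P: "P X \<in> Hom L X (free_ob d2 X)" "iso_arrow L (P X)" if "X \<in> Ob C" for X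
      using functor_Hom[OF l P2.seqs(4)[OF d2(1) that]] isoW inW P2.seqs(7)[OF d2(1) that] by (auto simp: P_def)
    have I: "I X \<in> Hom L (FO H X) (free_ob d2 X)" "iso_arrow L (I X)" if "X \<in> Ob C" for X
      using functor_Hom[OF l P1.seqs(3)[OF d1(1) o[OF that]]] isoW inW P1.seqs(8)[OF d1(1) o[OF that]]
      by (auto simp: I_def H_def)
    have "\<exists>b. X \<in> Ob C \<longrightarrow> b \<in> Hom L (free_ob d2 X) X \<and> b \<odot>\<^bsub>L\<^esub> P X = Ident L X \<and>
      P X \<odot>\<^bsub>L\<^esub> b = Ident L (free_ob d2 X) \<and> iso_arrow L b" for X
      using L.iso_arrowE[OF P(2,1)] by metis
    then obtain B where B: "\<And>X. X \<in> Ob C \<Longrightarrow> B X \<in> Hom L (free_ob d2 X) X \<and> B X \<odot>\<^bsub>L\<^esub> P X = Ident L X \<and>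
      P X \<odot>\<^bsub>L\<^esub> B X = Ident L (free_ob d2 X) \<and> iso_arrow L (B X)" by metis
    define a where "a X = B X \<odot>\<^bsub>L\<^esub> I X" for X
    have a: "a X \<in> Hom L (FO J (FO G X)) X" "iso_arrow L (a X)" if X: "X \<in> Ob C" for X
    proof -
      show "a X \<in> Hom L (FO J (FO G X)) X"
        using L.Cmp_Hom[OF I(1)[OF X] conjunct1[OF B[OF X]]] G(2)[OF X] by (simp add: a_def J_def)
      show "iso_arrow L (a X)"
        unfolding a_def by (rule L.iso_Cmp) (use B[OF X] I[OF X] in \<open>auto simp: Hom_def\<close>)
    qed
    have nat: "a (Cod C f) \<odot>\<^bsub>L\<^esub> FM J (FM G (?l f)) = ?l f \<odot>\<^bsub>L\<^esub> a (Dom C f)"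
      if f: "f \<in> Ar C" for f
    proof -
      define X Y where "X = Dom C f" and "Y = Cod C f"
      have fH: "f \<in> Hom C X Y" "X \<in> Ob C" "Y \<in> Ob C" using f by (auto simp: X_def Y_def Hom_def)
      let ?r = "FM (free_functor C d2) f"
      note r = P2.free_map[OF d2(1) fH(1)]
      have Hf: "FM H f \<in> Hom C (FO H X) (FO H Y)"
        "tor_inc d1 (free_ob d2 Y) \<odot> FM H f = ?r \<odot> tor_inc d1 (free_ob d2 X)"
        using P1.tor_map[OF d1(1) r(1)] by (simp_all add: H_def)
      have bX: "B X \<in> Hom L (free_ob d2 X) X" "P X \<odot>\<^bsub>L\<^esub> B X = Ident L (free_ob d2 X)"
        and bY: "B Y \<in> Hom L (free_ob d2 Y) Y" "B Y \<odot>\<^bsub>L\<^esub> P Y = Ident L Y" using B fH by auto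
      note lf = functor_Hom[OF l fH(1)] functor_Hom[OF l r(1)] functor_Hom[OF l Hf(1)]
      note PI = P(1)[OF fH(2)] P(1)[OF fH(3)] I(1)[OF fH(2)] I(1)[OF fH(3)]
      have 1: "I Y \<odot>\<^bsub>L\<^esub> ?l (FM H f) = ?l ?r \<odot>\<^bsub>L\<^esub> I X"
        using functor_Cmp[OF l Hf(1), of "tor_inc d1 (free_ob d2 Y)"] P1.seqs(3)[OF d1(1) o[OF fH(3)]]
          functor_Cmp[OF l P1.seqs(3)[OF d1(1) o[OF fH(2)]] r(1)] Hf(2) by (simp add: I_def H_def)
      have 2: "?l ?r \<odot>\<^bsub>L\<^esub> P X = P Y \<odot>\<^bsub>L\<^esub> ?l f"
        using functor_Cmp[OF l P2.seqs(4)[OF d2(1) fH(2)] r(1)] functor_Cmp[OF l fH(1) P2.seqs(4)[OF d2(1) fH(3)]] r(2)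
        by (simp add: P_def)
      have "B Y \<odot>\<^bsub>L\<^esub> ?l ?r = (B Y \<odot>\<^bsub>L\<^esub> (?l ?r \<odot>\<^bsub>L\<^esub> P X)) \<odot>\<^bsub>L\<^esub> B X"
        using bX bY(1) lf PI by (simp add: Hom_def)
      also have "\<dots> = (B Y \<odot>\<^bsub>L\<^esub> P Y) \<odot>\<^bsub>L\<^esub> (?l f \<odot>\<^bsub>L\<^esub> B X)"
        unfolding 2 using bX(1) bY(1) lf PI by (simp add: Hom_def)
      also have "\<dots> = ?l f \<odot>\<^bsub>L\<^esub> B X" unfolding bY(2) using bX(1) lf by (simp add: Hom_def)
      finally have 3: "B Y \<odot>\<^bsub>L\<^esub> ?l ?r = ?l f \<odot>\<^bsub>L\<^esub> B X" .
      have "a Y \<odot>\<^bsub>L\<^esub> ?l (FM H f) = B Y \<odot>\<^bsub>L\<^esub> (I Y \<odot>\<^bsub>L\<^esub> ?l (FM H f))"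
        unfolding a_def using bY(1) lf PI by (simp add: Hom_def)
      also have "\<dots> = (B Y \<odot>\<^bsub>L\<^esub> ?l ?r) \<odot>\<^bsub>L\<^esub> I X" unfolding 1 using bY(1) lf PI by (simp add: Hom_def)
      also have "\<dots> = ?l f \<odot>\<^bsub>L\<^esub> a X" unfolding 3 a_def using bX(1) lf PI by (simp add: Hom_def)
      finally show ?thesis using G(3)[OF f] by (simp add: J_def X_def Y_def)
    qed
    have JG: "is_functor L L (comp_functor J G)" by (rule is_functor_comp[OF G(1) J])
    have "a (Cod L f) \<odot>\<^bsub>L\<^esub> FM J (FM G f) = f \<odot>\<^bsub>L\<^esub> a (Dom L f)" if "f \<in> Ar L" for f
      by (rule localization_natural[where E = L and K = "comp_functor J G" and K' = id_functor and a = a and f = f,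
          OF W, folded L_def', unfolded comp_functor_simps id_functor_simps])
        (use L.category_axioms JG L.is_functor_id a(1) nat that in blast)+
    then show ?thesis
      using JG L.is_functor_id a unfolding nat_isomorphic_def comp_functor_simps id_functor_simps
      by (intro conjI exI[of _ a]) (auto simp: L_def')
  qed
  moreover have "\<forall>X \<in> Ob D. \<exists>Y \<in> Ob L. FO G Y = X"
    using onto G(2) by (auto simp: L_def')
  ultimately show ?thesis using G(1) J by blast
qed

text \<open>Naturality recovers \<open>f\<close> from \<open>J G f\<close> by conjugation with the
  components \<open>a X\<close> and \<open>a Y\<close>.\<close>

lemma equivalence_faithful:
  assumes n: "nat_isomorphic A A (comp_functor J G) id_functor" and A: "category A"
    and f: "f \<in> Hom A X Y" "g \<in> Hom A X Y" "FM G f = FM G g"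
  shows "f = g"
proof -
  interpret A: category A by fact
  obtain a where a: "\<And>X. X \<in> Ob A \<Longrightarrow> a X \<in> Hom A (FO J (FO G X)) X \<and> iso_arrow A (a X)"
    and nat: "\<And>f. f \<in> Ar A \<Longrightarrow> a (Cod A f) \<odot>\<^bsub>A\<^esub> FM J (FM G f) = f \<odot>\<^bsub>A\<^esub> a (Dom A f)"
    using n unfolding nat_isomorphic_def by auto
  have X: "X \<in> Ob A" using f A.Hom_Ob by blast
  have d: "Dom A f = X" "Cod A f = Y" "Dom A g = X" "Cod A g = Y" "f \<in> Ar A" "g \<in> Ar A" using f by (auto simp: Hom_def)
  have e: "f \<odot>\<^bsub>A\<^esub> a X = g \<odot>\<^bsub>A\<^esub> a X" using nat[OF d(5)] nat[OF d(6)] d f(3) by simp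
  obtain b where b: "b \<in> Hom A X (FO J (FO G X))" "a X \<odot>\<^bsub>A\<^esub> b = Ident A X"
    using A.iso_arrowE[of "a X" "FO J (FO G X)" X] a[OF X] by metis
  have "(f \<odot>\<^bsub>A\<^esub> a X) \<odot>\<^bsub>A\<^esub> b = f" "(g \<odot>\<^bsub>A\<^esub> a X) \<odot>\<^bsub>A\<^esub> b = g"
    using f(1,2) b a[OF X] by (auto simp: Hom_def)
  then show ?thesis using e by metis
qed

text \<open>The preimage of \<open>h\<close> is \<open>J h\<close> conjugated by the natural
  isomorphism. Naturality gives \<open>J G f = J h\<close>, and \<open>J\<close> is faithful by the
  other half of the equivalence.\<close>

lemma equivalence_full:
  assumes n: "nat_isomorphic A A (comp_functor J G) id_functor" and A: "category A"
    and n': "nat_isomorphic B B (comp_functor G J) id_functor" and B: "category B"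
    and G: "is_functor A B G" and J: "is_functor B A J"
    and o: "X \<in> Ob A" "Y \<in> Ob A" and h: "h \<in> Hom B (FO G X) (FO G Y)"
  shows "\<exists>f \<in> Hom A X Y. FM G f = h"
proof -
  interpret A: category A by fact
  obtain a where a: "\<And>X. X \<in> Ob A \<Longrightarrow> a X \<in> Hom A (FO J (FO G X)) X \<and> iso_arrow A (a X)"
    and nat: "\<And>f. f \<in> Ar A \<Longrightarrow> a (Cod A f) \<odot>\<^bsub>A\<^esub> FM J (FM G f) = f \<odot>\<^bsub>A\<^esub> a (Dom A f)"
    using n unfolding nat_isomorphic_def by auto
  obtain b where b: "b \<in> Hom A X (FO J (FO G X))" "b \<odot>\<^bsub>A\<^esub> a X = Ident A (FO J (FO G X))"
    using A.iso_arrowE[of "a X" "FO J (FO G X)" X] a[OF o(1)] by metis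
  have Jh: "FM J h \<in> Hom A (FO J (FO G X)) (FO J (FO G Y))" by (rule functor_Hom[OF J h])
  define f where "f = a Y \<odot>\<^bsub>A\<^esub> (FM J h \<odot>\<^bsub>A\<^esub> b)"
  have f: "f \<in> Hom A X Y" using b(1) Jh a[OF o(2)] by (auto simp: f_def Hom_def)
  have JGf: "FM J (FM G f) \<in> Hom A (FO J (FO G X)) (FO J (FO G Y))" by (rule functor_Hom[OF J functor_Hom[OF G f]])
  have "a Y \<odot>\<^bsub>A\<^esub> FM J (FM G f) = f \<odot>\<^bsub>A\<^esub> a X" using nat[of f] f by (simp add: Hom_def)
  also have "\<dots> = a Y \<odot>\<^bsub>A\<^esub> FM J h" using b Jh a[OF o(1)] a[OF o(2)] by (simp add: f_def Hom_def)
  finally have "FM J (FM G f) = FM J h"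
  proof (rule A.mono_cancel[OF A.iso_mono[OF conjunct2[OF a[OF o(2)]]]])
    have "Dom A (a Y) = FO J (FO G Y)" using a[OF o(2)] by (simp add: Hom_def)
    then show "FM J (FM G f) \<in> Hom A (FO J (FO G X)) (Dom A (a Y))" "FM J h \<in> Hom A (FO J (FO G X)) (Dom A (a Y))"
      using JGf Jh by simp_all
  qed
  then have "FM G f = h" using equivalence_faithful[OF n' B functor_Hom[OF G f] h] by blast
  then show ?thesis using f by blast
qed

section \<open>The category \<open>T\<^sub>1 \<inter> F\<^sub>2\<close> is quasi-abelian\<close>

text \<open>Phrased entirely in hom sets, the universal property can be compared between
  \<open>C\<close>, a full subcategory and a category mapping fully faithfully to it.\<close>

lemma is_kernel_Hom:
  assumes "f \<in> Hom C X Y" "k \<in> Hom C K X"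
  shows "is_kernel C f k \<longleftrightarrow> zero_arrow C (f \<odot>\<^bsub>C\<^esub> k) \<and>
    (\<forall>W h. h \<in> Hom C W X \<and> zero_arrow C (f \<odot>\<^bsub>C\<^esub> h) \<longrightarrow> (\<exists>!u. u \<in> Hom C W K \<and> k \<odot>\<^bsub>C\<^esub> u = h))"
proof -
  have d: "f \<in> Ar C" "k \<in> Ar C" "Dom C f = X" "Dom C k = K" "Cod C k = X" using assms by (auto simp: Hom_def)
  have h: "h \<in> Hom C W X \<longleftrightarrow> h \<in> Ar C \<and> Dom C h = W \<and> Cod C h = X" for h W by (simp add: Hom_def)
  show ?thesis unfolding is_kernel_def d h using d(1,2) by blast
qed

lemma is_cokernel_Hom:
  assumes "f \<in> Hom C X Y" "c \<in> Hom C Y Q"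
  shows "is_cokernel C f c \<longleftrightarrow> zero_arrow C (c \<odot>\<^bsub>C\<^esub> f) \<and>
    (\<forall>W h. h \<in> Hom C Y W \<and> zero_arrow C (h \<odot>\<^bsub>C\<^esub> f) \<longrightarrow> (\<exists>!u. u \<in> Hom C Q W \<and> u \<odot>\<^bsub>C\<^esub> c = h))"
  using is_kernel_Hom[of f "op_cat C" Y X c Q] assms by simp

context twin
begin

abbreviation "S \<equiv> T1 \<inter> F2"
abbreviation "D \<equiv> full_subcat C S"

lemma S_Ob: "X \<in> S \<Longrightarrow> X \<in> Ob C"
  using P1.T_Ob by blast

lemma D_Hom: "f \<in> Hom C X Y \<Longrightarrow> X \<in> S \<Longrightarrow> Y \<in> S \<Longrightarrow> f \<in> Hom D X Y"
  by simp

lemma zero_S: "zero_ob C \<in> S"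
  using P1.zero_T P2.zero_F zero_ob by blast

text \<open>A zero object of the subcategory has a single endomorphism, so its identity is the zero
  arrow of \<open>C\<close>.\<close>

lemma zero_object_D: "zero_object D Z \<longleftrightarrow> zero_object C Z \<and> Z \<in> S"
proof
  assume Z: "zero_object D Z"
  then have "\<exists>!f. f \<in> Hom C Z Z" and ZS: "Z \<in> S" "Z \<in> Ob C" by (auto simp: zero_object_def)
  then have "Ident C Z = z Z Z" using z_Hom Ident_Hom by metis
  then show "zero_object C Z \<and> Z \<in> S" using ZS zero_object_iff by blast
next
  assume "zero_object C Z \<and> Z \<in> S"
  then show "zero_object D Z" by (auto simp: zero_object_def)
qed

lemma zero_arrow_D: "zero_arrow D f \<longleftrightarrow> f \<in> Ar D \<and> zero_arrow C f"
proof
  assume "zero_arrow D f"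
  then show "f \<in> Ar D \<and> zero_arrow C f" unfolding zero_arrow_def zero_object_D by auto
next
  assume f: "f \<in> Ar D \<and> zero_arrow C f"
  define X Y where "X = Dom C f" and "Y = Cod C f"
  have o: "X \<in> S" "Y \<in> S" "X \<in> Ob C" "Y \<in> Ob C" "f = z X Y" using f zero_arrow_iff by (auto simp: X_def Y_def)
  have "f = z (zero_ob C) Y \<odot> z X (zero_ob C)" using o zero_ob by simp
  moreover have "z (zero_ob C) Y \<in> Hom D (zero_ob C) Y" "z X (zero_ob C) \<in> Hom D X (zero_ob C)"
    using o zero_ob zero_S z_Hom by auto
  moreover have "zero_object D (zero_ob C)" using zero_ob zero_S zero_object_D by blast
  ultimately show "zero_arrow D f"
    using f unfolding zero_arrow_def X_def Y_def by simp metis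
qed

lemma zero_arrow_D_Hom: "f \<in> Hom C X Y \<Longrightarrow> X \<in> S \<Longrightarrow> Y \<in> S \<Longrightarrow> zero_arrow D f \<longleftrightarrow> f = z X Y"
  using zero_arrow_D[of f] zero_arrow_Hom[of f X Y] by (simp add: Hom_def)

text \<open>The kernel \<open>K\<close> formed in \<open>C\<close> is in \<open>F2\<close> as a
  subobject of \<open>X\<close> but may fail to be in \<open>T1\<close>. Its torsion part
  \<open>A\<close> repairs this, and arrows from objects of \<open>T1\<close> into \<open>K\<close>
  factor through \<open>A\<close>.\<close>

lemma kernel_D_exists:
  assumes "f \<in> Ar D"
  shows "\<exists>k. is_kernel D f k"
proof -
  define X Y where "X = Dom C f" and "Y = Cod C f"
  have f: "f \<in> Hom C X Y" "X \<in> S" "Y \<in> S" using assms by (auto simp: X_def Y_def Hom_def)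
  obtain k where k: "is_kernel C f k" using has_kernel f by (auto simp: Hom_def)
  define K where "K = Dom C k"
  have kH: "k \<in> Hom C K X" "f \<odot> k = z K Y" using kernel_Hom[OF k f(1)] by (simp_all add: K_def)
  have o: "K \<in> Ob C" "Y \<in> Ob C" using kH f Hom_Ob by blast+
  obtain A B i p where s: "A \<in> T1" "B \<in> F1" "i \<in> Hom C A K" "p \<in> Hom C K B" "is_kernel C p i" "is_cokernel C i p"
    using P1.torsion_sequence[OF o(1)] .
  have iR: "i \<in> Rorth C T1" by (rule P1.sequence_orth(2)[OF s(5,6,3,4,1,2)])
  have ki: "k \<odot> i \<in> Hom C A X" using kH s by (auto simp: Hom_def)
  have mono: "mono_arrow C (k \<odot> i)"
  proof (rule monoI[OF ki])
    fix W x assume x: "x \<in> Hom C W A" "(k \<odot> i) \<odot> x = z W X"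
    then have "k \<odot> (i \<odot> x) = z W X" using kH(1) s(3) by (simp add: Hom_def)
    then have "i \<odot> x = z W K" using mono_Hom[OF kernel_mono[OF k] kH(1) Cmp_Hom[OF x(1) s(3)]] by blast
    then show "x = z W A" using mono_Hom[OF kernel_mono[OF s(5)] s(3) x(1)] by blast
  qed
  have A: "A \<in> S" using s(1) P2.F_sub[OF mono ki] f(2) by blast
  have fki: "f \<odot> (k \<odot> i) = z A Y"
    using kH(1) kH(2)[THEN Cmp_rewrite, of i] s(3) f(1) o by (simp add: Hom_def)
  have "is_kernel D f (k \<odot> i)"
    unfolding is_kernel_Hom[OF D_Hom[OF f] D_Hom[OF ki A f(2)]]
  proof (intro conjI allI impI)
    show "zero_arrow D (f \<odot>\<^bsub>D\<^esub> (k \<odot> i))"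
      using zero_arrow_D_Hom[OF Cmp_Hom[OF ki f(1)] A f(3)] fki by simp
    fix W h assume h: "h \<in> Hom D W X \<and> zero_arrow D (f \<odot>\<^bsub>D\<^esub> h)"
    then have hH: "h \<in> Hom C W X" "W \<in> S" by auto
    then have "f \<odot> h = z W Y" using h zero_arrow_D_Hom[OF Cmp_Hom[OF hH(1) f(1)] hH(2) f(3)] by simp
    then obtain u where u: "u \<in> Hom C W K" "k \<odot> u = h" using kernel_lift[OF k f(1) hH(1)] K_def by metis
    obtain v where v: "v \<in> Hom C W A" "i \<odot> v = u" using RorthE[OF iR s(3) _ u(1)] hH(2) by blast
    have "(k \<odot> i) \<odot> v = h" using u v kH(1) s(3) by (simp add: Hom_def)
    moreover have "y = v" if "y \<in> Hom C W A" "(k \<odot> i) \<odot> y = h" for y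
    proof (rule mono_cancel[OF mono, of _ _ W])
      show "(k \<odot> i) \<odot> y = (k \<odot> i) \<odot> v" using that(2) \<open>(k \<odot> i) \<odot> v = h\<close> by metis
    qed (use that(1) v(1) ki in \<open>simp_all add: Hom_def\<close>)
    ultimately have "\<exists>!u. u \<in> Hom C W A \<and> (k \<odot> i) \<odot> u = h" using v(1) by metis
    then show "\<exists>!u. u \<in> Hom D W A \<and> (k \<odot> i) \<odot>\<^bsub>D\<^esub> u = h"
      unfolding Hom_full_subcat full_subcat_simps using hH(2) A by blast
  qed
  then show ?thesis by blast
qed

lemma preabelian_D: "preabelian D pl z"
proof -
  have H: "Hom D X Y = Hom C X Y" if "X \<in> S" "Y \<in> S" for X Y using that by auto
  have "preadditive_with D pl z"
    unfolding preadditive_with_def using category_full_subcat pl_group pl_Cmp Cmp_pl H by simp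
  moreover have "\<exists>Z. zero_object D Z" using zero_object_D zero_S zero_ob by blast
  moreover have "\<exists>c. is_cokernel D f c" if "f \<in> Ar D" for f
    using twin.kernel_D_exists[OF twin_op, of f] that by (simp add: full_subcat_op Int_commute)
  moreover have "\<exists>B \<in> Ob D.
           \<exists>i \<in> Hom D X B. \<exists>j \<in> Hom D Y B. \<exists>p \<in> Hom D B X. \<exists>q \<in> Hom D B Y.
             p \<odot>\<^bsub>D\<^esub> i = Ident D X \<and> q \<odot>\<^bsub>D\<^esub> j = Ident D Y \<and>
             p \<odot>\<^bsub>D\<^esub> j = z Y X \<and> q \<odot>\<^bsub>D\<^esub> i = z X Y \<and>
             pl (i \<odot>\<^bsub>D\<^esub> p) (j \<odot>\<^bsub>D\<^esub> q) = Ident D B" if X: "X \<in> Ob D" and Y: "Y \<in> Ob D" for X Y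
  proof -
    have XY: "X \<in> S" "Y \<in> S" "X \<in> Ob C" "Y \<in> Ob C" using X Y by auto
    obtain B i j p q where B: "B \<in> Ob C" "i \<in> Hom C X B" "j \<in> Hom C Y B" "p \<in> Hom C B X" "q \<in> Hom C B Y"
      "p \<odot> i = Ident C X" "q \<odot> j = Ident C Y" "p \<odot> j = z Y X" "q \<odot> i = z X Y"
      "pl (i \<odot> p) (j \<odot> q) = Ident C B" using has_biproduct[OF XY(3,4)] by blast
    have ip: "i \<odot> p \<in> Hom C B B" "j \<odot> q \<in> Hom C B B" using B by (auto simp: Hom_def)
    \<comment> \<open>An arrow out of the biproduct vanishes as soon as its restrictions along
      \<open>i\<close> and \<open>j\<close> do; those go from \<open>T1\<close> to
      \<open>F1\<close>.\<close>
    have "B \<in> T1"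
    proof (rule P1.T_I[OF B(1)])
      fix V f assume f: "V \<in> F1" "f \<in> Hom C B V"
      have V: "V \<in> Ob C" using f Hom_Ob by blast
      have "f \<odot> i = z X V" "f \<odot> j = z Y V" using P1.Hom_T_F XY f Cmp_Hom B by blast+
      then have "(f \<odot> i) \<odot> p = z B V" "(f \<odot> j) \<odot> q = z B V"
        using B(4,5) V by (simp_all add: Hom_def)
      then have "f \<odot> (i \<odot> p) = z B V" "f \<odot> (j \<odot> q) = z B V"
        using Cmp_assoc[OF B(4,2) f(2)] Cmp_assoc[OF B(5,3) f(2)] by simp_all
      then have "f \<odot> pl (i \<odot> p) (j \<odot> q) = z B V"
        using Cmp_pl[OF ip f(2)] pl_z[OF z_Hom[OF B(1) V]] by simp
      then show "f = z B V" using f B(10) Ident_right by simp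
    qed
    moreover have "B \<in> F2"
    proof (rule P2.F_I[OF B(1)])
      fix V f assume f: "V \<in> T2" "f \<in> Hom C V B"
      have V: "V \<in> Ob C" using f Hom_Ob by blast
      have "p \<odot> f = z V X" "q \<odot> f = z V Y" using P2.Hom_T_F XY f Cmp_Hom B by blast+
      then have "i \<odot> (p \<odot> f) = z V B" "j \<odot> (q \<odot> f) = z V B"
        using B(2,3) V by (simp_all add: Hom_def)
      then have "(i \<odot> p) \<odot> f = z V B" "(j \<odot> q) \<odot> f = z V B"
        using Cmp_assoc[OF f(2) B(4,2)] Cmp_assoc[OF f(2) B(5,3)] by simp_all
      then have "pl (i \<odot> p) (j \<odot> q) \<odot> f = z V B"
        using pl_Cmp[OF f(2) ip] pl_z[OF z_Hom[OF V B(1)]] by simp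
      then show "f = z V B" using f B(10) Ident_left by simp
    qed
    ultimately show ?thesis using B XY
      by (intro bexI[of _ B] bexI[of _ i] bexI[of _ j] bexI[of _ p] bexI[of _ q]) simp_all
  qed
  ultimately show ?thesis
    using category_full_subcat kernel_D_exists by (intro preabelian.intro preabelian_axioms.intro) blast+
qed

text \<open>If the kernel is in \<open>T1\<close>, it is also in \<open>F2\<close> as a subobject of
  \<open>X\<close>, so the cokernel presentation of \<open>f\<close> takes place in
  \<open>D\<close>. Conversely, a cokernel in \<open>D\<close> is the torsion-free quotient
  \<open>R\<close> of the cokernel \<open>Q\<close> formed in \<open>C\<close>. Thus
  \<open>f\<close> is a composite of two epimorphisms up to isomorphism, and its kernel is built
  from the image of \<open>h\<close> and the torsion part of \<open>Q\<close>.\<close>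

lemma strict_epi_D:
  assumes f: "f \<in> Hom C X Y" "X \<in> S" "Y \<in> S"
  shows "(\<exists>h. is_cokernel D h f) \<longleftrightarrow> epi_arrow C f \<and> (\<exists>k. is_kernel C f k \<and> Dom C k \<in> T1)"
proof
  assume "epi_arrow C f \<and> (\<exists>k. is_kernel C f k \<and> Dom C k \<in> T1)"
  then obtain k where k: "epi_arrow C f" "is_kernel C f k" "Dom C k \<in> T1" by blast
  define K where "K = Dom C k"
  have kH: "k \<in> Hom C K X" using kernel_Hom[OF k(2) f(1)] by (simp add: K_def)
  have K: "K \<in> S" using k(3) P2.F_sub[OF kernel_mono[OF k(2)] kH] f(2) K_def by blast
  have c: "is_cokernel C k f" by (rule epi_cokernel_of_kernel[OF k(1,2)])
  have "is_cokernel D k f"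
    unfolding is_cokernel_Hom[OF D_Hom[OF kH K f(2)] D_Hom[OF f]]
  proof (intro conjI allI impI)
    show "zero_arrow D (f \<odot>\<^bsub>D\<^esub> k)"
      using zero_arrow_D_Hom[OF Cmp_Hom[OF kH f(1)] K f(3)] cokernel_Hom(2)[OF c kH] f(1) by (simp add: Hom_def)
    fix W h assume h: "h \<in> Hom D X W \<and> zero_arrow D (h \<odot>\<^bsub>D\<^esub> k)"
    then have hH: "h \<in> Hom C X W" "W \<in> S" by auto
    then have "zero_arrow C (h \<odot> k)" using h by (simp add: zero_arrow_D)
    then show "\<exists>!u. u \<in> Hom D Y W \<and> u \<odot>\<^bsub>D\<^esub> f = h"
      using c is_cokernel_Hom[OF kH f(1)] hH f(3) by simp
  qed
  then show "\<exists>h. is_cokernel D h f" by blast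
next
  interpret DD: preabelian D pl z by (rule preabelian_D)
  assume "\<exists>h. is_cokernel D h f"
  then obtain h where h: "is_cokernel D h f" by blast
  define W where "W = Dom C h"
  have hH: "h \<in> Hom C W X" "W \<in> S" using h f(1) by (auto simp: is_cokernel_def Hom_def W_def)
  have hD: "h \<in> Hom D W X" using hH f by simp
  have o: "X \<in> Ob C" "Y \<in> Ob C" "W \<in> Ob C" using f(1) hH Hom_Ob by auto
  have fh: "f \<odot> h = z W Y" using DD.cokernel_Hom(2)[OF h hD] f(1) by (simp add: Hom_def)
  obtain c where c: "is_cokernel C h c" using has_cokernel hH by (auto simp: Hom_def)
  define Q where "Q = Cod C c"
  have cH: "c \<in> Hom C X Q" "c \<odot> h = z W Q" using cokernel_Hom[OF c hH(1)] by (auto simp: Q_def)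
  have cE: "epi_arrow C c" by (rule cokernel_epi[OF c])
  have Q: "Q \<in> Ob C" "Q \<in> T1" using cH Hom_Ob P1.T_quotient[OF cE cH(1)] f by blast+
  obtain A R i p where s: "A \<in> T2" "R \<in> F2" "i \<in> Hom C A Q" "p \<in> Hom C Q R" "is_kernel C p i" "is_cokernel C i p"
    using P2.torsion_sequence[OF Q(1)] .
  have pL: "p \<in> Lorth C F2" by (rule P2.sequence_orth(1)[OF s(5,6,3,4,1,2)])
  have pE: "epi_arrow C p" by (rule cokernel_epi[OF s(6)])
  have R: "R \<in> S" "R \<in> Ob C" using P1.T_quotient[OF pE s(4) Q(2)] s(2) P2.F_Ob by blast+
  have pc: "p \<odot> c \<in> Hom C X R" using s cH by (auto simp: Hom_def)
  have "(p \<odot> c) \<odot> h = z W R" using s(4) cH hH(1) R(2) o by (simp add: Hom_def)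
  moreover have "Cod C f = Y" using f(1) by (simp add: Hom_def)
  ultimately obtain g where g: "g \<in> Hom C Y R" "g \<odot> f = p \<odot> c"
    using DD.cokernel_lift[OF h hD D_Hom[OF pc f(2) R(1)]] by auto
  obtain m where m: "m \<in> Hom C Q Y" "m \<odot> c = f" using cokernel_lift[OF c hH(1) f(1) fh] Q_def by metis
  have "Y \<in> F2" using f by blast
  then obtain n where n: "n \<in> Hom C R Y" "n \<odot> p = m" using LorthE[OF pL s(4) _ m(1)] by blast
  have npc: "n \<odot> (p \<odot> c) = f" using n(1) n(2)[THEN Cmp_rewrite, of c] s(4) cH m by (simp add: Hom_def)
  \<comment> \<open>\<open>n\<close> and \<open>g\<close> are mutually inverse, so \<open>Y\<close>
    is identified with \<open>R\<close> and \<open>f\<close> with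
    \<open>p \<odot> c\<close>.\<close>
  have ng: "n \<odot> g = Ident C Y"
  proof (rule DD.epi_cancel[OF DD.cokernel_epi[OF h], of _ _ Y])
    show "(n \<odot> g) \<odot>\<^bsub>D\<^esub> f = Ident C Y \<odot>\<^bsub>D\<^esub> f" using n g f(1) npc by (simp add: Hom_def)
  qed (use n g f o in \<open>auto simp: Hom_def\<close>)
  have gn: "g \<odot> n = Ident C R"
  proof (rule epi_cancel[OF pE, of _ _ R])
    show "(g \<odot> n) \<odot> p = Ident C R \<odot> p"
    proof (rule epi_cancel[OF cE, of _ _ R])
      have "((g \<odot> n) \<odot> p) \<odot> c = g \<odot> (n \<odot> (p \<odot> c))" using g(1) n(1) s(4) cH(1) by (simp add: Hom_def)
      also have "\<dots> = (Ident C R \<odot> p) \<odot> c" unfolding npc using g s(4) cH(1) by (simp add: Hom_def)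
      finally show "((g \<odot> n) \<odot> p) \<odot> c = (Ident C R \<odot> p) \<odot> c" .
    qed (use g(1) n(1) s(4) cH(1) R(2) in \<open>auto simp: Hom_def\<close>)
  qed (use g(1) n(1) s(4) R(2) in \<open>auto simp: Hom_def\<close>)
  have fE: "epi_arrow C f"
  proof (rule epiI[OF f(1)])
    fix V x assume x: "x \<in> Hom C Y V" "x \<odot> f = z X V"
    have V: "V \<in> Ob C" using x Hom_Ob by blast
    have xnp: "(x \<odot> n) \<odot> p \<in> Hom C Q V" "x \<odot> n \<in> Hom C R V" using x n s(4) by (auto simp: Hom_def)
    have "((x \<odot> n) \<odot> p) \<odot> c = x \<odot> (n \<odot> (p \<odot> c))" using x(1) n(1) s(4) cH(1) by (simp add: Hom_def)
    then have "((x \<odot> n) \<odot> p) \<odot> c = z X V" using npc x(2) by simp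
    then have "(x \<odot> n) \<odot> p = z Q V" using epi_Hom[OF cE cH(1) xnp(1)] by blast
    then have "x \<odot> n = z R V" using epi_Hom[OF pE s(4) xnp(2)] by blast
    then have "(x \<odot> n) \<odot> g = z Y V" using g(1) V by (simp add: Hom_def)
    then show "x = z Y V" using x(1) n(1) g(1) ng by (simp add: Hom_def)
  qed
  obtain k where k: "is_kernel C f k" using has_kernel f by (auto simp: Hom_def)
  define K where "K = Dom C k"
  have kH: "k \<in> Hom C K X" "f \<odot> k = z K Y" using kernel_Hom[OF k f(1)] by (auto simp: K_def)
  have K: "K \<in> Ob C" using kH Hom_Ob by blast
  text \<open>\<open>K\<close> is a retract of the pullback of the torsion part of \<open>Q\<close>, which is an extension of objects of \<open>T1\<close>.\<close>
  obtain P a b where P: "a \<in> Hom C P X" "b \<in> Hom C P A" "is_pullback C c i a b" using pullback_exists[OF cH(1) s(3)] .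
  obtain kc where kc: "is_kernel C c kc" using has_kernel cH by (auto simp: Hom_def)
  define Kc where "Kc = Dom C kc"
  obtain e where e: "e \<in> Hom C W Kc" "kc \<odot> e = h" using kernel_lift[OF kc cH(1) hH(1) cH(2)] Kc_def by metis
  \<comment> \<open>The kernel of \<open>c\<close> is the image of \<open>h\<close>, hence a
    quotient of \<open>W\<close>, and so lies in \<open>T1\<close>.\<close>
  have "epi_arrow C e" using image_epi[OF hH(1) c kc] e Kc_def by blast
  then have Kc: "Kc \<in> T1" using P1.T_quotient e(1) hH(2) by blast
  obtain k0 where k0: "k0 \<in> Hom C Kc (Dom C a)" "is_kernel C b k0"
    using pullback_kernel[OF P(3) kc] Kc_def by metis
  have bE: "epi_arrow C b" by (rule pullback_epi[OF P(3) cE])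
  have "Dom C k0 \<in> T1" "A \<in> T1" using k0(1) Kc s(1) T2_T1 by (auto simp: Hom_def)
  then have PT: "P \<in> T1" using P1.T_extension[OF bE P(2) k0(2)] by blast
  have ca: "c \<odot> a = i \<odot> b" using P(3) by (simp add: is_pullback_def)
  have "f \<odot> a = n \<odot> (p \<odot> (c \<odot> a))" using npc[THEN Cmp_rewrite, of a] n(1) s(4) cH(1) P(1) by (simp add: Hom_def)
  also have "\<dots> = n \<odot> ((p \<odot> i) \<odot> b)" unfolding ca using n(1) s(3,4) P(2) by (simp add: Hom_def)
  also have "\<dots> = z P Y" unfolding kernel_Hom(2)[OF s(5,4)] using s(3) P(2) n(1) R(2) Hom_Ob(1)[OF P(2)] by (simp add: Hom_def)
  finally obtain t where t: "t \<in> Hom C P K" "k \<odot> t = a" using kernel_lift[OF k f(1) P(1)] K_def by metis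
  have "p \<odot> (c \<odot> k) = (g \<odot> f) \<odot> k" unfolding g(2) using s(4) cH(1) kH(1) by (simp add: Hom_def)
  also have "\<dots> = z K R" using g(1) f(1) kH R(2) K by (simp add: Hom_def)
  finally obtain y where y: "y \<in> Hom C K A" "i \<odot> y = c \<odot> k"
    using kernel_lift[OF s(5,4) Cmp_Hom[OF kH(1) cH(1)]] s(3) by (auto simp: Hom_def)
  obtain w where w: "w \<in> Hom C K P" "a \<odot> w = k"
  proof (rule pullback_lift[OF P(3), of k K y])
    show "k \<in> Hom C K (Dom C c)" "y \<in> Hom C K (Dom C i)" "c \<odot> k = i \<odot> y"
      using kH(1) y cH(1) s(3) by (simp_all add: Hom_def)
    fix w assume "w \<in> Hom C K (Dom C a)" "a \<odot> w = k"
    then show thesis using that[of w] P(1) by (simp add: Hom_def)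
  qed
  have tw: "t \<odot> w = Ident C K"
  proof (rule mono_cancel[OF kernel_mono[OF k], of _ _ K])
    show "k \<odot> (t \<odot> w) = k \<odot> Ident C K" using t(1) t(2)[THEN Cmp_rewrite, of w] w kH(1) by (simp add: Hom_def)
  qed (use t(1) w(1) K kH(1) in \<open>auto simp: Hom_def\<close>)
  have "epi_arrow C t"
  proof (rule epiI[OF t(1)])
    fix V x assume x: "x \<in> Hom C K V" "x \<odot> t = z P V"
    have "x = (x \<odot> t) \<odot> w" using x(1) t(1) w(1) tw by (simp add: Hom_def)
    then show "x = z K V" unfolding x(2) using w(1) Hom_Ob(2)[OF x(1)] by (simp add: Hom_def)
  qed
  then have "K \<in> T1" using P1.T_quotient t(1) PT by blast
  then show "epi_arrow C f \<and> (\<exists>k. is_kernel C f k \<and> Dom C k \<in> T1)" using fE k K_def by blast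
qed

text \<open>The pullback \<open>P0\<close> formed in \<open>C\<close> already lies in
  \<open>T1 \<inter> F2\<close>: it is an extension of \<open>Z\<close> by the kernel of
  \<open>f\<close>, and arrows into it from \<open>T2\<close> have zero components in
  \<open>X\<close> and \<open>Z\<close>. Hence \<open>P\<close> is isomorphic to \<open>P0\<close>,
  where epimorphisms are stable and the kernel is that of \<open>f\<close>;
  \<open>strict_epi_D\<close> translates this back.\<close>

lemma strict_epi_pullback_D:
  assumes P: "is_pullback D f g p q" and h: "\<exists>h. is_cokernel D h f"
  shows "\<exists>h. is_cokernel D h q"
proof -
  interpret DD: category D by (rule category_full_subcat)
  define X Y Z P where "X = Dom C f" and "Y = Cod C f" and "Z = Dom C g" and "P = Dom C p"
  have h: "f \<in> Hom C X Y" "g \<in> Hom C Z Y" "p \<in> Hom C P X" "q \<in> Hom C P Z" and e: "f \<odot> p = g \<odot> q"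
    and o: "X \<in> S" "Y \<in> S" "Z \<in> S" "P \<in> S"
    and f: "epi_arrow C f \<and> (\<exists>k. is_kernel C f k \<and> Dom C k \<in> T1)"
    using assms strict_epi_D[of f X Y] by (auto simp: is_pullback_def Hom_def X_def Y_def Z_def P_def)
  then obtain k where k: "is_kernel C f k" "Dom C k \<in> T1" by blast
  obtain P0 p0 q0 where P0: "p0 \<in> Hom C P0 X" "q0 \<in> Hom C P0 Z" "is_pullback C f g p0 q0"
    using pullback_exists[OF h(1,2)] .
  have q0: "epi_arrow C q0" using pullback_epi[OF P0(3)] f by blast
  obtain k0 where k0: "k0 \<in> Hom C (Dom C k) (Dom C p0)" "is_kernel C q0 k0" using pullback_kernel[OF P0(3) k(1)] .
  have Dk0: "Dom C k0 \<in> T1" using k0 k by (simp add: Hom_def)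
  have Dp0: "Dom C p0 = P0" using P0 by (simp add: Hom_def)
  have P0o: "P0 \<in> Ob C" using P0 Hom_Ob by blast
  have "P0 \<in> T1" using P1.T_extension[OF q0 P0(2) k0(2) Dk0] o by blast
  moreover have "P0 \<in> F2"
  proof (rule P2.F_I[OF P0o])
    fix V u assume u: "V \<in> T2" "u \<in> Hom C V P0"
    have V: "V \<in> Ob C" using u Hom_Ob by blast
    have X: "X \<in> F2" "Z \<in> F2" using o by auto
    have "p0 \<odot> u = z V X" "q0 \<odot> u = z V Z"
      using P2.Hom_T_F[OF u(1) X(1) Cmp_Hom[OF u(2) P0(1)]] P2.Hom_T_F[OF u(1) X(2) Cmp_Hom[OF u(2) P0(2)]] by auto
    then have "p0 \<odot> u = p0 \<odot> z V P0" "q0 \<odot> u = q0 \<odot> z V P0" using P0(1,2) V by (auto simp: Hom_def)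
    then show "u = z V P0" using pullback_unique[OF P0(3), of u V "z V P0"] u z_Hom[OF V P0o] Dp0 by simp
  qed
  ultimately have P0S: "P0 \<in> S" by blast
  have d: "Dom C f = X" "Dom C g = Z" "Dom C p = P" using h by (simp_all add: Hom_def)
  obtain s where s: "s \<in> Hom C P P0" "p0 \<odot> s = p" "q0 \<odot> s = q"
    using pullback_lift[OF P0(3), of p P q] h e d Dp0 by metis
  have "f \<odot> p0 = g \<odot> q0" using P0(3) by (simp add: is_pullback_def)
  then obtain w where w: "w \<in> Hom C P0 P" "p \<odot> w = p0" "q \<odot> w = q0"
    using DD.pullback_lift[OF P, of p0 P0 q0] P0(1,2) P0S o d by auto
  have ws: "w \<odot> s = Ident C P"
  proof (rule DD.pullback_unique[OF P, of _ P])
    show "p \<odot>\<^bsub>D\<^esub> (w \<odot> s) = p \<odot>\<^bsub>D\<^esub> Ident C P" "q \<odot>\<^bsub>D\<^esub> (w \<odot> s) = q \<odot>\<^bsub>D\<^esub> Ident C P"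
      using h(3,4) w(1) w(2,3)[THEN Cmp_rewrite, of s] s by (simp_all add: Hom_def)
    show "w \<odot> s \<in> Hom D P (Dom D p)" "Ident C P \<in> Hom D P (Dom D p)"
      using w(1) s(1) o S_Ob d Ident_Hom[of P] by (auto simp: Hom_def)
  qed
  have "epi_arrow C q"
  proof (rule epiI[OF h(4)])
    fix V x assume x: "x \<in> Hom C Z V" "x \<odot> q = z P V"
    have "x \<odot> q0 = (x \<odot> q) \<odot> w" using x(1) h(4) w by (auto simp: Hom_def)
    also have "\<dots> = z P0 V" unfolding x(2) using w(1) Hom_Ob(2)[OF x(1)] by (simp add: Hom_def)
    finally show "x = z Z V" using epi_Hom[OF q0 P0(2) x(1)] by blast
  qed
  moreover have "is_kernel C q (w \<odot> k0)"
  proof -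
    define K where "K = Dom C k0"
    have kH: "k0 \<in> Hom C K P0" "q0 \<odot> k0 = z K Z" using kernel_Hom[OF k0(2) P0(2)] by (auto simp: K_def)
    have wk: "w \<odot> k0 \<in> Hom C K P" using w kH by (auto simp: Hom_def)
    have qw: "q0 \<odot> (s \<odot> x) = q \<odot> x" if "x \<in> Hom C V P" for x V
      using P0(2) s(1) s(3)[THEN Cmp_rewrite, of x] that by (simp add: Hom_def)
    have wsx: "w \<odot> (s \<odot> x) = x" if "x \<in> Hom C V P" for x V
      using w(1) s(1) ws[THEN Cmp_rewrite, of x] that by (simp add: Hom_def)
    \<comment> \<open>Together with \<open>ws\<close> this makes \<open>s\<close> and
      \<open>w\<close> inverse isomorphisms, along which the kernel \<open>k0\<close> of
      \<open>q0\<close> is carried to a kernel of \<open>q\<close>.\<close>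
    have sw: "s \<odot> w = Ident C P0"
    proof (rule pullback_unique[OF P0(3), of _ P0])
      show "p0 \<odot> (s \<odot> w) = p0 \<odot> Ident C P0" "q0 \<odot> (s \<odot> w) = q0 \<odot> Ident C P0"
        using P0(1,2) s(1) s(2,3)[THEN Cmp_rewrite, of w] w by (simp_all add: Hom_def)
    qed (use s(1) w(1) Dp0 P0o in \<open>auto simp: Hom_def\<close>)
    show ?thesis
    proof (rule kernelI[OF h(4) wk])
      show "q \<odot> (w \<odot> k0) = z K Z" using h(4) w(1) w(3)[THEN Cmp_rewrite, of k0] kH by (simp add: Hom_def)
      show "mono_arrow C (w \<odot> k0)"
      proof (rule monoI[OF wk])
        fix V x assume x: "x \<in> Hom C V K" "(w \<odot> k0) \<odot> x = z V P"
        have "k0 \<odot> x = s \<odot> ((w \<odot> k0) \<odot> x)"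
          using sw[THEN Cmp_rewrite, of "k0 \<odot> x"] s(1) w(1) kH(1) x(1) by (simp add: Hom_def)
        also have "\<dots> = z V P0" unfolding x(2) using s(1) Hom_Ob(1)[OF x(1)] by (simp add: Hom_def)
        finally show "x = z V K" using mono_Hom[OF kernel_mono[OF k0(2)] kH(1) x(1)] by blast
      qed
      fix V x assume x: "x \<in> Hom C V P" "q \<odot> x = z V Z"
      then have "q0 \<odot> (s \<odot> x) = z V Z" using qw by simp
      then obtain u where u: "u \<in> Hom C V K" "k0 \<odot> u = s \<odot> x"
        using kernel_lift[OF k0(2) P0(2) Cmp_Hom[OF x(1) s(1)]] K_def by metis
      have "(w \<odot> k0) \<odot> u = x" using wsx[OF x(1)] u w(1) kH(1) by (simp add: Hom_def)
      then show "\<exists>u \<in> Hom C V K. (w \<odot> k0) \<odot> u = x" using u by blast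
    qed
  qed
  moreover have "Dom C (w \<odot> k0) \<in> T1" using w(1) k0(1) Dk0 Dp0 by (auto simp: Hom_def)
  ultimately show ?thesis using strict_epi_D[OF h(4) o(4,3)] by blast
qed

text \<open>The dual twin pair has the same intersection of classes and the opposite subcategory, so
  stability of strict monomorphisms under pushout is the pullback statement applied to it.\<close>

lemma quasi_abelian_D: "quasi_abelian_category D"
proof -
  have "pre_abelian_category D" using preabelian_D pre_abelian_category_iff by blast
  moreover have "\<exists>h. is_kernel D h j" if "is_pushout D f g i j" "\<exists>h. is_kernel D h f" for f g i j
    using twin.strict_epi_pullback_D[OF twin_op, of f g i j] that by (simp add: full_subcat_op Int_commute)
  ultimately show ?thesis using strict_epi_pullback_D unfolding quasi_abelian_category_def by blast
qed

end

section \<open>Transfer along a fully faithful functor that is surjective on objects\<close>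

text \<open>Surjectivity is meant strictly: kernels, biproducts and test objects of \<open>D\<close>
  are images of objects of \<open>A\<close>, and their arrows lift by fullness.\<close>

locale fully_faithful = A: category A + D: category D
  for A :: "('o, 'm) cat" and D :: "('p, 'n) cat" +
  fixes G :: "('o, 'm, 'p, 'n) ftor"
  assumes G: "is_functor A D G"
    and faithful: "f \<in> Hom A X Y \<Longrightarrow> g \<in> Hom A X Y \<Longrightarrow> FM G f = FM G g \<Longrightarrow> f = g"
    and full: "X \<in> Ob A \<Longrightarrow> Y \<in> Ob A \<Longrightarrow> h \<in> Hom D (FO G X) (FO G Y) \<Longrightarrow> \<exists>f \<in> Hom A X Y. FM G f = h"
    and onto: "V \<in> Ob D \<Longrightarrow> \<exists>X \<in> Ob A. FO G X = V"
begin

lemmas G_Hom = functor_Hom[OF G] and G_Ob = functor_Ob[OF G] and G_Ident = functor_Ident[OF G]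
  and G_Cmp = functor_Cmp[OF G]

lemma fully_faithful_op: "fully_faithful (op_cat A) (op_cat D) G"
proof -
  have "is_functor (op_cat A) (op_cat D) G" using G unfolding is_functor_def by simp
  moreover have "f = g" if "f \<in> Hom (op_cat A) X Y" "g \<in> Hom (op_cat A) X Y" "FM G f = FM G g" for f g X Y
    using faithful[of f Y X g] that by simp
  moreover have "\<exists>f \<in> Hom (op_cat A) X Y. FM G f = h"
    if "X \<in> Ob (op_cat A)" "Y \<in> Ob (op_cat A)" "h \<in> Hom (op_cat D) (FO G X) (FO G Y)" for X Y h
    using full[of Y X h] that by simp
  moreover have "\<exists>X \<in> Ob (op_cat A). FO G X = V" if "V \<in> Ob (op_cat D)" for V using onto that by simp
  ultimately show ?thesis
    using A.category_op D.category_op by (intro fully_faithful.intro fully_faithful_axioms.intro) blast+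
qed

lemma lift_unique:
  assumes "X \<in> Ob A" "Y \<in> Ob A" "h \<in> Hom D (FO G X) (FO G Y)"
  shows "\<exists>!f. f \<in> Hom A X Y \<and> FM G f = h"
  using full[OF assms] faithful by metis

text \<open>Universal properties are assertions of unique existence in a hom set; they pass along
  the bijection induced by \<open>G\<close> once the conditions correspond.\<close>

lemma ex1_Hom_transfer:
  assumes "X \<in> Ob A" "Y \<in> Ob A"
    and "\<And>f. f \<in> Hom A X Y \<Longrightarrow> Q (FM G f) \<longleftrightarrow> P f"
  shows "(\<exists>!f. f \<in> Hom A X Y \<and> P f) \<longleftrightarrow> (\<exists>!h. h \<in> Hom D (FO G X) (FO G Y) \<and> Q h)"
proof
  assume "\<exists>!f. f \<in> Hom A X Y \<and> P f"
  then obtain f where f: "f \<in> Hom A X Y" "P f" "\<And>g. g \<in> Hom A X Y \<Longrightarrow> P g \<Longrightarrow> g = f" by blast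
  show "\<exists>!h. h \<in> Hom D (FO G X) (FO G Y) \<and> Q h"
  proof (rule ex1I[of _ "FM G f"])
    show "FM G f \<in> Hom D (FO G X) (FO G Y) \<and> Q (FM G f)" using f assms(3) G_Hom by blast
    fix h assume h: "h \<in> Hom D (FO G X) (FO G Y) \<and> Q h"
    then obtain g where "g \<in> Hom A X Y" "FM G g = h" using full[OF assms(1,2)] by blast
    then show "h = FM G f" using f(3) assms(3) h by metis
  qed
next
  assume "\<exists>!h. h \<in> Hom D (FO G X) (FO G Y) \<and> Q h"
  then obtain h where h: "h \<in> Hom D (FO G X) (FO G Y)" "Q h" "\<And>k. k \<in> Hom D (FO G X) (FO G Y) \<Longrightarrow> Q k \<Longrightarrow> k = h"
    by blast
  obtain f where f: "f \<in> Hom A X Y" "FM G f = h" using full[OF assms(1,2) h(1)] by blast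
  show "\<exists>!f. f \<in> Hom A X Y \<and> P f"
  proof (rule ex1I[of _ f])
    show "f \<in> Hom A X Y \<and> P f" using f h assms(3) by blast
    fix g assume "g \<in> Hom A X Y \<and> P g"
    then show "g = f" using faithful[OF _ f(1)] h(3) assms(3) G_Hom f(2) by metis
  qed
qed

lemma zero_object_G:
  assumes X: "X \<in> Ob A"
  shows "zero_object A X \<longleftrightarrow> zero_object D (FO G X)"
proof -
  have "(\<exists>!f. f \<in> Hom A V W) \<longleftrightarrow> (\<exists>!h. h \<in> Hom D (FO G V) (FO G W))" if "V \<in> Ob A" "W \<in> Ob A" for V W
    using ex1_Hom_transfer[OF that, of "\<lambda>_. True" "\<lambda>_. True"] by simp
  moreover have all: "(\<forall>Y \<in> Ob A. Q (FO G Y)) \<longleftrightarrow> (\<forall>V \<in> Ob D. Q V)" for Q using onto G_Ob by metis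
  ultimately have "zero_object A X \<longleftrightarrow> (\<forall>Y \<in> Ob A. (\<exists>!h. h \<in> Hom D (FO G X) (FO G Y)) \<and> (\<exists>!h. h \<in> Hom D (FO G Y) (FO G X)))"
    using X unfolding zero_object_def by simp
  also have "\<dots> \<longleftrightarrow> (\<forall>V \<in> Ob D. (\<exists>!h. h \<in> Hom D (FO G X) V) \<and> (\<exists>!h. h \<in> Hom D V (FO G X)))"
    using all[of "\<lambda>V. (\<exists>!h. h \<in> Hom D (FO G X) V) \<and> (\<exists>!h. h \<in> Hom D V (FO G X))"] by simp
  finally show ?thesis using G_Ob[OF X] unfolding zero_object_def by simp
qed

lemma zero_arrow_G:
  assumes f: "f \<in> Hom A X Y"
  shows "zero_arrow A f \<longleftrightarrow> zero_arrow D (FM G f)"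
proof
  have d: "Dom A f = X" "Cod A f = Y" "f \<in> Ar A" "FM G f \<in> Ar D" "Dom D (FM G f) = FO G X" "Cod D (FM G f) = FO G Y"
    using f G_Hom[OF f] by (auto simp: Hom_def)
  {
    assume "zero_arrow A f"
    then obtain Z g h where z: "zero_object A Z" "g \<in> Hom A X Z" "h \<in> Hom A Z Y" "f = h \<odot>\<^bsub>A\<^esub> g"
      unfolding zero_arrow_def d by blast
    then have "zero_object D (FO G Z)" using zero_object_G A.Hom_Ob by blast
    then show "zero_arrow D (FM G f)"
      using G_Hom[OF z(2)] G_Hom[OF z(3)] G_Cmp[OF z(2,3)] z(4) d unfolding zero_arrow_def by auto
  next
    assume "zero_arrow D (FM G f)"
    then obtain Z g h where z: "zero_object D Z" "g \<in> Hom D (FO G X) Z" "h \<in> Hom D Z (FO G Y)" "FM G f = h \<odot>\<^bsub>D\<^esub> g"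
      unfolding zero_arrow_def d by blast
    then obtain V where V: "V \<in> Ob A" "FO G V = Z" using onto unfolding zero_object_def by metis
    have XY: "X \<in> Ob A" "Y \<in> Ob A" using f A.Hom_Ob by auto
    obtain g' where g': "g' \<in> Hom A X V" "FM G g' = g" using full[OF XY(1) V(1)] z(2) V(2) by blast
    obtain h' where h': "h' \<in> Hom A V Y" "FM G h' = h" using full[OF V(1) XY(2)] z(3) V(2) by blast
    have "f = h' \<odot>\<^bsub>A\<^esub> g'"
      by (rule faithful[OF f A.Cmp_Hom[OF g'(1) h'(1)]]) (use G_Cmp[OF g'(1) h'(1)] g' h' z(4) in simp)
    moreover have "zero_object A V" using zero_object_G[OF V(1)] V(2) z(1) by simp
    ultimately show "zero_arrow A f" using g'(1) h'(1) d unfolding zero_arrow_def by auto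
  }
qed

text \<open>Every test arrow of \<open>D\<close> starts at the image of an object of
  \<open>A\<close> and lifts to \<open>A\<close>, so testing in either category amounts to the
  same.\<close>

lemma is_kernel_G:
  assumes f: "f \<in> Hom A X Y" and k: "k \<in> Hom A K X"
  shows "is_kernel A f k \<longleftrightarrow> is_kernel D (FM G f) (FM G k)"
proof -
  have o: "X \<in> Ob A" "K \<in> Ob A" using k A.Hom_Ob by auto
  have z: "zero_arrow A (f \<odot>\<^bsub>A\<^esub> h) \<longleftrightarrow> zero_arrow D (FM G f \<odot>\<^bsub>D\<^esub> FM G h)" if "h \<in> Hom A W X" for h W
    using zero_arrow_G[OF A.Cmp_Hom[OF that f]] G_Cmp[OF that f] by simp
  have u: "(\<exists>!u. u \<in> Hom A W K \<and> k \<odot>\<^bsub>A\<^esub> u = h) \<longleftrightarrow>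
      (\<exists>!u. u \<in> Hom D (FO G W) (FO G K) \<and> FM G k \<odot>\<^bsub>D\<^esub> u = FM G h)" if h: "h \<in> Hom A W X" for h W
  proof (rule ex1_Hom_transfer)
    show "W \<in> Ob A" "K \<in> Ob A" using h A.Hom_Ob o by auto
    show "FM G k \<odot>\<^bsub>D\<^esub> FM G u = FM G h \<longleftrightarrow> k \<odot>\<^bsub>A\<^esub> u = h" if u: "u \<in> Hom A W K" for u
      using G_Cmp[OF u k] faithful[OF A.Cmp_Hom[OF u k] h] by metis
  qed
  have "is_kernel A f k \<longleftrightarrow> zero_arrow D (FM G f \<odot>\<^bsub>D\<^esub> FM G k) \<and>
    (\<forall>W h. h \<in> Hom A W X \<and> zero_arrow D (FM G f \<odot>\<^bsub>D\<^esub> FM G h) \<longrightarrow>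
      (\<exists>!u. u \<in> Hom D (FO G W) (FO G K) \<and> FM G k \<odot>\<^bsub>D\<^esub> u = FM G h))"
    unfolding is_kernel_Hom[OF f k] using z[OF k] z u by blast
  also have "\<dots> \<longleftrightarrow> zero_arrow D (FM G f \<odot>\<^bsub>D\<^esub> FM G k) \<and>
    (\<forall>V h. h \<in> Hom D V (FO G X) \<and> zero_arrow D (FM G f \<odot>\<^bsub>D\<^esub> h) \<longrightarrow>
      (\<exists>!u. u \<in> Hom D V (FO G K) \<and> FM G k \<odot>\<^bsub>D\<^esub> u = h))"
    (is "_ \<and> ?l \<longleftrightarrow> _ \<and> ?r")
  proof -
    have lr: ?r if l: ?l
    proof (intro allI impI)
      fix V h assume h: "h \<in> Hom D V (FO G X) \<and> zero_arrow D (FM G f \<odot>\<^bsub>D\<^esub> h)"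
      then obtain W where W: "W \<in> Ob A" "FO G W = V" using onto D.Hom_Ob by blast
      then obtain h' where h': "h' \<in> Hom A W X" "FM G h' = h" using full[OF W(1) o(1)] h by blast
      then have "\<exists>!u. u \<in> Hom D (FO G W) (FO G K) \<and> FM G k \<odot>\<^bsub>D\<^esub> u = FM G h'"
        using l[rule_format, of h' W] h by simp
      then show "\<exists>!u. u \<in> Hom D V (FO G K) \<and> FM G k \<odot>\<^bsub>D\<^esub> u = h" unfolding h'(2) W(2) .
    qed
    have rl: ?l if r: ?r
    proof (intro allI impI)
      fix W h assume h: "h \<in> Hom A W X \<and> zero_arrow D (FM G f \<odot>\<^bsub>D\<^esub> FM G h)"
      then show "\<exists>!u. u \<in> Hom D (FO G W) (FO G K) \<and> FM G k \<odot>\<^bsub>D\<^esub> u = FM G h"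
        using r[rule_format, of "FM G h" "FO G W"] G_Hom[of h W X] by blast
    qed
    show ?thesis by (rule conj_cong[OF HOL.refl], rule iffI) (erule lr, erule rl)
  qed
  also have "\<dots> \<longleftrightarrow> is_kernel D (FM G f) (FM G k)" unfolding is_kernel_Hom[OF G_Hom[OF f] G_Hom[OF k]] by blast
  finally show ?thesis .
qed

lemma has_kernel_G:
  assumes f: "f \<in> Hom A X Y" and k: "is_kernel D (FM G f) k"
  shows "\<exists>k. is_kernel A f k"
proof -
  have kH: "k \<in> Hom D (Dom D k) (FO G X)" using k G_Hom[OF f] by (auto simp: is_kernel_def Hom_def)
  obtain K where K: "K \<in> Ob A" "FO G K = Dom D k" using onto D.Hom_Ob kH by blast
  obtain k' where k': "k' \<in> Hom A K X" "FM G k' = k" using full[OF K(1), of X k] kH K(2) f A.Hom_Ob by metis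
  then show ?thesis using is_kernel_G[OF f k'(1)] k by blast
qed

lemma ex_kernel_of_G:
  assumes k: "k \<in> Hom A K X"
  shows "(\<exists>f. is_kernel A f k) \<longleftrightarrow> (\<exists>h. is_kernel D h (FM G k))"
proof
  assume "\<exists>f. is_kernel A f k"
  then obtain f where f: "is_kernel A f k" by blast
  have "f \<in> Hom A X (Cod A f)" using f k by (auto simp: is_kernel_def Hom_def)
  then show "\<exists>h. is_kernel D h (FM G k)" using is_kernel_G k f by blast
next
  assume "\<exists>h. is_kernel D h (FM G k)"
  then obtain h where h: "is_kernel D h (FM G k)" by blast
  then have hH: "h \<in> Hom D (FO G X) (Cod D h)" using G_Hom[OF k] by (auto simp: is_kernel_def Hom_def)
  obtain Y where Y: "Y \<in> Ob A" "FO G Y = Cod D h" using onto D.Hom_Ob hH by blast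
  obtain f where f: "f \<in> Hom A X Y" "FM G f = h" using full[of X Y h] Y hH k A.Hom_Ob by metis
  then show "\<exists>f. is_kernel A f k" using is_kernel_G[OF f(1) k] h by blast
qed

lemma is_pullback_G:
  assumes P: "is_pullback A f g p q"
  shows "is_pullback D (FM G f) (FM G g) (FM G p) (FM G q)"
proof -
  define X Y Z P where "X = Dom A f" and "Y = Cod A f" and "Z = Dom A g" and "P = Dom A p"
  have h: "f \<in> Hom A X Y" "g \<in> Hom A Z Y" "p \<in> Hom A P X" "q \<in> Hom A P Z" and e: "f \<odot>\<^bsub>A\<^esub> p = g \<odot>\<^bsub>A\<^esub> q"
    using P by (auto simp: is_pullback_def Hom_def X_def Y_def Z_def P_def)
  have o: "X \<in> Ob A" "Z \<in> Ob A" "P \<in> Ob A" using h A.Hom_Ob by blast+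
  show ?thesis
  proof (rule D.pullbackI[OF G_Hom[OF h(1)] G_Hom[OF h(2)] G_Hom[OF h(3)] G_Hom[OF h(4)]])
    show "FM G f \<odot>\<^bsub>D\<^esub> FM G p = FM G g \<odot>\<^bsub>D\<^esub> FM G q" using G_Cmp[OF h(3,1)] G_Cmp[OF h(4,2)] e by simp
    fix W a b assume a: "a \<in> Hom D W (FO G X)" "b \<in> Hom D W (FO G Z)" "FM G f \<odot>\<^bsub>D\<^esub> a = FM G g \<odot>\<^bsub>D\<^esub> b"
    obtain V where V: "V \<in> Ob A" "FO G V = W" using onto D.Hom_Ob a by blast
    obtain a' where a': "a' \<in> Hom A V X" "FM G a' = a" using full[OF V(1) o(1)] a(1) V(2) by blast
    obtain b' where b': "b' \<in> Hom A V Z" "FM G b' = b" using full[OF V(1) o(2)] a(2) V(2) by blast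
    have "f \<odot>\<^bsub>A\<^esub> a' = g \<odot>\<^bsub>A\<^esub> b'"
      by (rule faithful[OF A.Cmp_Hom[OF a'(1) h(1)] A.Cmp_Hom[OF b'(1) h(2)]])
        (use G_Cmp[OF a'(1) h(1)] G_Cmp[OF b'(1) h(2)] a' b' a(3) in simp)
    then obtain u where u: "u \<in> Hom A V P" "p \<odot>\<^bsub>A\<^esub> u = a'" "q \<odot>\<^bsub>A\<^esub> u = b'"
      using A.pullback_lift[OF P, of a' V b'] a'(1) b'(1) unfolding X_def Z_def P_def by blast
    then show "\<exists>u \<in> Hom D W (FO G P). FM G p \<odot>\<^bsub>D\<^esub> u = a \<and> FM G q \<odot>\<^bsub>D\<^esub> u = b"
      using G_Hom[OF u(1)] G_Cmp[OF u(1) h(3)] G_Cmp[OF u(1) h(4)] a' b' V(2) by metis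
  next
    fix W u v assume u: "u \<in> Hom D W (FO G P)" "v \<in> Hom D W (FO G P)"
      "FM G p \<odot>\<^bsub>D\<^esub> u = FM G p \<odot>\<^bsub>D\<^esub> v" "FM G q \<odot>\<^bsub>D\<^esub> u = FM G q \<odot>\<^bsub>D\<^esub> v"
    obtain V where V: "V \<in> Ob A" "FO G V = W" using onto D.Hom_Ob u by blast
    obtain u' where u': "u' \<in> Hom A V P" "FM G u' = u" using full[OF V(1) o(3)] u(1) V(2) by blast
    obtain v' where v': "v' \<in> Hom A V P" "FM G v' = v" using full[OF V(1) o(3)] u(2) V(2) by blast
    have "p \<odot>\<^bsub>A\<^esub> u' = p \<odot>\<^bsub>A\<^esub> v'"
      by (rule faithful[OF A.Cmp_Hom[OF u'(1) h(3)] A.Cmp_Hom[OF v'(1) h(3)]])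
        (use G_Cmp[OF u'(1) h(3)] G_Cmp[OF v'(1) h(3)] u' v' u(3) in simp)
    moreover have "q \<odot>\<^bsub>A\<^esub> u' = q \<odot>\<^bsub>A\<^esub> v'"
      by (rule faithful[OF A.Cmp_Hom[OF u'(1) h(4)] A.Cmp_Hom[OF v'(1) h(4)]])
        (use G_Cmp[OF u'(1) h(4)] G_Cmp[OF v'(1) h(4)] u' v' u(4) in simp)
    ultimately show "u = v" using A.pullback_unique[OF P, of u' V v'] u' v' P_def by metis
  qed
qed

text \<open>The square is pushed forward to \<open>D\<close>, and strictness of \<open>j\<close> is
  brought back by \<open>ex_kernel_of_G\<close>. With stability in \<open>D\<close> as a hypothesis,
  the statement also applies to the opposite functor, which covers pullbacks of strict
  epimorphisms.\<close>

lemma strict_mono_pushout_transfer: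
  assumes D: "\<And>f g i j. is_pushout D f g i j \<Longrightarrow> \<exists>h. is_kernel D h f \<Longrightarrow> \<exists>h. is_kernel D h j"
    and P: "is_pushout A f g i j" and h: "\<exists>h. is_kernel A h f"
  shows "\<exists>h. is_kernel A h j"
proof -
  have f: "f \<in> Hom A (Dom A f) (Cod A f)" "j \<in> Hom A (Dom A j) (Cod A j)"
    using P by (auto simp: is_pushout_def Hom_def)
  have "is_pushout D (FM G f) (FM G g) (FM G i) (FM G j)"
    using fully_faithful.is_pullback_G[OF fully_faithful_op, of f g i j] P by simp
  then show ?thesis using D h ex_kernel_of_G f by blast
qed

text \<open>Sums and zero arrows of \<open>A\<close> are the lifts of those in \<open>D\<close>;
  each law is checked after applying \<open>G\<close> and concluded by faithfulness.\<close>

lemma preabelian_transfer: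
  assumes "preabelian D pl z"
  shows "\<exists>pl' z'. preabelian A pl' z'"
proof -
  interpret D: preabelian D pl z by fact
  define lft where "lft X Y h = (THE f. f \<in> Hom A X Y \<and> FM G f = h)" for X Y h
  have lft: "lft X Y h \<in> Hom A X Y" "FM G (lft X Y h) = h" if "X \<in> Ob A" "Y \<in> Ob A" "h \<in> Hom D (FO G X) (FO G Y)" for X Y h
    using theI'[OF lift_unique[OF that]] unfolding lft_def by auto
  \<comment> \<open>Addition takes only arrows as arguments, so the hom set in which to lift is read
    off the first summand.\<close>
  define pl' where "pl' f g = lft (Dom A f) (Cod A f) (pl (FM G f) (FM G g))" for f g
  define z' where "z' X Y = lft X Y (z (FO G X) (FO G Y))" for X Y
  have pl': "pl' f g \<in> Hom A X Y" "FM G (pl' f g) = pl (FM G f) (FM G g)" if f: "f \<in> Hom A X Y" "g \<in> Hom A X Y" for f g X Y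
  proof -
    have "Dom A f = X" "Cod A f = Y" using f(1) by (auto simp: Hom_def)
    then show "pl' f g \<in> Hom A X Y" "FM G (pl' f g) = pl (FM G f) (FM G g)"
      using lft[OF A.Hom_Ob(1)[OF f(1)] A.Hom_Ob(2)[OF f(1)] D.pl_Hom[OF G_Hom[OF f(1)] G_Hom[OF f(2)]]]
      by (simp_all add: pl'_def)
  qed
  have z': "z' X Y \<in> Hom A X Y" "FM G (z' X Y) = z (FO G X) (FO G Y)" if "X \<in> Ob A" "Y \<in> Ob A" for X Y
    using lft[OF that D.z_Hom[OF G_Ob G_Ob]] that by (auto simp: z'_def)
  have grp: "comm_group \<lparr>carrier = Hom A X Y, mult = pl', one = z' X Y\<rparr>" if o: "X \<in> Ob A" "Y \<in> Ob A" for X Y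
  proof -
    interpret Q: comm_group "\<lparr>carrier = Hom D (FO G X) (FO G Y), mult = pl, one = z (FO G X) (FO G Y)\<rparr>"
      by (rule D.pl_group[OF G_Ob[OF o(1)] G_Ob[OF o(2)]])
    show ?thesis
    proof (rule comm_groupI, simp_all only: monoid.simps partial_object.simps)
      fix f g h assume a: "f \<in> Hom A X Y" "g \<in> Hom A X Y"
      note b = G_Hom[OF a(1)] G_Hom[OF a(2)]
      show "pl' f g \<in> Hom A X Y" using pl' a by blast
      show "pl' f g = pl' g f"
        by (rule faithful[OF pl'(1)[OF a] pl'(1)[OF a(2,1)]]) (use pl'(2) a Q.m_comm b in simp)
      assume h: "h \<in> Hom A X Y"
      show "pl' (pl' f g) h = pl' f (pl' g h)"
        by (rule faithful[OF pl'(1)[OF pl'(1)[OF a] h] pl'(1)[OF a(1) pl'(1)[OF a(2) h]]])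
          (use pl'(2)[OF pl'(1)[OF a] h] pl'(2)[OF a] pl'(2)[OF a(1) pl'(1)[OF a(2) h]] pl'(2)[OF a(2) h]
            Q.m_assoc b G_Hom[OF h] in simp)
    next
      show z: "z' X Y \<in> Hom A X Y" using z' o by blast
      fix f assume f: "f \<in> Hom A X Y"
      show "pl' (z' X Y) f = f"
        by (rule faithful[OF pl'(1)[OF z f] f]) (use pl'(2)[OF z f] z'(2)[OF o] Q.l_one G_Hom[OF f] in simp)
      obtain d where d: "d \<in> Hom D (FO G X) (FO G Y)" "pl d (FM G f) = z (FO G X) (FO G Y)"
        using D.pl_diff[OF G_Hom[OF f] D.z_Hom[OF G_Ob[OF o(1)] G_Ob[OF o(2)]]] by blast
      obtain g where g: "g \<in> Hom A X Y" "FM G g = d" using full[OF o d(1)] by blast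
      have "pl' g f = z' X Y"
        by (rule faithful[OF pl'(1)[OF g(1) f] z]) (use pl'(2)[OF g(1) f] z'(2)[OF o] g d in simp)
      then show "\<exists>y \<in> Hom A X Y. pl' y f = z' X Y" using g by blast
    qed
  qed
  have "preadditive_with A pl' z'"
    unfolding preadditive_with_def
  proof (intro conjI ballI)
    show "category A" by (rule A.category_axioms)
    show "comm_group \<lparr>carrier = Hom A X Y, mult = pl', one = z' X Y\<rparr>" if "X \<in> Ob A" "Y \<in> Ob A" for X Y
      by (rule grp[OF that])
  next
    fix X Y Z f g h assume f: "f \<in> Hom A X Y" "g \<in> Hom A Y Z" "h \<in> Hom A Y Z"
    note a = A.Cmp_Hom[OF f(1,2)] A.Cmp_Hom[OF f(1,3)]
    show "pl' g h \<odot>\<^bsub>A\<^esub> f = pl' (g \<odot>\<^bsub>A\<^esub> f) (h \<odot>\<^bsub>A\<^esub> f)"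
      by (rule faithful[OF A.Cmp_Hom[OF f(1) pl'(1)[OF f(2,3)]] pl'(1)[OF a]])
        (use pl'(2)[OF a] pl'(2)[OF f(2,3)] G_Cmp[OF f(1) pl'(1)[OF f(2,3)]] G_Cmp[OF f(1,2)] G_Cmp[OF f(1,3)]
          D.pl_Cmp[OF G_Hom[OF f(1)] G_Hom[OF f(2)] G_Hom[OF f(3)]] in simp)
  next
    fix X Y Z f g h assume f: "f \<in> Hom A X Y" "g \<in> Hom A X Y" "h \<in> Hom A Y Z"
    note a = A.Cmp_Hom[OF f(1,3)] A.Cmp_Hom[OF f(2,3)]
    show "h \<odot>\<^bsub>A\<^esub> pl' f g = pl' (h \<odot>\<^bsub>A\<^esub> f) (h \<odot>\<^bsub>A\<^esub> g)"
      by (rule faithful[OF A.Cmp_Hom[OF pl'(1)[OF f(1,2)] f(3)] pl'(1)[OF a]])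
        (use pl'(2)[OF a] pl'(2)[OF f(1,2)] G_Cmp[OF pl'(1)[OF f(1,2)] f(3)] G_Cmp[OF f(1,3)] G_Cmp[OF f(2,3)]
          D.Cmp_pl[OF G_Hom[OF f(1)] G_Hom[OF f(2)] G_Hom[OF f(3)]] in simp)
  qed
  moreover have "\<exists>Z. zero_object A Z"
    using D.zero_ob onto zero_object_G by metis
  moreover have "\<exists>k. is_kernel A f k" if "f \<in> Ar A" for f
    using has_kernel_G[of f "Dom A f" "Cod A f"] D.has_kernel[of "FM G f"] that G_Hom[of f "Dom A f" "Cod A f"]
    by (auto simp: Hom_def)
  moreover have "\<exists>c. is_cokernel A f c" if "f \<in> Ar A" for f
    using fully_faithful.has_kernel_G[OF fully_faithful_op, of f "Cod A f" "Dom A f"] D.has_cokernel[of "FM G f"] that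
      G_Hom[of f "Dom A f" "Cod A f"] by (auto simp: Hom_def)
  moreover have "\<exists>B \<in> Ob A.
           \<exists>i \<in> Hom A X B. \<exists>j \<in> Hom A Y B. \<exists>p \<in> Hom A B X. \<exists>q \<in> Hom A B Y.
             p \<odot>\<^bsub>A\<^esub> i = Ident A X \<and> q \<odot>\<^bsub>A\<^esub> j = Ident A Y \<and>
             p \<odot>\<^bsub>A\<^esub> j = z' Y X \<and> q \<odot>\<^bsub>A\<^esub> i = z' X Y \<and>
             pl' (i \<odot>\<^bsub>A\<^esub> p) (j \<odot>\<^bsub>A\<^esub> q) = Ident A B" if o: "X \<in> Ob A" "Y \<in> Ob A" for X Y
  proof -
    obtain B i j p q where b: "B \<in> Ob D" "i \<in> Hom D (FO G X) B" "j \<in> Hom D (FO G Y) B"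
      "p \<in> Hom D B (FO G X)" "q \<in> Hom D B (FO G Y)"
      "p \<odot>\<^bsub>D\<^esub> i = Ident D (FO G X)" "q \<odot>\<^bsub>D\<^esub> j = Ident D (FO G Y)" "p \<odot>\<^bsub>D\<^esub> j = z (FO G Y) (FO G X)"
      "q \<odot>\<^bsub>D\<^esub> i = z (FO G X) (FO G Y)" "pl (i \<odot>\<^bsub>D\<^esub> p) (j \<odot>\<^bsub>D\<^esub> q) = Ident D B"
      using D.has_biproduct[OF G_Ob[OF o(1)] G_Ob[OF o(2)]] by blast
    obtain V where V: "V \<in> Ob A" "FO G V = B" using onto b(1) by blast
    note b = b[folded V(2)]
    obtain i' where i': "i' \<in> Hom A X V" "FM G i' = i" using full[OF o(1) V(1) b(2)] by blast
    obtain j' where j': "j' \<in> Hom A Y V" "FM G j' = j" using full[OF o(2) V(1) b(3)] by blast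
    obtain p' where p': "p' \<in> Hom A V X" "FM G p' = p" using full[OF V(1) o(1) b(4)] by blast
    obtain q' where q': "q' \<in> Hom A V Y" "FM G q' = q" using full[OF V(1) o(2) b(5)] by blast
    have 1: "p' \<odot>\<^bsub>A\<^esub> i' = Ident A X"
      by (rule faithful[OF A.Cmp_Hom[OF i'(1) p'(1)] A.Ident_Hom[OF o(1)]])
        (use G_Cmp[OF i'(1) p'(1)] G_Ident o i' p' b in simp)
    have 2: "q' \<odot>\<^bsub>A\<^esub> j' = Ident A Y"
      by (rule faithful[OF A.Cmp_Hom[OF j'(1) q'(1)] A.Ident_Hom[OF o(2)]])
        (use G_Cmp[OF j'(1) q'(1)] G_Ident o j' q' b in simp)
    have 3: "p' \<odot>\<^bsub>A\<^esub> j' = z' Y X"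
      by (rule faithful[OF A.Cmp_Hom[OF j'(1) p'(1)] z'(1)[OF o(2,1)]])
        (use G_Cmp[OF j'(1) p'(1)] z'(2) o j' p' b in simp)
    have 4: "q' \<odot>\<^bsub>A\<^esub> i' = z' X Y"
      by (rule faithful[OF A.Cmp_Hom[OF i'(1) q'(1)] z'(1)[OF o]])
        (use G_Cmp[OF i'(1) q'(1)] z'(2) o i' q' b in simp)
    note ip = A.Cmp_Hom[OF p'(1) i'(1)] A.Cmp_Hom[OF q'(1) j'(1)]
    have 5: "pl' (i' \<odot>\<^bsub>A\<^esub> p') (j' \<odot>\<^bsub>A\<^esub> q') = Ident A V"
      by (rule faithful[OF pl'(1)[OF ip] A.Ident_Hom[OF V(1)]])
        (use pl'(2)[OF ip] G_Cmp[OF p'(1) i'(1)] G_Cmp[OF q'(1) j'(1)] G_Ident V i' j' p' q' b in simp)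
    show ?thesis using V(1) i'(1) j'(1) p'(1) q'(1) 1 2 3 4 5 by blast
  qed
  ultimately have "preabelian A pl' z'"
    using A.category_axioms by (intro preabelian.intro preabelian_axioms.intro) blast+
  then show ?thesis by blast
qed

lemma quasi_abelian_transfer:
  assumes "quasi_abelian_category D"
  shows "quasi_abelian_category A"
proof -
  obtain pl z where "preabelian D pl z" using assms unfolding quasi_abelian_category_def pre_abelian_category_iff by blast
  then have "pre_abelian_category A" using preabelian_transfer pre_abelian_category_iff by blast
  moreover have "\<exists>h. is_kernel A h j" if "is_pushout A f g i j" "\<exists>h. is_kernel A h f" for f g i j
    using strict_mono_pushout_transfer[OF _ that] assms unfolding quasi_abelian_category_def by blast
  moreover have "\<exists>h. is_cokernel A h q" if P: "is_pullback A f g p q" "\<exists>h. is_cokernel A h f" for f g p q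
    using fully_faithful.strict_mono_pushout_transfer[OF fully_faithful_op, of f g p q] P assms
    unfolding quasi_abelian_category_def is_pushout_op is_kernel_op by blast
  ultimately show ?thesis unfolding quasi_abelian_category_def by blast
qed

end

section \<open>The homotopy category, trivial torsion pairs and the theorem\<close>

lemma (in twin) Ho_model:
  "quasi_abelian_category (Ho C model)" "equivalent_cats (Ho C model) (full_subcat C (T1 \<inter> F2))"
proof -
  let ?L = "localization C (twin_weq C T1 F2)"
  obtain G J where GJ: "is_functor ?L D G" "is_functor D ?L J"
    "nat_isomorphic ?L ?L (comp_functor J G) id_functor" "nat_isomorphic D D (comp_functor G J) id_functor"
    "\<forall>X \<in> Ob D. \<exists>Y \<in> Ob ?L. FO G Y = X" using Ho_equivalence by blast
  have Ho: "Ho C model = ?L" by (simp add: model_def)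
  show "equivalent_cats (Ho C model) D" unfolding Ho equivalent_cats_def using GJ by blast
  have L: "category ?L" by (rule category_localization[OF Weq_Ar])
  have "fully_faithful ?L D G"
    using L category_full_subcat GJ(1,5) equivalence_faithful[OF GJ(3) L]
      equivalence_full[OF GJ(3) L GJ(4) category_full_subcat GJ(1,2)]
    by (intro fully_faithful.intro fully_faithful_axioms.intro) blast+
  then show "quasi_abelian_category (Ho C model)"
    unfolding Ho using fully_faithful.quasi_abelian_transfer quasi_abelian_D by blast
qed

lemma (in abelian) twin_torsion_pairs_iff: "(T1, F1, T2, F2) \<in> twin_torsion_pairs C \<longleftrightarrow> twin C pl z T1 F1 T2 F2"
  using abelian_axioms by (auto simp: twin_torsion_pairs_def twin_def twin_axioms_def)

text \<open>The smallest torsion class, with the identity of \<open>X\<close> as projection. Its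
  torsion class lies in every other one, so it can stand second in a twin pair with any given
  torsion pair.\<close>

lemma (in abelian) torsion_pair_zero:
  "torsion_pair C {X. zero_object C X} (Ob C)"
proof -
  have iso: "zero_object C Y" if X: "zero_object C X" and Y: "Y \<in> Ob C" "isomorphic C X Y" for X Y
  proof -
    obtain f where f: "f \<in> Hom C X Y" "iso_arrow C f" using Y by (auto simp: isomorphic_def)
    obtain g where g: "g \<in> Hom C Y X" "f \<odot> g = Ident C Y" using iso_arrowE[OF f(2,1)] by metis
    have "g = z Y X" using zero_object_Hom X g by blast
    then have "Ident C Y = z Y Y" using g(2) f(1) Y by (simp add: Hom_def)
    then show ?thesis using Y zero_object_iff by blast
  qed
  have seq: "\<exists>A \<in> {X. zero_object C X}. \<exists>B \<in> Ob C. \<exists>i \<in> Hom C A X. \<exists>p \<in> Hom C X B. short_exact C i p" if X: "X \<in> Ob C" for X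
  proof -
    let ?Z = "zero_ob C" and ?i = "z (zero_ob C) X"
    have i: "?i \<in> Hom C ?Z X" "Ident C X \<odot> ?i = z ?Z X" using z_Hom X zero_ob by auto
    have "is_kernel C (Ident C X) ?i"
    proof (rule kernelI[OF Ident_Hom[OF X] i])
      show "mono_arrow C ?i" by (rule monoI[OF i(1)]) (use zero_object_Hom zero_ob in blast)
      fix W h assume h: "h \<in> Hom C W X" "Ident C X \<odot> h = z W X"
      have W: "W \<in> Ob C" using h Hom_Ob by blast
      have "?i \<odot> z W ?Z = h" using h Ident_left[OF h(1)] W X zero_ob by simp
      then show "\<exists>u \<in> Hom C W ?Z. ?i \<odot> u = h" using z_Hom[OF W zero_ob(2)] by blast
    qed
    moreover have "epi_arrow C (Ident C X)"
      by (rule epiI[OF Ident_Hom[OF X]]) (use Ident_right in metis)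
    ultimately have "short_exact C ?i (Ident C X)" using epi_cokernel_of_kernel by (simp add: short_exact_def)
    then show ?thesis using i zero_ob X Ident_Hom[OF X] by blast
  qed
  have "zero_arrow C f" if "zero_object C X" "f \<in> Hom C X Y" for X Y f
    using zero_object_Hom(2)[OF that] zero_arrow_Hom[OF that(2)] by blast
  then show ?thesis
    unfolding torsion_pair_def using iso seq zero_object_iff by (intro conjI) blast+
qed

lemma (in abelian) torsion_pair_zero': "torsion_pair C (Ob C) {X. zero_object C X}"
  using torsion_pair_op[OF category.category_op[OF category_axioms] abelian.torsion_pair_zero[OF abelian_op]] by simp

theorem theoremD:
  fixes C :: "('o, 'm) cat"
  assumes "abelian_category C"
  shows
    "bij_betw (Phi C) (twin_torsion_pairs C) {M. torsion_model_structure C M} \<and>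
     bij_betw (Psi C) {M. torsion_model_structure C M} (twin_torsion_pairs C) \<and>
     (\<forall>P \<in> twin_torsion_pairs C. Psi C (Phi C P) = P) \<and>
     (\<forall>M. torsion_model_structure C M \<longrightarrow> Phi C (Psi C M) = M) \<and>
     (\<forall>T1 F1 T2 F2 d1 d2.
        (T1, F1, T2, F2) \<in> twin_torsion_pairs C \<and>
        is_torsion_seqs C T1 F1 d1 \<and> is_torsion_seqs C T2 F2 d2 \<longrightarrow>
        nat_isomorphic C (full_subcat C (T1 \<inter> F2))
          (comp_functor (tor_functor C d1) (free_functor C d2))
          (comp_functor (free_functor C d2) (tor_functor C d1)) \<and>
        (\<forall>H. nat_isomorphic C (full_subcat C (T1 \<inter> F2)) H
               (comp_functor (tor_functor C d1) (free_functor C d2)) \<longrightarrow>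
             Phi C (T1, F1, T2, F2) = model_of_seqs C d1 d2 H)) \<and>
     (\<forall>M. torsion_model_structure C M \<longrightarrow> bireflective_model_structure C M) \<and>
     (\<forall>T1 F1 T2 F2 M.
        (T1, F1, T2, F2) \<in> twin_torsion_pairs C \<and> M = Phi C (T1, F1, T2, F2) \<longrightarrow>
        cofibrant_objects C M = T1 \<and>
        fibrant_objects C M = F2 \<and>
        trivial_objects C M = extension_class C T2 F1 \<and>
        quasi_abelian_category (Ho C M) \<and>
        equivalent_cats (Ho C M) (full_subcat C (T1 \<inter> F2))) \<and>
     (\<forall>T F. torsion_pair C T F \<longrightarrow>
        (\<exists>M. torsion_model_structure C M \<and> equivalent_cats (Ho C M) (full_subcat C T)) \<and>
        (\<exists>M. torsion_model_structure C M \<and> equivalent_cats (Ho C M) (full_subcat C F)))"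
proof -
  obtain pl z where "abelian C pl z" using assms abelian_category_iff by blast
  then interpret abelian C pl z .
  have tw: "twin C pl z T1 F1 T2 F2" if "(T1, F1, T2, F2) \<in> twin_torsion_pairs C" for T1 F1 T2 F2
    using that twin_torsion_pairs_iff by blast
  have PhiP: "torsion_model_structure C (Phi C P) \<and> Psi C (Phi C P) = P" if P: "P \<in> twin_torsion_pairs C" for P
  proof -
    obtain T1 F1 T2 F2 where e: "P = (T1, F1, T2, F2)" by (cases P) auto
    show ?thesis
      using twin.Phi_eq twin.Psi_model twin.torsion_model tw P unfolding e by metis
  qed
  have PsiM: "Psi C M \<in> twin_torsion_pairs C \<and> Phi C (Psi C M) = M" if M: "torsion_model_structure C M" for M
  proof -
    obtain CoFib Fib Weq where e: "M = (CoFib, Fib, Weq)" by (cases M) auto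
    obtain T1 F1 T2 F2 where p: "Psi C M = (T1, F1, T2, F2)" by (cases "Psi C M") auto
    show ?thesis
      using torsion_model_structure_twin[OF M[unfolded e] p[unfolded e]] twin.Phi_eq twin_torsion_pairs_iff p e
      by metis
  qed
  have A: "bij_betw (Phi C) (twin_torsion_pairs C) {M. torsion_model_structure C M}"
    by (rule bij_betw_byWitness[where f'="Psi C"]) (use PhiP PsiM in auto)
  have B: "bij_betw (Psi C) {M. torsion_model_structure C M} (twin_torsion_pairs C)"
    by (rule bij_betw_byWitness[where f'="Phi C"]) (use PhiP PsiM in auto)
  have E: "nat_isomorphic C (full_subcat C (T1 \<inter> F2))
          (comp_functor (tor_functor C d1) (free_functor C d2))
          (comp_functor (free_functor C d2) (tor_functor C d1)) \<and>
        (\<forall>H. nat_isomorphic C (full_subcat C (T1 \<inter> F2)) H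
               (comp_functor (tor_functor C d1) (free_functor C d2)) \<longrightarrow>
             Phi C (T1, F1, T2, F2) = model_of_seqs C d1 d2 H)"
    if "(T1, F1, T2, F2) \<in> twin_torsion_pairs C \<and> is_torsion_seqs C T1 F1 d1 \<and> is_torsion_seqs C T2 F2 d2"
    for T1 F1 T2 F2 d1 d2
  proof -
    interpret twin C pl z T1 F1 T2 F2 using tw that by blast
    have d: "is_torsion_seqs C T1 F1 d1" "is_torsion_seqs C T2 F2 d2" using that by auto
    show ?thesis unfolding Phi_eq
      using tor_free_nat_isomorphic[OF d] model_of_seqs_nat_isomorphic[OF d] by simp
  qed
  have bi: "bireflective_model_structure C M" if "torsion_model_structure C M" for M
  proof -
    obtain T1 F1 T2 F2 where p: "Psi C M = (T1, F1, T2, F2)" by (cases "Psi C M") auto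
    interpret twin C pl z T1 F1 T2 F2 using PsiM[OF that] tw p by simp
    have "M = model" using PsiM[OF that] p Phi_eq by simp
    then show ?thesis using bireflective_model by simp
  qed
  have O: "cofibrant_objects C M = T1 \<and> fibrant_objects C M = F2 \<and>
        trivial_objects C M = extension_class C T2 F1 \<and>
        quasi_abelian_category (Ho C M) \<and> equivalent_cats (Ho C M) (full_subcat C (T1 \<inter> F2))"
    if "(T1, F1, T2, F2) \<in> twin_torsion_pairs C \<and> M = Phi C (T1, F1, T2, F2)" for T1 F1 T2 F2 M
  proof -
    interpret twin C pl z T1 F1 T2 F2 using tw that by blast
    have "M = model" using that Phi_eq by simp
    then show ?thesis using cofibrant_model fibrant_model trivial_model Ho_model by simp
  qed
  have R: "(\<exists>M. torsion_model_structure C M \<and> equivalent_cats (Ho C M) (full_subcat C T)) \<and>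
        (\<exists>M. torsion_model_structure C M \<and> equivalent_cats (Ho C M) (full_subcat C F))"
    if TF: "torsion_pair C T F" for T F
  proof -
    interpret torsion C pl z T F using TF by unfold_locales
    let ?O = "{X. zero_object C X}"
    \<comment> \<open>These two completions are chosen for their intersections:
      \<open>T1 \<inter> F2\<close> is \<open>T\<close> for the first twin pair and \<open>F\<close>
      for the second.\<close>
    have "(T, F, ?O, Ob C) \<in> twin_torsion_pairs C" "(Ob C, ?O, T, F) \<in> twin_torsion_pairs C"
      using TF torsion_pair_zero torsion_pair_zero' zero_T T_subset by (auto simp: twin_torsion_pairs_def)
    note this[THEN PhiP] O[OF conjI[OF this(1) HOL.refl]] O[OF conjI[OF this(2) HOL.refl]]
    moreover have "T \<inter> Ob C = T" "Ob C \<inter> F = F" using T_subset F_subset by auto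
    ultimately show ?thesis by metis
  qed
  show ?thesis using A B PhiP PsiM E bi O R by blast
qed

end
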